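(* Let $\mathcal X$ and $\mathcal Y$ be infinite dimensional complex Banach spaces and let $A\in L(\mathcal X)$ and $B\in L(\mathcal Y)$ be such that $A$ and $B^*$ are $a$-isoloid and $a$-Weyl's theorem holds for $A$ and for $B^*$. Let $\rho\colon L(\mathcal Y,\mathcal X)\to L(\mathcal Y,\mathcal X)$ be the generalized derivation defined by $A$ and $B$, i.e. $\rho(U)=AU-UB$ for $U\in L(\mathcal Y,\mathcal X)$. Then the following statements are equivalent. (i) $a$-Weyl's theorem holds for $\rho\in L(L(\mathcal Y,\mathcal X))$. (ii) $a$-Browder's theorem holds for $\rho\in L(L(\mathcal Y,\mathcal X))$.
   Context: $L(\mathcal Y,\mathcal X)$ is the Banach space of bounded linear maps from $\mathcal Y$ to $\mathcal X$, $L(\mathcal X)=L(\mathcal X,\mathcal X)$, and $B^*\in L(\mathcal Y^* )$ is the (Banach space) adjoint of $B$. For $K\subseteq\mathbb C$, $\mathrm{iso}\,K$ is the set of isolated points of $K$. For a bounded operator $T$ on a Banach space, $N(T)$ and $R(T)$ are its null space and range, $\alpha(T)=\dim N(T)$, $\beta(T)$ is the codimension of $R(T)$, $\mathrm{ind}(T)=\alpha(T)-\beta(T)$. $T$ is bounded below if $N(T)=0$ and $R(T)$ is closed; $T$ is upper semi-Fredholm if $R(T)$ is closed and $\alpha(T)<\infty$ (its index may be $-\infty$). $\sigma_a(T)=\{\lambda\in\mathbb C: T-\lambda$ is not bounded below$\}$; $\sigma_{aw}(T)=\{\lambda\in\sigma_a(T): T-\lambda$ is not upper semi-Fredholm or $0<\mathrm{ind}(T-\lambda)\}$.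 The ascent $\mathrm{asc}(T)$ is the smallest integer $a\ge0$ with $N(T^a)=N(T^{a+1})$ ($\infty$ if none exists). $\Pi^a(T)=\{\lambda\in\mathrm{iso}\,\sigma_a(T): a=\mathrm{asc}(T-\lambda)<\infty$ and $R((T-\lambda)^{a+1})$ is closed$\}$, $\Pi_0^a(T)=\{\lambda\in\Pi^a(T):\alpha(T-\lambda)<\infty\}$, $E^a(T)=\{\lambda\in\mathrm{iso}\,\sigma_a(T):0<\alpha(T-\lambda)\}$, $E_0^a(T)=\{\lambda\in E^a(T):\alpha(T-\lambda)<\infty\}$. $T$ is $a$-isoloid if $\mathrm{iso}\,\sigma_a(T)=E^a(T)$. $a$-Browder's theorem holds for $T$ if $\sigma_{aw}(T)=\sigma_a(T)\setminus\Pi_0^a(T)$; $a$-Weyl's theorem holds for $T$ if $\sigma_{aw}(T)=\sigma_a(T)\setminus E_0^a(T)$. *)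

theory Defs
  imports "HOL-Analysis.Analysis"
begin

section \<open>Complex Banach spaces\<close>

text \<open>The fourth axiom ties the complex scalar multiplication to the real one, so that norm,
  topology and completeness are those of the underlying real normed space.\<close>

class complex_normed_vector = real_normed_vector +
  fixes scaleC :: "complex \<Rightarrow> 'a \<Rightarrow> 'a" (infixr \<open>*\<^sub>C\<close> 75)
  assumes scaleC_add_right: "c *\<^sub>C (x + y) = c *\<^sub>C x + c *\<^sub>C y"
    and scaleC_add_left: "(c + d) *\<^sub>C x = c *\<^sub>C x + d *\<^sub>C x"
    and scaleC_scaleC: "c *\<^sub>C d *\<^sub>C x = (c * d) *\<^sub>C x"
    and scaleC_of_real: "complex_of_real r *\<^sub>C x = r *\<^sub>R x"
    and norm_scaleC: "norm (c *\<^sub>C x) = cmod c * norm x"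

class cbanach = complex_normed_vector + banach

interpretation cvs: vector_space "scaleC :: complex \<Rightarrow> 'a \<Rightarrow> 'a::complex_normed_vector"
proof
  show "1 *\<^sub>C x = x" for x :: 'a
    using scaleC_of_real[of 1 x] by simp
qed (simp_all add: scaleC_add_right scaleC_add_left scaleC_scaleC)

lemma bounded_linear_scaleC: "bounded_linear (\<lambda>x::'a::complex_normed_vector. c *\<^sub>C x)"
proof (rule bounded_linear_intro[where K = "cmod c"])
  show "c *\<^sub>C r *\<^sub>R x = r *\<^sub>R c *\<^sub>C x" for r and x :: 'a
    by (metis scaleC_of_real scaleC_scaleC mult.commute)
qed (simp_all add: scaleC_add_right norm_scaleC mult.commute)

instantiation complex :: cbanach
begin

definition scaleC_complex :: "complex \<Rightarrow> complex \<Rightarrow> complex"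
  where "scaleC_complex c z = c * z"

instance
  by standard (simp_all add: scaleC_complex_def algebra_simps norm_mult scaleR_conv_of_real)

end

section \<open>The Banach space of bounded complex-linear maps\<close>

typedef (overloaded) ('a, 'b) cblinfun =
    "{f :: 'a::complex_normed_vector \<Rightarrow>\<^sub>L 'b::complex_normed_vector. \<forall>c x. blinfun_apply f (c *\<^sub>C x) = c *\<^sub>C blinfun_apply f x}"
  morphisms blinfun_of_cblinfun Abs_cblinfun
  by (rule exI[of _ 0]) simp

setup_lifting type_definition_cblinfun

lift_definition cblinfun_apply ::
    "('a::complex_normed_vector, 'b::complex_normed_vector) cblinfun \<Rightarrow> 'a \<Rightarrow> 'b"
  is blinfun_apply .

declare [[coercion cblinfun_apply]]

lemma cblinfun_eqI: "(\<And>x. cblinfun_apply f x = cblinfun_apply g x) \<Longrightarrow> f = g"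
  by transfer (rule blinfun_eqI)

lemma bounded_linear_cblinfun_apply: "bounded_linear (cblinfun_apply f)"
  by transfer (rule blinfun.bounded_linear_right)

lemma cblinfun_apply_scaleC: "cblinfun_apply f (c *\<^sub>C x) = c *\<^sub>C cblinfun_apply f x"
  by transfer simp

instantiation cblinfun :: (complex_normed_vector, complex_normed_vector) complex_normed_vector
begin

lift_definition zero_cblinfun :: "('a, 'b) cblinfun" is 0
  by simp
lift_definition plus_cblinfun :: "('a, 'b) cblinfun \<Rightarrow> ('a, 'b) cblinfun \<Rightarrow> ('a, 'b) cblinfun"
  is "(+)" by (simp add: blinfun.add_left scaleC_add_right)
lift_definition uminus_cblinfun :: "('a, 'b) cblinfun \<Rightarrow> ('a, 'b) cblinfun"
  is uminus by (simp add: blinfun.minus_left)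
lift_definition minus_cblinfun :: "('a, 'b) cblinfun \<Rightarrow> ('a, 'b) cblinfun \<Rightarrow> ('a, 'b) cblinfun"
  is "(-)" by (simp add: blinfun.diff_left cvs.scale_right_diff_distrib)
lift_definition scaleR_cblinfun :: "real \<Rightarrow> ('a, 'b) cblinfun \<Rightarrow> ('a, 'b) cblinfun"
  is "scaleR"
  by (simp add: blinfun.scaleR_left mult.commute flip: scaleC_of_real)
lift_definition scaleC_cblinfun :: "complex \<Rightarrow> ('a, 'b) cblinfun \<Rightarrow> ('a, 'b) cblinfun"
  is "\<lambda>c f. Blinfun (\<lambda>x. c *\<^sub>C blinfun_apply f x)"
  by (simp add: bounded_linear_Blinfun_apply mult.commute
      bounded_linear_compose[OF bounded_linear_scaleC blinfun.bounded_linear_right])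
lift_definition norm_cblinfun :: "('a, 'b) cblinfun \<Rightarrow> real" is norm .

definition dist_cblinfun :: "('a, 'b) cblinfun \<Rightarrow> ('a, 'b) cblinfun \<Rightarrow> real"
  where "dist_cblinfun f g = norm (f - g)"
definition sgn_cblinfun :: "('a, 'b) cblinfun \<Rightarrow> ('a, 'b) cblinfun"
  where "sgn_cblinfun f = scaleR (inverse (norm f)) f"
definition uniformity_cblinfun :: "(('a, 'b) cblinfun \<times> ('a, 'b) cblinfun) filter"
  where [code del]: "uniformity_cblinfun = (INF e\<in>{0<..}. principal {(f, g). dist f g < e})"
definition open_cblinfun :: "('a, 'b) cblinfun set \<Rightarrow> bool"
  where [code del]: "open_cblinfun S = (\<forall>f\<in>S. \<forall>\<^sub>F (f', g) in uniformity. f' = f \<longrightarrow> g \<in> S)"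

lemma scaleC_cblinfun_apply: "cblinfun_apply (c *\<^sub>C f) x = c *\<^sub>C cblinfun_apply f x"
  by transfer
    (simp add: bounded_linear_Blinfun_apply
      bounded_linear_compose[OF bounded_linear_scaleC blinfun.bounded_linear_right])

lemma zero_cblinfun_apply: "cblinfun_apply 0 x = 0"
  by transfer simp

lemma cblinfun_apply_add: "cblinfun_apply (f + g) x = cblinfun_apply f x + cblinfun_apply g x"
  by transfer (simp add: blinfun.add_left)

lemma scaleR_cblinfun_apply: "cblinfun_apply (r *\<^sub>R f) x = r *\<^sub>R cblinfun_apply f x"
  by transfer (simp add: blinfun.scaleR_left)

instance
proof
  fix f g h :: "('a, 'b) cblinfun" and r s :: real and c d :: complex
  show "f + g + h = f + (g + h)" "f + g = g + f" "0 + f = f" "- f + f = 0" "f - g = f + - g"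
    by (transfer; simp)+
  show "r *\<^sub>R (f + g) = r *\<^sub>R f + r *\<^sub>R g" "(r + s) *\<^sub>R f = r *\<^sub>R f + s *\<^sub>R f"
    "r *\<^sub>R s *\<^sub>R f = (r * s) *\<^sub>R f" "1 *\<^sub>R f = f"
    by (transfer; simp add: scaleR_add_right scaleR_add_left)+
  show "dist f g = norm (f - g)" "sgn f = inverse (norm f) *\<^sub>R f"
    by (simp_all add: dist_cblinfun_def sgn_cblinfun_def)
  show "norm f = 0 \<longleftrightarrow> f = 0" "norm (f + g) \<le> norm f + norm g" "norm (r *\<^sub>R f) = \<bar>r\<bar> * norm f"
    by (transfer; simp add: norm_triangle_ineq)+
  show "(uniformity :: (('a, 'b) cblinfun \<times> ('a, 'b) cblinfun) filter)
      = (INF e\<in>{0<..}. principal {(x, y). dist x y < e})"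
    by (rule uniformity_cblinfun_def)
  show "open S = (\<forall>x\<in>S. \<forall>\<^sub>F (x', y) in uniformity. x' = x \<longrightarrow> y \<in> S)"
    for S :: "('a, 'b) cblinfun set"
    by (rule open_cblinfun_def)
  show "c *\<^sub>C (f + g) = c *\<^sub>C f + c *\<^sub>C g" "(c + d) *\<^sub>C f = c *\<^sub>C f + d *\<^sub>C f"
    "c *\<^sub>C d *\<^sub>C f = (c * d) *\<^sub>C f" "complex_of_real r *\<^sub>C f = r *\<^sub>R f"
    by (rule cblinfun_eqI; simp add: scaleC_cblinfun_apply cblinfun_apply_add scaleR_cblinfun_apply
        scaleC_add_right scaleC_add_left scaleC_of_real)+
  show "norm (c *\<^sub>C f) = cmod c * norm f"
  proof -
    have le: "norm (e *\<^sub>C k) \<le> cmod e * norm k" for e and k :: "('a, 'b) cblinfun"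
    proof transfer
      fix e and k :: "'a \<Rightarrow>\<^sub>L 'b"
      have "norm (e *\<^sub>C blinfun_apply k x) \<le> cmod e * norm k * norm x" for x
        by (simp add: norm_scaleC mult.assoc mult_left_mono norm_blinfun)
      then show "norm (Blinfun (\<lambda>x. e *\<^sub>C blinfun_apply k x)) \<le> cmod e * norm k"
        by (intro norm_blinfun_bound)
          (simp_all add: bounded_linear_Blinfun_apply
            bounded_linear_compose[OF bounded_linear_scaleC blinfun.bounded_linear_right])
    qed
    show ?thesis
    proof (cases "c = 0")
      case True
      have "0 *\<^sub>C f = 0"
        by (rule cblinfun_eqI) (simp add: scaleC_cblinfun_apply zero_cblinfun_apply)
      moreover have "norm (0 :: ('a, 'b) cblinfun) = 0"
        by transfer simp
      ultimately show ?thesis using True by simp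
    next
      case False
      have "inverse c *\<^sub>C c *\<^sub>C f = f"
        using False by (intro cblinfun_eqI) (simp add: scaleC_cblinfun_apply)
      with le[of "inverse c" "c *\<^sub>C f"] have "norm f \<le> norm (c *\<^sub>C f) / cmod c"
        by (simp add: norm_inverse divide_inverse mult.commute)
      with False le[of c f] show ?thesis
        by (simp add: field_simps)
    qed
  qed
qed

end

lemma cblinfun_apply_diff: "cblinfun_apply (f - g) x = cblinfun_apply f x - cblinfun_apply g x"
  by transfer (simp add: blinfun.diff_left)

lemma norm_cblinfun: "norm (cblinfun_apply f x) \<le> norm f * norm x"
  by transfer (rule norm_blinfun)

lemma norm_cblinfun_eq_onorm: "norm f = onorm (cblinfun_apply f)"
  by transfer (rule norm_blinfun.rep_eq)

instance cblinfun :: (complex_normed_vector, cbanach) cbanach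
proof
  fix X :: "nat \<Rightarrow> ('a, 'b) cblinfun"
  assume X: "Cauchy X"
  have dist: "dist (blinfun_of_cblinfun f) (blinfun_of_cblinfun g) = dist f g"
    for f g :: "('a, 'b) cblinfun"
    by (simp add: dist_norm norm_cblinfun.rep_eq minus_cblinfun.rep_eq)
  from X have "Cauchy (\<lambda>n. blinfun_of_cblinfun (X n))"
    by (simp add: Cauchy_def dist)
  then obtain L where L: "(\<lambda>n. blinfun_of_cblinfun (X n)) \<longlonglongrightarrow> L"
    by (meson Cauchy_convergent_iff convergent_def)
  have lim: "(\<lambda>n. blinfun_apply (blinfun_of_cblinfun (X n)) x) \<longlonglongrightarrow> blinfun_apply L x" for x
    by (intro tendsto_intros L)
  have "blinfun_apply L (c *\<^sub>C x) = c *\<^sub>C blinfun_apply L x" for c x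
  proof (rule LIMSEQ_unique[OF lim])
    have "(\<lambda>n. c *\<^sub>C blinfun_apply (blinfun_of_cblinfun (X n)) x) \<longlonglongrightarrow> c *\<^sub>C blinfun_apply L x"
      by (rule bounded_linear.tendsto[OF bounded_linear_scaleC lim])
    then show "(\<lambda>n. blinfun_apply (blinfun_of_cblinfun (X n)) (c *\<^sub>C x)) \<longlonglongrightarrow> c *\<^sub>C blinfun_apply L x"
      by (simp flip: cblinfun_apply.rep_eq add: cblinfun_apply_scaleC)
  qed
  then have "L = blinfun_of_cblinfun (Abs_cblinfun L)"
    by (simp add: Abs_cblinfun_inverse)
  with L have "X \<longlonglongrightarrow> Abs_cblinfun L"
    by (metis (no_types, lifting) dist lim_sequentially)
  then show "convergent X"
    by (auto simp: convergent_def)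
qed

definition CBlinfun :: "('a::complex_normed_vector \<Rightarrow> 'b::complex_normed_vector) \<Rightarrow> ('a, 'b) cblinfun"
  where "CBlinfun f = Abs_cblinfun (Blinfun f)"

lemma CBlinfun_apply:
  assumes "bounded_linear f" and "\<And>c x. f (c *\<^sub>C x) = c *\<^sub>C f x"
  shows "cblinfun_apply (CBlinfun f) = f"
  using assms
  by (simp add: CBlinfun_def cblinfun_apply.rep_eq Abs_cblinfun_inverse bounded_linear_Blinfun_apply)

definition cblinfun_id :: "('a::complex_normed_vector, 'a) cblinfun"
  where "cblinfun_id = CBlinfun (\<lambda>x. x)"

lemma cblinfun_id_apply: "cblinfun_apply cblinfun_id x = x"
  by (simp add: cblinfun_id_def CBlinfun_apply bounded_linear_ident)

definition cblinfun_compose ::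
    "('b::complex_normed_vector, 'c::complex_normed_vector) cblinfun \<Rightarrow>
      ('a::complex_normed_vector, 'b) cblinfun \<Rightarrow> ('a, 'c) cblinfun" (infixl \<open>o\<^sub>C\<close> 67)
  where "f o\<^sub>C g = CBlinfun (\<lambda>x. f (g x))"

lemma cblinfun_compose_apply: "cblinfun_apply (f o\<^sub>C g) x = f (g x)"
  by (simp add: cblinfun_compose_def CBlinfun_apply cblinfun_apply_scaleC
      bounded_linear_compose[OF bounded_linear_cblinfun_apply bounded_linear_cblinfun_apply])

lemma norm_cblinfun_compose: "norm (f o\<^sub>C g) \<le> norm f * norm g"
  unfolding norm_cblinfun_eq_onorm
  using onorm_compose[OF bounded_linear_cblinfun_apply bounded_linear_cblinfun_apply, of f g]
  by (simp add: cblinfun_compose_apply[abs_def] comp_def)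

lemma bounded_linear_cblinfun_compose_right: "bounded_linear (\<lambda>g. f o\<^sub>C g)"
proof (rule bounded_linear_intro[where K = "norm f"])
  show "norm (f o\<^sub>C g) \<le> norm g * norm f" for g
    using norm_cblinfun_compose[of f g] by (simp add: mult.commute)
qed (auto intro!: cblinfun_eqI simp: cblinfun_compose_apply cblinfun_apply_add scaleR_cblinfun_apply
      linear_add linear_scale bounded_linear.linear[OF bounded_linear_cblinfun_apply])

lemma bounded_linear_cblinfun_compose_left: "bounded_linear (\<lambda>f. f o\<^sub>C g)"
proof (rule bounded_linear_intro[where K = "norm g"])
  show "norm (f o\<^sub>C g) \<le> norm f * norm g" for f
    by (rule norm_cblinfun_compose)
qed (auto intro!: cblinfun_eqI simp: cblinfun_compose_apply cblinfun_apply_add scaleR_cblinfun_apply)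

lemma cblinfun_compose_scaleC_right: "f o\<^sub>C (c *\<^sub>C g) = c *\<^sub>C (f o\<^sub>C g)"
  by (rule cblinfun_eqI)
    (simp add: cblinfun_compose_apply scaleC_cblinfun_apply cblinfun_apply_scaleC)

lemma cblinfun_compose_scaleC_left: "(c *\<^sub>C f) o\<^sub>C g = c *\<^sub>C (f o\<^sub>C g)"
  by (rule cblinfun_eqI) (simp add: cblinfun_compose_apply scaleC_cblinfun_apply)

definition banach_adjoint ::
    "('a::complex_normed_vector, 'b::complex_normed_vector) cblinfun \<Rightarrow>
      (('b, complex) cblinfun, ('a, complex) cblinfun) cblinfun"
  where "banach_adjoint B = CBlinfun (\<lambda>\<phi>. \<phi> o\<^sub>C B)"

lemma banach_adjoint_apply: "banach_adjoint B \<phi> = \<phi> o\<^sub>C B"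
  by (simp add: banach_adjoint_def CBlinfun_apply bounded_linear_cblinfun_compose_left
      cblinfun_compose_scaleC_left)

definition generalized_derivation ::
    "('x::complex_normed_vector, 'x) cblinfun \<Rightarrow> ('y::complex_normed_vector, 'y) cblinfun \<Rightarrow>
      (('y, 'x) cblinfun, ('y, 'x) cblinfun) cblinfun"
  where "generalized_derivation A B = CBlinfun (\<lambda>U. A o\<^sub>C U - U o\<^sub>C B)"

lemma generalized_derivation_apply: "generalized_derivation A B U = A o\<^sub>C U - U o\<^sub>C B"
  by (simp add: generalized_derivation_def CBlinfun_apply bounded_linear_sub
      bounded_linear_cblinfun_compose_left bounded_linear_cblinfun_compose_right
      cblinfun_compose_scaleC_left cblinfun_compose_scaleC_right cvs.scale_right_diff_distrib)

section \<open>Dimension and codimension\<close>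

definition cdim :: "'a::complex_normed_vector set \<Rightarrow> enat"
  where "cdim S = (if \<exists>B. finite B \<and> cvs.span B = S then enat (cvs.dim S) else \<infinity>)"

text \<open>The dimension of the quotient by \<open>S\<close>: the least number of vectors spanning the whole space
  modulo \<open>S\<close> (the infimum of the empty set is \<open>\<infinity>\<close>). See \<open>ccodim_eq_cdim_complement\<close> below.\<close>

definition ccodim :: "'a::complex_normed_vector set \<Rightarrow> enat"
  where "ccodim S = (INF B\<in>{B. finite B \<and> cvs.span (S \<union> B) = UNIV}. enat (card B))"

lemma ccodim_eq_cdim_complement:
  fixes S W :: "'a::complex_normed_vector set"
  assumes S: "cvs.subspace S" and W: "cvs.subspace W"
    and int: "S \<inter> W = {0}" and sum: "\<And>x. \<exists>s\<in>S. \<exists>w\<in>W. x = s + w"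
  shows "ccodim S = cdim W"
proof (rule antisym)
  show "ccodim S \<le> cdim W"
  proof (cases "\<exists>B. finite B \<and> cvs.span B = W")
    case True
    then obtain B0 where B0: "finite B0" "cvs.span B0 = W" by blast
    obtain B where B: "B \<subseteq> W" "cvs.independent B" "W \<subseteq> cvs.span B" "card B = cvs.dim W"
      using cvs.basis_exists by blast
    have fin: "finite B"
      using cvs.independent_span_bound[OF B0(1) B(2)] B(1) B0(2) by blast
    have "x \<in> cvs.span (S \<union> B)" for x
    proof -
      obtain s w where sw: "s \<in> S" "w \<in> W" "x = s + w" using sum[of x] by blast
      have "s \<in> cvs.span (S \<union> B)" using sw(1) by (simp add: cvs.span_base)
      moreover have "w \<in> cvs.span (S \<union> B)"
        using sw(2) B(3) cvs.span_mono[of B "S \<union> B"] by blast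
      ultimately show ?thesis unfolding sw(3) by (rule cvs.span_add)
    qed
    then have "ccodim S \<le> enat (card B)"
      unfolding ccodim_def using fin by (intro INF_lower) auto
    with True B(4) show ?thesis by (simp add: cdim_def)
  next
    case False
    then show ?thesis by (simp only: cdim_def if_False enat_ord_simps)
  qed
  show "cdim W \<le> ccodim S"
    unfolding ccodim_def
  proof (rule INF_greatest)
    fix B assume "B \<in> {B. finite B \<and> cvs.span (S \<union> B) = UNIV}"
    then have fin: "finite B" and sp: "cvs.span (S \<union> B) = UNIV" by auto
    have "\<forall>x. \<exists>u. u \<in> W \<and> x - u \<in> S"
    proof
      fix x
      obtain v u where "v \<in> S" "u \<in> W" "x = v + u" using sum[of x] by blast
      then show "\<exists>u. u \<in> W \<and> x - u \<in> S" by (intro exI[of _ u]) simp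
    qed
    from choice[OF this] obtain w where w: "\<And>x. w x \<in> W" "\<And>x. x - w x \<in> S" by blast
    have "x \<in> cvs.span (S \<union> w ` B)" for x
    proof -
      have "S \<union> B \<subseteq> cvs.span (S \<union> w ` B)"
      proof -
        have "b \<in> cvs.span (S \<union> w ` B)" if "b \<in> B" for b
        proof -
          have "(b - w b) + w b \<in> cvs.span (S \<union> w ` B)"
            using that w(2)[of b] by (intro cvs.span_add cvs.span_base) auto
          then show ?thesis by simp
        qed
        then show ?thesis by (auto intro: cvs.span_base)
      qed
      then have "cvs.span (S \<union> B) \<subseteq> cvs.span (S \<union> w ` B)"
        by (simp add: cvs.span_minimal)
      then show ?thesis using sp by blast
    qed
    then have dec: "\<exists>a b. x = a + b \<and> a \<in> S \<and> b \<in> cvs.span (w ` B)" for x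
      using S unfolding cvs.span_Un cvs.span_eq_iff[symmetric] by fastforce
    have spW: "cvs.span (w ` B) \<subseteq> W"
      using w(1) W by (intro cvs.span_minimal) auto
    have "W \<subseteq> cvs.span (w ` B)"
    proof -
      have "x \<in> cvs.span (w ` B)" if "x \<in> W" for x
      proof -
        obtain a b where ab: "x = a + b" "a \<in> S" "b \<in> cvs.span (w ` B)"
          using dec[of x] by blast
        then have "x - b \<in> W" using cvs.subspace_diff[OF W that] spW by blast
        then have "a \<in> S \<inter> W" using ab by simp
        then show ?thesis using int ab by simp
      qed
      then show ?thesis by blast
    qed
    with spW have eq: "cvs.span (w ` B) = W" by simp
    then have "cvs.dim W \<le> card (w ` B)"
      using cvs.dim_le_card[of W "w ` B"] fin by simp
    also have "\<dots> \<le> card B" by (rule card_image_le[OF fin])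
    finally show "cdim W \<le> enat (card B)"
      using eq fin by (auto simp: cdim_def)
  qed
qed

section \<open>Fredholm and spectral notions\<close>

text \<open>In the usual notation, \<open>approx_spectrum\<close> is \<open>\<sigma>\<^sub>a\<close>, \<open>weyl_approx_spectrum\<close> is \<open>\<sigma>\<^sub>a\<^sub>w\<close>,
  \<open>left_poles\<close> and \<open>left_poles_finite\<close> are \<open>\<Pi>\<^sup>a\<close> and \<open>\<Pi>\<^sub>0\<^sup>a\<close>, and \<open>iso_approx_eigenvalues\<close> and
  \<open>iso_approx_eigenvalues_finite\<close> are \<open>E\<^sup>a\<close> and \<open>E\<^sub>0\<^sup>a\<close>.\<close>

definition null_space :: "('a \<Rightarrow> 'b::zero) \<Rightarrow> 'a set"
  where "null_space f = {x. f x = 0}"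

definition nullity :: "('a::complex_normed_vector, 'a) cblinfun \<Rightarrow> enat"
  where "nullity T = cdim (null_space T)"

definition defect :: "('a::complex_normed_vector, 'a) cblinfun \<Rightarrow> enat"
  where "defect T = ccodim (range T)"

text \<open>Only meaningful if \<open>nullity T\<close> or \<open>defect T\<close> is finite.\<close>

definition fredholm_index :: "('a::complex_normed_vector, 'a) cblinfun \<Rightarrow> ereal"
  where "fredholm_index T = ereal_of_enat (nullity T) - ereal_of_enat (defect T)"

definition bounded_below :: "('a::complex_normed_vector, 'a) cblinfun \<Rightarrow> bool"
  where "bounded_below T \<longleftrightarrow> null_space T = {0} \<and> closed (range T)"

definition upper_semi_fredholm :: "('a::complex_normed_vector, 'a) cblinfun \<Rightarrow> bool"
  where "upper_semi_fredholm T \<longleftrightarrow> closed (range T) \<and> nullity T < \<infinity>"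

definition shift :: "('a::complex_normed_vector, 'a) cblinfun \<Rightarrow> complex \<Rightarrow> ('a, 'a) cblinfun"
  where "shift T \<mu> = T - \<mu> *\<^sub>C cblinfun_id"

definition approx_spectrum :: "('a::complex_normed_vector, 'a) cblinfun \<Rightarrow> complex set"
  where "approx_spectrum T = {\<mu>. \<not> bounded_below (shift T \<mu>)}"

definition weyl_approx_spectrum :: "('a::complex_normed_vector, 'a) cblinfun \<Rightarrow> complex set"
  where "weyl_approx_spectrum T = {\<mu> \<in> approx_spectrum T.
    \<not> upper_semi_fredholm (shift T \<mu>) \<or> 0 < fredholm_index (shift T \<mu>)}"

definition iso :: "complex set \<Rightarrow> complex set"
  where "iso K = {\<mu>. \<mu> isolated_in K}"

definition ascent :: "('a::complex_normed_vector, 'a) cblinfun \<Rightarrow> enat"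
  where "ascent T =
    (if \<exists>a. null_space (cblinfun_apply T ^^ a) = null_space (cblinfun_apply T ^^ (a + 1))
     then enat (LEAST a. null_space (cblinfun_apply T ^^ a) = null_space (cblinfun_apply T ^^ (a + 1))) else \<infinity>)"

definition left_poles :: "('a::complex_normed_vector, 'a) cblinfun \<Rightarrow> complex set"
  where "left_poles T = {\<mu> \<in> iso (approx_spectrum T).
    \<exists>a. ascent (shift T \<mu>) = enat a \<and> closed (range (cblinfun_apply (shift T \<mu>) ^^ (a + 1)))}"

definition left_poles_finite :: "('a::complex_normed_vector, 'a) cblinfun \<Rightarrow> complex set"
  where "left_poles_finite T = {\<mu> \<in> left_poles T. nullity (shift T \<mu>) < \<infinity>}"

definition iso_approx_eigenvalues :: "('a::complex_normed_vector, 'a) cblinfun \<Rightarrow> complex set"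
  where "iso_approx_eigenvalues T = {\<mu> \<in> iso (approx_spectrum T). 0 < nullity (shift T \<mu>)}"

definition iso_approx_eigenvalues_finite :: "('a::complex_normed_vector, 'a) cblinfun \<Rightarrow> complex set"
  where "iso_approx_eigenvalues_finite T =
    {\<mu> \<in> iso_approx_eigenvalues T. nullity (shift T \<mu>) < \<infinity>}"

definition a_isoloid :: "('a::complex_normed_vector, 'a) cblinfun \<Rightarrow> bool"
  where "a_isoloid T \<longleftrightarrow> iso (approx_spectrum T) = iso_approx_eigenvalues T"

definition a_browder :: "('a::complex_normed_vector, 'a) cblinfun \<Rightarrow> bool"
  where "a_browder T \<longleftrightarrow> weyl_approx_spectrum T = approx_spectrum T - left_poles_finite T"

definition a_weyl :: "('a::complex_normed_vector, 'a) cblinfun \<Rightarrow> bool"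
  where "a_weyl T \<longleftrightarrow>
    weyl_approx_spectrum T = approx_spectrum T - iso_approx_eigenvalues_finite T"

end

theory Submission
  imports Defs "HOL-Library.Function_Algebras"
begin

text \<open>Write \<open>\<rho>\<close> for the generalized derivation. Always \<open>\<Pi>\<^sub>0\<^sup>a(\<rho>) \<subseteq> E\<^sub>0\<^sup>a(\<rho>)\<close>, and under the
  hypotheses on \<open>A\<close> and \<open>B\<^sup>*\<close> the two sets agree, which makes the two properties the same equation.

  Let \<open>\<zeta> \<in> E\<^sub>0\<^sup>a(\<rho>)\<close>. If \<open>\<zeta> = \<mu> - \<nu>\<close> with \<open>\<mu> \<in> \<sigma>\<^sub>a(A)\<close> and \<open>\<nu> \<in> \<sigma>\<^sub>a(B\<^sup>*)\<close>, then rank-one operators show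
  that \<open>\<mu>\<close> and \<open>\<nu>\<close> are isolated and, both being eigenvalues, have finite multiplicity, so \<open>A - \<mu>\<close>
  and \<open>B\<^sup>* - \<nu>\<close> are upper semi-Fredholm by \<open>a\<close>-Weyl's theorem. If \<open>\<rho> - \<zeta>\<close> did not have closed range,
  there would be bounded \<open>U\<^sub>n\<close> staying away from \<open>N(\<rho> - \<zeta>)\<close> with \<open>(\<rho> - \<zeta>) U\<^sub>n \<rightarrow> 0\<close>, and
  \<open>U \<mapsto> A U\<close> would have an approximate eigenvalue \<open>\<mu>\<close> on the space of such sequences modulo
  \<open>N(\<rho> - \<zeta>)\<close>. Then \<open>(A - \<mu>) U\<^sub>n\<close> and \<open>U\<^sub>n (B - \<nu>)\<close> with \<open>\<nu> = \<mu> - \<zeta>\<close> are relatively compact, and in each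
  of the cases \<open>\<mu> \<notin> \<sigma>\<^sub>a(A)\<close>, \<open>\<nu> \<notin> \<sigma>\<^sub>a(B\<^sup>*)\<close>, or both semi-Fredholm, a subsequence of \<open>U\<^sub>n\<close>
  converges into \<open>N(\<rho> - \<zeta>)\<close>, a contradiction. So \<open>\<rho> - \<zeta>\<close> is upper semi-Fredholm, and since \<open>\<zeta>\<close> is
  isolated in \<open>\<sigma>\<^sub>a(\<rho>)\<close> it has finite ascent.

  The approximate eigenvalue exists by an argument which needs neither completeness nor
  surjectivity: if \<open>\<parallel>(L - \<mu>) x\<parallel> \<ge> c \<parallel>x\<parallel>\<close> for all \<open>\<mu>\<close>, then averages over roots of unity show that an
  eventual bound \<open>\<parallel>L\<^sup>n\<parallel> \<le> t\<^sup>n\<close> improves to \<open>\<parallel>L\<^sup>n\<parallel> \<le> (t - \<eta>)\<^sup>n\<close> with \<open>\<eta>\<close> independent of \<open>t\<close>,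
  whereas \<open>\<parallel>L\<^sup>n x\<parallel> \<ge> c\<^sup>n \<parallel>x\<parallel>\<close>.\<close>

section \<open>Approximate eigenvalues in seminormed spaces\<close>

text \<open>The seminorm \<open>q\<close> need not be definite and is constrained only on
  \<open>E\<close>, and completeness is not assumed: later \<open>E\<close> is a set of sequences
  inside the type of all sequences. \<open>K\<close> is positive because it occurs in a
  denominator.\<close>

locale seminormed_operator = vector_space scale
  for scale :: "complex \<Rightarrow> 'e::ab_group_add \<Rightarrow> 'e" (infixr \<open>*s\<close> 75) +
  fixes E :: "'e set" and q :: "'e \<Rightarrow> real" and L :: "'e \<Rightarrow> 'e" and K :: real
  assumes subspace_E: "subspace E"
    and L_add: "L (x + y) = L x + L y"
    and L_scale: "L (c *s x) = c *s L x"
    and L_mem: "x \<in> E \<Longrightarrow> L x \<in> E"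
    and q_add: "x \<in> E \<Longrightarrow> y \<in> E \<Longrightarrow> q (x + y) \<le> q x + q y"
    and q_scale: "x \<in> E \<Longrightarrow> q (c *s x) = cmod c * q x"
    and K_pos: "0 < K"
    and q_L: "x \<in> E \<Longrightarrow> q (L x) \<le> K * q x"
begin

section \<open>Elementary estimates for the seminorm and for powers of the operator\<close>

lemmas E_closed = subspace_0[OF subspace_E] subspace_add[OF subspace_E]
  subspace_scale[OF subspace_E] subspace_diff[OF subspace_E] subspace_sum[OF subspace_E] L_mem

lemma L_diff: "L (x - y) = L x - L y"
  by (metis L_add add_diff_cancel_right' diff_add_cancel)

lemma L_zero: "L 0 = 0"
  using L_diff[of 0 0] by simp

lemma L_sum: "L (sum f I) = (\<Sum>i\<in>I. L (f i))"
  by (induction I rule: infinite_finite_induct) (simp_all add: L_zero L_add)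

lemma q_zero: "q 0 = 0"
  using q_scale[of 0 0] E_closed by simp

lemma q_minus: "x \<in> E \<Longrightarrow> q (- x) = q x"
  using q_scale[of x "-1"] by simp

lemma q_diff: "x \<in> E \<Longrightarrow> y \<in> E \<Longrightarrow> q (x - y) \<le> q x + q y"
  using q_add[of x "-y"] q_minus[of y] subspace_neg[OF subspace_E] by simp

lemma q_nonneg: "x \<in> E \<Longrightarrow> 0 \<le> q x"
  using q_diff[of x x] q_zero by simp

lemma q_sum: "(\<And>i. i \<in> I \<Longrightarrow> f i \<in> E) \<Longrightarrow> q (sum f I) \<le> (\<Sum>i\<in>I. q (f i))"
proof (induction I rule: infinite_finite_induct)
  case (insert i I)
  have "q (sum f (insert i I)) \<le> q (f i) + q (sum f I)"
    using insert q_add[of "f i" "sum f I"] E_closed(5)[of I f] by simp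
  then show ?case using insert by force
qed (simp_all add: q_zero)

lemma L_pow_mem: "x \<in> E \<Longrightarrow> (L ^^ n) x \<in> E"
  by (induction n) (simp_all add: L_mem)

lemma L_pow_diff: "(L ^^ n) (x - y) = (L ^^ n) x - (L ^^ n) y"
  by (induction n) (simp_all add: L_diff)

lemma L_pow_scale: "(L ^^ n) (c *s x) = c *s (L ^^ n) x"
  by (induction n) (simp_all add: L_scale)

lemma q_L_pow: "x \<in> E \<Longrightarrow> q ((L ^^ n) x) \<le> K ^ n * q x"
proof (induction n)
  case (Suc n)
  then have "q ((L ^^ Suc n) x) \<le> K * q ((L ^^ n) x)"
    using q_L[OF L_pow_mem[OF Suc.prems, of n]] by simp
  also have "\<dots> \<le> K * (K ^ n * q x)"
    using Suc K_pos by (intro mult_left_mono) auto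
  finally show ?case by (simp add: mult.assoc)
qed simp

text \<open>The polynomial quotient of \<open>L ^^ n - a ^ n\<close> by \<open>L - a\<close>, see
  \<open>cofactor_factor\<close>. Up to the first of these factors it stands in for the resolvent at
  \<open>a\<close>, which need not exist.\<close>

definition cofactor :: "nat \<Rightarrow> complex \<Rightarrow> 'e \<Rightarrow> 'e"
  where "cofactor n a x = (\<Sum>j<n. a ^ j *s (L ^^ (n - 1 - j)) x)"

lemma cofactor_mem: "x \<in> E \<Longrightarrow> cofactor n a x \<in> E"
  unfolding cofactor_def by (intro E_closed(5) E_closed(3) L_pow_mem)

lemma cofactor_Suc: "cofactor (Suc n) a x = (L ^^ n) x + a *s cofactor n a x"
  unfolding cofactor_def
  by (subst sum.lessThan_Suc_shift) (simp add: scale_sum_right)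

lemma cofactor_factor: "L (cofactor n a x) - a *s cofactor n a x = (L ^^ n) x - a ^ n *s x"
proof (induction n)
  case 0
  then show ?case by (simp add: cofactor_def L_zero)
next
  case (Suc n)
  have "L (cofactor (Suc n) a x) - a *s cofactor (Suc n) a x
      = (L ^^ Suc n) x - a *s (L ^^ n) x + a *s (L (cofactor n a x) - a *s cofactor n a x)"
    by (simp add: cofactor_Suc L_add L_scale algebra_simps)
  then show ?case by (simp add: Suc algebra_simps)
qed

lemma cofactor_diff: "cofactor n a (x - y) = cofactor n a x - cofactor n a y"
  unfolding cofactor_def by (simp add: L_pow_diff scale_right_diff_distrib sum_subtractf)

lemma cofactor_scale: "cofactor n a (c *s x) = c *s cofactor n a x"
  unfolding cofactor_def by (simp add: L_pow_scale scale_sum_right mult.commute)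

lemma cofactor_L: "cofactor n a (L x) = L (cofactor n a x)"
  unfolding cofactor_def by (simp add: L_sum L_scale funpow_swap1)

lemma cofactor_sum: "cofactor n a (sum f I) = (\<Sum>i\<in>I. cofactor n a (f i))"
proof (induction I rule: infinite_finite_induct)
  case (insert i I)
  then show ?case
    using cofactor_diff[of n a "f i + sum f I" "sum f I"] by (simp add: algebra_simps)
qed (use cofactor_scale[of n a 0] in auto)

lemma cofactor_L_pow: "cofactor n a ((L ^^ j) x) = (L ^^ j) (cofactor n a x)"
  by (induction j) (simp_all add: cofactor_L)

lemma cofactor_commute: "cofactor n a (cofactor n b x) = cofactor n b (cofactor n a x)"
  by (simp add: cofactor_def[of n b] cofactor_sum cofactor_scale cofactor_L_pow)

section \<open>Averages over roots of unity\<close>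

definition root1 :: "nat \<Rightarrow> complex"
  where "root1 n = exp (2 * of_real pi * \<i> / of_nat n)"

lemma norm_root1: "cmod (root1 n) = 1"
  by (simp add: root1_def)

lemma root1_pow: "root1 n ^ j = exp (2 * of_real pi * \<i> * of_nat j / of_nat n)"
  by (simp add: root1_def exp_of_nat_mult[symmetric] field_simps)

lemma root1_pow_n: "1 \<le> n \<Longrightarrow> root1 n ^ n = 1"
  by (simp add: root1_pow complex_root_unity_eq_1)

text \<open>A geometric sum of length \<open>n\<close> whose ratio \<open>root1 n ^ j\<close> is an
  \<open>n\<close>-th root of unity; the ratio is 1 exactly when \<open>n\<close> divides
  \<open>j\<close>.\<close>

lemma sum_root1:
  assumes "1 \<le> n"
  shows "(\<Sum>k<n. (root1 n ^ k) ^ j) = (if n dvd j then of_nat n else 0)"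
proof -
  have eq: "(root1 n ^ k) ^ j = (root1 n ^ j) ^ k" for k
    by (simp add: power_mult[symmetric] mult.commute)
  have one: "root1 n ^ j = 1 \<longleftrightarrow> n dvd j"
    using complex_root_unity_eq_1[OF assms] by (simp add: root1_pow)
  show ?thesis
  proof (cases "n dvd j")
    case True
    then show ?thesis using one by (simp add: eq)
  next
    case False
    have "(root1 n ^ j) ^ n = 1"
      using root1_pow_n[OF assms] by (metis power_mult mult.commute power_one)
    then show ?thesis using False one by (simp add: eq geometric_sum)
  qed
qed

text \<open>With the extra factor in front, the term of index \<open>j\<close> carries the power
  \<open>Suc j\<close> of the root. For \<open>j < n\<close> only \<open>Suc j = n\<close> survives
  the summation, and there the remaining power of \<open>L\<close> is 0.\<close>

lemma sum_cofactor:
  assumes "1 \<le> n"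
  shows "(\<Sum>k<n. (r * root1 n ^ k) *s cofactor n (r * root1 n ^ k) x) = (of_nat n * r ^ n) *s x"
proof -
  have "(\<Sum>k<n. (r * root1 n ^ k) *s cofactor n (r * root1 n ^ k) x)
      = (\<Sum>k<n. \<Sum>j<n. (r ^ Suc j * (root1 n ^ k) ^ Suc j) *s (L ^^ (n - 1 - j)) x)"
    unfolding cofactor_def by (simp add: scale_sum_right power_mult_distrib mult_ac)
  also have "\<dots> = (\<Sum>j<n. \<Sum>k<n. (r ^ Suc j * (root1 n ^ k) ^ Suc j) *s (L ^^ (n - 1 - j)) x)"
    by (rule sum.swap)
  also have "\<dots> = (\<Sum>j<n. (r ^ Suc j * (\<Sum>k<n. (root1 n ^ k) ^ Suc j)) *s (L ^^ (n - 1 - j)) x)"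
    by (simp only: scale_sum_left sum_distrib_left)
  also have "\<dots> = (\<Sum>j<n. if j = n - 1 then (r ^ n * of_nat n) *s x else 0)"
  proof (rule sum.cong[OF refl])
    fix j assume "j \<in> {..<n}"
    then have "n dvd Suc j \<longleftrightarrow> j = n - 1"
      using assms by (auto dest: dvd_imp_le)
    then show "(r ^ Suc j * (\<Sum>k<n. (root1 n ^ k) ^ Suc j)) *s (L ^^ (n - 1 - j)) x
        = (if j = n - 1 then (r ^ n * of_nat n) *s x else 0)"
      using sum_root1[OF assms, of "Suc j"] assms by (simp del: power_Suc)
  qed
  also have "\<dots> = (of_nat n * r ^ n) *s x"
    using assms by (simp add: mult.commute)
  finally show ?thesis .
qed

text \<open>Averaging \<open>a R(a) - b R(b) = (a - b) L R(a) R(b)\<close> (\<open>R\<close> the resolvent) over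
  \<open>a = r \<omega>\<^sup>k\<close>, \<open>b = t \<omega>\<^sup>k\<close> with \<open>\<omega>\<close> a primitive \<open>n\<close>-th root of unity, multiplied through
  by \<open>(L\<^sup>n - r\<^sup>n) (L\<^sup>n - t\<^sup>n)\<close> so that no inverse is needed.\<close>

lemma sum_cofactor_cofactor:
  fixes r t :: real
  assumes n: "1 \<le> n"
  defines "a \<equiv> \<lambda>k. complex_of_real r * root1 n ^ k" and "b \<equiv> \<lambda>k. complex_of_real t * root1 n ^ k"
  shows "(\<Sum>k<n. (a k - b k) *s L (cofactor n (a k) (cofactor n (b k) x)))
    = (of_nat n * (of_real r ^ n - of_real t ^ n)) *s (L ^^ n) x"
proof -
  have pow: "a k ^ n = of_real r ^ n" "b k ^ n = of_real t ^ n" for k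
  proof -
    have "(root1 n ^ k) ^ n = 1"
      using root1_pow_n[OF n] by (metis power_mult mult.commute power_one)
    then show "a k ^ n = of_real r ^ n" "b k ^ n = of_real t ^ n"
      by (simp_all add: a_def b_def power_mult_distrib)
  qed
  \<comment> \<open>Clearing one cofactor at a time leaves a (L - b) - b (L - a) applied to the
    double cofactor; the terms with a b cancel.\<close>
  have id: "(a k - b k) *s L (cofactor n (a k) (cofactor n (b k) x))
      = a k *s cofactor n (a k) ((L ^^ n) x - of_real t ^ n *s x)
        - b k *s cofactor n (b k) ((L ^^ n) x - of_real r ^ n *s x)" for k
  proof -
    let ?A = "cofactor n (a k)" and ?B = "cofactor n (b k)"
    have 1: "?A ((L ^^ n) x - of_real t ^ n *s x) = L (?A (?B x)) - b k *s ?A (?B x)"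
      using cofactor_factor[of n "b k" x] pow(2)[of k]
      by (metis cofactor_diff cofactor_scale cofactor_L)
    have 2: "?B ((L ^^ n) x - of_real r ^ n *s x) = L (?A (?B x)) - a k *s ?A (?B x)"
      using cofactor_factor[of n "a k" x] pow(1)[of k]
      by (metis cofactor_diff cofactor_scale cofactor_L cofactor_commute)
    show ?thesis unfolding 1 2 by (simp add: algebra_simps)
  qed
  \<comment> \<open>\<open>sum_cofactor\<close> evaluates both sums, and the multiples of
    \<open>x\<close>, with coefficient r^n t^n in each, cancel.\<close>
  show ?thesis
    unfolding id sum_subtractf
    unfolding a_def b_def sum_cofactor[OF n]
    by (simp add: algebra_simps)
qed


text \<open>A compactness argument: points \<mu> whose best lower bound tends to 0 eventually lie in
  the disc of radius \<open>K + 1\<close>, and the lower bound would fail at any accumulation point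
  of them.\<close>

lemma uniformly_bounded_below:
  assumes low: "\<And>\<mu>. \<exists>\<epsilon>>0. \<forall>x\<in>E. \<epsilon> * q x \<le> q (L x - \<mu> *s x)"
  shows "\<exists>c>0. \<forall>\<mu>. \<forall>x\<in>E. c * q x \<le> q (L x - \<mu> *s x)"
proof (rule ccontr)
  assume neg: "\<not> ?thesis"
  have "\<exists>\<mu> x. x \<in> E \<and> q (L x - \<mu> *s x) < 1 / real (Suc n) * q x" for n
    using neg by (metis not_le of_nat_0_less_iff zero_less_Suc zero_less_divide_1_iff)
  then obtain \<mu> x where x: "\<And>n. x n \<in> E"
    and less: "\<And>n. q (L (x n) - \<mu> n *s x n) < 1 / real (Suc n) * q (x n)"
    by metis
  have pos: "0 < q (x n)" for n
  proof (rule ccontr)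
    assume "\<not> 0 < q (x n)"
    then have "q (x n) = 0" using q_nonneg[OF x[of n]] by simp
    then show False
      using less[of n] q_nonneg[of "L (x n) - \<mu> n *s x n"] x[of n] E_closed by simp
  qed
  have "cmod (\<mu> n) \<le> K + 1" for n
  proof -
    have "cmod (\<mu> n) * q (x n) = q (L (x n) - (L (x n) - \<mu> n *s x n))"
      using q_scale[OF x] by simp
    also have "\<dots> \<le> q (L (x n)) + q (L (x n) - \<mu> n *s x n)"
      using x E_closed by (intro q_diff) auto
    also have "\<dots> \<le> K * q (x n) + 1 / real (Suc n) * q (x n)"
      using q_L[OF x[of n]] less[of n] by linarith
    also have "\<dots> \<le> K * q (x n) + 1 * q (x n)"
      using pos[of n] by (intro add_left_mono mult_right_mono) auto
    finally have "cmod (\<mu> n) * q (x n) \<le> (K + 1) * q (x n)" by (simp add: distrib_right)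
    then show ?thesis using pos[of n] by (rule mult_right_le_imp_le)
  qed
  then have "range \<mu> \<subseteq> cball 0 (K + 1)" by auto
  then obtain l r where r: "strict_mono r" and lim: "(\<mu> \<circ> r) \<longlonglongrightarrow> l"
    using compact_cball[of 0 "K + 1"] unfolding compact_def by (meson range_subsetD)
  obtain \<epsilon> where \<epsilon>: "\<epsilon> > 0" "\<And>x. x \<in> E \<Longrightarrow> \<epsilon> * q x \<le> q (L x - l *s x)"
    using low by blast
  have "\<epsilon> \<le> 1 / real (Suc (r n)) + cmod (\<mu> (r n) - l)" for n
  proof -
    let ?x = "x (r n)"
    have "\<epsilon> * q ?x \<le> q ((L ?x - \<mu> (r n) *s ?x) + (\<mu> (r n) - l) *s ?x)"
      using \<epsilon>(2)[OF x, of "r n"] by (simp add: algebra_simps)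
    also have "\<dots> \<le> q (L ?x - \<mu> (r n) *s ?x) + q ((\<mu> (r n) - l) *s ?x)"
      using x E_closed by (intro q_add) auto
    also have "\<dots> \<le> (1 / real (Suc (r n)) + cmod (\<mu> (r n) - l)) * q ?x"
      using less[of "r n"] q_scale[OF x] by (simp add: distrib_right)
    finally show ?thesis using pos by simp
  qed
  moreover have "(\<lambda>n. 1 / real (Suc (r n)) + cmod (\<mu> (r n) - l)) \<longlonglongrightarrow> 0 + 0"
  proof (rule tendsto_add)
    show "(\<lambda>n. 1 / real (Suc (r n))) \<longlonglongrightarrow> 0"
      using LIMSEQ_subseq_LIMSEQ[OF LIMSEQ_Suc[OF lim_1_over_n] r]
      by (simp add: comp_def)
    show "(\<lambda>n. cmod (\<mu> (r n) - l)) \<longlonglongrightarrow> 0"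
      using lim by (simp add: comp_def LIM_zero tendsto_norm_zero)
  qed
  ultimately have "\<epsilon> \<le> 0 + 0" by (intro Lim_bounded2[where N = 0]) auto
  then show False using \<epsilon>(1) by simp
qed

text \<open>Two applications of \<open>low\<close> bound the double cofactors, and
  \<open>sum_cofactor_cofactor\<close> expresses \<open>(L ^^ n) x\<close> through them with
  coefficients of modulus only \<eta>. Apart from \<open>\<eta> < t\<close> the condition on \<eta>
  does not involve \<open>t\<close>, so the same decrement can be used again and again.\<close>

lemma growth_rate_decrease:
  assumes c: "0 < c" and low: "\<And>\<mu> x. x \<in> E \<Longrightarrow> c * q x \<le> q (L x - \<mu> *s x)"
    and \<eta>: "0 < \<eta>" "\<eta> < t" "8 * \<eta> * K \<le> c\<^sup>2"
    and t: "\<forall>\<^sub>F n in sequentially. \<forall>x\<in>E. q ((L ^^ n) x) \<le> t ^ n * q x"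
  shows "\<forall>\<^sub>F n in sequentially. \<forall>x\<in>E. q ((L ^^ n) x) \<le> (t - \<eta>) ^ n * q x"
proof -
  define r where "r = t - \<eta>"
  have r: "0 < r" "r < t" "0 < t" using \<eta> by (auto simp: r_def)
  \<comment> \<open>For large \<open>n\<close> the factor \<open>t ^ n - r ^ n\<close> is at least
    \<open>t ^ n / 2\<close>.\<close>
  have "(\<lambda>n. (r / t) ^ n) \<longlonglongrightarrow> 0"
    using r by (intro LIMSEQ_realpow_zero) auto
  then have "\<forall>\<^sub>F n in sequentially. (r / t) ^ n < 1 / 2"
    by (rule order_tendstoD) simp
  then show ?thesis
    using t eventually_ge_at_top[of 1]
  proof eventually_elim
    case (elim n)
    have "r ^ n < t ^ n / 2"
      using elim(1) r by (simp add: power_divide field_simps)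
    show ?case
    proof
      fix x assume x: "x \<in> E"
      define a b where "a = (\<lambda>k. complex_of_real r * root1 n ^ k)"
        and "b = (\<lambda>k. complex_of_real t * root1 n ^ k)"
      define y where "y k = cofactor n (a k) (cofactor n (b k) x)" for k
      \<comment> \<open>For every \<open>k\<close>, applying L - a k and then L - b k to
        \<open>y k\<close> gives \<open>z\<close>, although neither \<open>v\<close> nor
        \<open>z\<close> depends on \<open>k\<close>.\<close>
      define v where "v = (L ^^ n) x - of_real r ^ n *s x"
      define z where "z = (L ^^ n) v - of_real t ^ n *s v"
      have v: "v \<in> E" unfolding v_def using x L_pow_mem E_closed by auto
      have y: "y k \<in> E" for k unfolding y_def using x cofactor_mem by auto
      have pow: "a k ^ n = of_real r ^ n" "b k ^ n = of_real t ^ n" for k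
      proof -
        have "(root1 n ^ k) ^ n = 1"
          using root1_pow_n[OF elim(3)] by (metis power_mult mult.commute power_one)
        then show "a k ^ n = of_real r ^ n" "b k ^ n = of_real t ^ n"
          by (simp_all add: a_def b_def power_mult_distrib)
      qed
      have qz: "q z \<le> 2 * t ^ n * q v"
      proof -
        have "q z \<le> q ((L ^^ n) v) + t ^ n * q v"
          unfolding z_def using q_diff[of "(L ^^ n) v" "of_real t ^ n *s v"] v L_pow_mem E_closed
            q_scale[OF v, of "of_real t ^ n"] r by (simp add: norm_power)
        then show ?thesis using elim(2) v by fastforce
      qed
      have qy: "c\<^sup>2 * q (y k) \<le> q z" for k
      proof -
        let ?w = "L (y k) - a k *s y k"
        have w: "?w \<in> E" using y E_closed by auto
        have "?w = (L ^^ n) (cofactor n (b k) x) - of_real r ^ n *s cofactor n (b k) x"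
          unfolding y_def by (simp add: cofactor_factor pow)
        also have "\<dots> = cofactor n (b k) v"
          unfolding v_def by (simp add: cofactor_diff cofactor_scale cofactor_L_pow)
        finally have "L ?w - b k *s ?w = z"
          unfolding z_def by (simp add: cofactor_factor pow)
        then have "c * q ?w \<le> q z" using low[OF w, of "b k"] by simp
        moreover have "c * (c * q (y k)) \<le> c * q ?w"
          using low[OF y, of k "a k"] c by (intro mult_left_mono) auto
        ultimately show ?thesis by (simp add: power2_eq_square mult.assoc)
      qed
      have qL: "q ((a k - b k) *s L (y k)) \<le> \<eta> * K / c\<^sup>2 * q z" for k
      proof -
        have "cmod (a k - b k) = \<eta>"
        proof -
          have "a k - b k = of_real (r - t) * root1 n ^ k"
            by (simp add: a_def b_def algebra_simps)
          then show ?thesis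
            using \<eta> by (simp add: norm_mult norm_power norm_root1 r_def del: of_real_diff)
        qed
        then have "q ((a k - b k) *s L (y k)) = \<eta> * q (L (y k))"
          using q_scale y E_closed by simp
        also have "\<dots> \<le> \<eta> * (K * q (y k))"
          using q_L[OF y] \<eta> by (intro mult_left_mono) auto
        also have "\<dots> \<le> \<eta> * (K * (q z / c\<^sup>2))"
          using qy[of k] \<eta> K_pos c by (intro mult_left_mono) (auto simp: field_simps)
        finally show ?thesis by (simp add: mult_ac)
      qed
      have "(real n * (t ^ n - r ^ n)) * q ((L ^^ n) x)
          = q ((of_nat n * (of_real r ^ n - of_real t ^ n)) *s (L ^^ n) x)"
      proof -
        have "complex_of_nat n * (of_real r ^ n - of_real t ^ n)
            = of_real (real n * (r ^ n - t ^ n))" by simp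
        moreover have "r ^ n \<le> t ^ n" using r by (intro power_mono) auto
        ultimately show ?thesis
          using q_scale[OF L_pow_mem[OF x]]
          by (simp del: of_real_mult of_real_diff add: norm_mult abs_mult)
      qed
      also have "\<dots> = q (\<Sum>k<n. (a k - b k) *s L (y k))"
        unfolding y_def a_def b_def sum_cofactor_cofactor[OF elim(3)] ..
      also have "\<dots> \<le> (\<Sum>k<n. q ((a k - b k) *s L (y k)))"
        using y E_closed by (intro q_sum) auto
      also have "\<dots> \<le> (\<Sum>k<n. \<eta> * K / c\<^sup>2 * q z)"
        by (intro sum_mono qL)
      also have "\<dots> = real n * (\<eta> * K / c\<^sup>2 * q z)" by simp
      finally have "(t ^ n - r ^ n) * q ((L ^^ n) x) \<le> \<eta> * K / c\<^sup>2 * q z"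
        using elim(3) mult_left_le_imp_le[of "real n"] by (simp only: mult.assoc)
      \<comment> \<open>The hypothesis on \<eta> makes the first factor at most 1/8; the remaining 2
        comes from \<open>qz\<close>.\<close>
      moreover have "\<eta> * K / c\<^sup>2 * q z \<le> 1 / 8 * (2 * t ^ n * q v)"
        using \<eta> c K_pos qz q_nonneg[of z] v E_closed L_pow_mem unfolding z_def
        by (intro mult_mono) (auto simp: field_simps)
      moreover have "t ^ n / 2 * q ((L ^^ n) x) \<le> (t ^ n - r ^ n) * q ((L ^^ n) x)"
        using \<open>r ^ n < t ^ n / 2\<close> q_nonneg[OF L_pow_mem[OF x]] by (intro mult_right_mono) auto
      ultimately have "t ^ n / 2 * q ((L ^^ n) x) \<le> 1 / 8 * (2 * t ^ n * q v)" by linarith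
      then have "t ^ n * (2 * q ((L ^^ n) x)) \<le> t ^ n * q v" by (simp add: mult_ac)
      then have "2 * q ((L ^^ n) x) \<le> q v" using r by simp
      \<comment> \<open>\<open>v\<close> contains \<open>(L ^^ n) x\<close> only once, so one of the
        two copies on the left survives and is bounded by \<open>r ^ n * q x\<close>.\<close>
      also have "q v \<le> q ((L ^^ n) x) + r ^ n * q x"
        unfolding v_def using q_diff[of "(L ^^ n) x" "of_real r ^ n *s x"] x L_pow_mem E_closed
          q_scale[OF x, of "of_real r ^ n"] r by (simp add: norm_power)
      finally show "q ((L ^^ n) x) \<le> (t - \<eta>) ^ n * q x" by (simp add: r_def)
    qed
  qed
qed

lemma q_L_pow_lower:
  assumes c: "0 < c" and low: "\<And>x. x \<in> E \<Longrightarrow> c * q x \<le> q (L x)" and x: "x \<in> E"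
  shows "c ^ n * q x \<le> q ((L ^^ n) x)"
proof (induction n)
  case (Suc n)
  have "c ^ Suc n * q x \<le> c * q ((L ^^ n) x)"
    using Suc c by (simp add: mult.assoc)
  also have "\<dots> \<le> q ((L ^^ Suc n) x)" using low[OF L_pow_mem[OF x]] by simp
  finally show ?case .
qed simp

text \<open>If every \<mu> had a lower bound, the growth rate could be lowered from \<open>K\<close>
  by the same \<eta> forever, although it has to stay positive.\<close>

theorem approximate_eigenvalue_exists:
  assumes "x0 \<in> E" and "0 < q x0"
  shows "\<exists>\<mu>. \<forall>\<epsilon>>0. \<exists>x\<in>E. q (L x - \<mu> *s x) < \<epsilon> * q x"
proof (rule ccontr)
  assume neg: "\<not> ?thesis"
  have "\<exists>\<epsilon>>0. \<forall>x\<in>E. \<epsilon> * q x \<le> q (L x - \<mu> *s x)" for \<mu>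
    using neg by (metis not_le)
  then obtain c where c: "0 < c" and low: "\<And>\<mu> x. x \<in> E \<Longrightarrow> c * q x \<le> q (L x - \<mu> *s x)"
    using uniformly_bounded_below by blast
  \<comment> \<open>The first term keeps \<eta> below \<open>c\<close>, hence below every admissible
    rate by \<open>ge\<close>; the second is what \<open>growth_rate_decrease\<close> asks
    for.\<close>
  define \<eta> where "\<eta> = min (c / 2) (c\<^sup>2 / (8 * K))"
  have \<eta>: "0 < \<eta>" "\<eta> < c" "8 * \<eta> * K \<le> c\<^sup>2"
  proof -
    have "\<eta> \<le> c / 2" "\<eta> \<le> c\<^sup>2 / (8 * K)" by (simp_all add: \<eta>_def)
    then show "\<eta> < c" "8 * \<eta> * K \<le> c\<^sup>2" using c K_pos by (auto simp: field_simps)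
    show "0 < \<eta>" using c K_pos by (simp add: \<eta>_def)
  qed
  let ?B = "\<lambda>t. \<forall>\<^sub>F n in sequentially. \<forall>x\<in>E. q ((L ^^ n) x) \<le> t ^ n * q x"
  \<comment> \<open>The lower bound at \<mu> = 0 makes the powers grow at least like
    \<open>c ^ n\<close>; as \<open>q x0\<close> is positive, no smaller rate is possible.\<close>
  have ge: "c \<le> t" if "0 < t" "?B t" for t
  proof -
    have "\<forall>\<^sub>F n in sequentially. c \<le> t"
      using that(2) eventually_ge_at_top[of 1]
    proof eventually_elim
      case (elim n)
      have "c ^ n * q x0 \<le> t ^ n * q x0"
        using elim(1) assms(1) q_L_pow_lower[OF c _ assms(1), of n] low[of _ 0] by fastforce
      then have "c ^ n \<le> t ^ n" using assms(2) by simp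
      then show ?case using that(1) c elim(2) by (simp add: power_mono_iff)
    qed
    then show ?thesis by simp
  qed
  have B: "0 < K - real j * \<eta> \<and> ?B (K - real j * \<eta>)" for j
  proof (induction j)
    case 0
    then show ?case using K_pos q_L_pow by (simp add: always_eventually)
  next
    case (Suc j)
    have "c \<le> K - real j * \<eta>" using ge Suc by blast
    then have lt: "\<eta> < K - real j * \<eta>" using \<eta> by simp
    have "?B (K - real j * \<eta> - \<eta>)"
      using growth_rate_decrease[OF c low \<eta>(1) lt \<eta>(3)] Suc by blast
    then show ?case using lt by (simp add: algebra_simps)
  qed
  obtain j where "K / \<eta> < real j" using reals_Archimedean2 by blast
  then have "K < real j * \<eta>" using \<eta> by (simp add: field_simps)
  then show False using B[of j] by simp
qed

end

section \<open>Sequences with relatively compact range\<close>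

text \<open>Every subsequence, not only the whole sequence, must have a convergent subsequence. This
  form survives sums and thinning, and in a metric space it says that the range has compact
  closure.\<close>

definition rel_compact_seq :: "(nat \<Rightarrow> 'a::topological_space) \<Rightarrow> bool"
  where "rel_compact_seq u \<longleftrightarrow> (\<forall>r::nat \<Rightarrow> nat. strict_mono r \<longrightarrow>
    (\<exists>(s::nat \<Rightarrow> nat) l. strict_mono s \<and> (\<lambda>n. u (r (s n))) \<longlonglongrightarrow> l))"

lemma rel_compact_seqD:
  assumes "rel_compact_seq u"
  obtains s :: "nat \<Rightarrow> nat" and l where "strict_mono s" "(\<lambda>n. u (s n)) \<longlonglongrightarrow> l"
proof -
  have "strict_mono (\<lambda>n::nat. n)" by (simp add: strict_mono_def)
  then show ?thesis
    using assms that unfolding rel_compact_seq_def by blast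
qed

lemma convergent_imp_rel_compact_seq: "u \<longlonglongrightarrow> l \<Longrightarrow> rel_compact_seq u"
  unfolding rel_compact_seq_def
proof (intro allI impI)
  fix r :: "nat \<Rightarrow> nat" assume "u \<longlonglongrightarrow> l" "strict_mono r"
  then have "(\<lambda>n. u (r (id n))) \<longlonglongrightarrow> l"
    using LIMSEQ_subseq_LIMSEQ[of u l r] by (simp add: comp_def)
  then show "\<exists>(s::nat \<Rightarrow> nat) l. strict_mono s \<and> (\<lambda>n. u (r (s n))) \<longlonglongrightarrow> l"
    using strict_mono_id by blast
qed

lemma rel_compact_seqI:
  assumes "\<And>r. strict_mono r \<Longrightarrow> \<exists>s::nat \<Rightarrow> nat. strict_mono s \<and> rel_compact_seq (\<lambda>n. u (r (s n)))"
  shows "rel_compact_seq u"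
  unfolding rel_compact_seq_def
proof (intro allI impI)
  fix r :: "nat \<Rightarrow> nat" assume "strict_mono r"
  then obtain s where s: "strict_mono s" "rel_compact_seq (\<lambda>n. u (r (s n)))" using assms by blast
  obtain s' l where "strict_mono s'" "(\<lambda>n. u (r (s (s' n)))) \<longlonglongrightarrow> l"
    using rel_compact_seqD[OF s(2)] by blast
  then show "\<exists>s l. strict_mono s \<and> (\<lambda>n. u (r (s n))) \<longlonglongrightarrow> l"
    using strict_mono_o[OF s(1)] by (intro exI[of _ "s \<circ> s'"]) auto
qed

lemma rel_compact_seq_add:
  fixes u v :: "nat \<Rightarrow> 'a::real_normed_vector"
  assumes "rel_compact_seq u" "rel_compact_seq v"
  shows "rel_compact_seq (\<lambda>n. u n + v n)"
proof (rule rel_compact_seqI)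
  fix r :: "nat \<Rightarrow> nat" assume r: "strict_mono r"
  obtain s l where s: "strict_mono s" "(\<lambda>n. u (r (s n))) \<longlonglongrightarrow> l"
    using assms(1) r unfolding rel_compact_seq_def by blast
  obtain s' l' where s': "strict_mono s'" "(\<lambda>n. v (r (s (s' n)))) \<longlonglongrightarrow> l'"
    using assms(2) strict_mono_o[OF r s(1)] unfolding rel_compact_seq_def
    by (auto simp: comp_def dest!: spec[of _ "r \<circ> s"])
  have "(\<lambda>n. u (r (s (s' n)))) \<longlonglongrightarrow> l"
    using LIMSEQ_subseq_LIMSEQ[OF s(2) s'(1)] by (simp add: comp_def)
  then have "rel_compact_seq (\<lambda>n. u (r ((s \<circ> s') n)) + v (r ((s \<circ> s') n)))"
    using convergent_imp_rel_compact_seq[OF tendsto_add[OF _ s'(2)]] by simp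
  then show "\<exists>s::nat \<Rightarrow> nat. strict_mono s \<and> rel_compact_seq (\<lambda>n. u (r (s n)) + v (r (s n)))"
    using strict_mono_o[OF s(1) s'(1)] by blast
qed

lemma rel_compact_seq_sum:
  fixes u :: "'i \<Rightarrow> nat \<Rightarrow> 'a::real_normed_vector"
  assumes "\<And>i. i \<in> I \<Longrightarrow> rel_compact_seq (u i)"
  shows "rel_compact_seq (\<lambda>n. \<Sum>i\<in>I. u i n)"
  using assms
  by (induction I rule: infinite_finite_induct)
    (simp_all add: rel_compact_seq_add convergent_imp_rel_compact_seq[OF tendsto_const])

lemma rel_compact_seq_bounded_linear:
  assumes "bounded_linear f" "rel_compact_seq u"
  shows "rel_compact_seq (\<lambda>n. f (u n))"
  using assms(2) bounded_linear.tendsto[OF assms(1)] unfolding rel_compact_seq_def by blast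

lemma rel_compact_seq_diff:
  fixes u v :: "nat \<Rightarrow> 'a::real_normed_vector"
  assumes "rel_compact_seq u" "rel_compact_seq v"
  shows "rel_compact_seq (\<lambda>n. u n - v n)"
  using rel_compact_seq_add[OF assms(1) rel_compact_seq_bounded_linear[OF
      bounded_linear_minus[OF bounded_linear_ident] assms(2)]] by simp

text \<open>Where \<open>f (u n)\<close> converges, \<open>g (u n)\<close> is Cauchy, so
  completeness is required only of the target of \<open>g\<close>. In the applications
  \<open>f\<close> is composition with an operator, and \<open>g\<close> is the identity or the
  complement of a finite-rank projection.\<close>

lemma rel_compact_seq_dominated:
  fixes f :: "'a::real_normed_vector \<Rightarrow> 'b::real_normed_vector" and g :: "'a \<Rightarrow> 'c::banach"
  assumes f: "linear f" and g: "linear g" and dom: "\<And>x. norm (g x) \<le> C * norm (f x)"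
    and u: "rel_compact_seq (\<lambda>n. f (u n))"
  shows "rel_compact_seq (\<lambda>n. g (u n))"
proof (rule rel_compact_seqI)
  fix r :: "nat \<Rightarrow> nat" assume "strict_mono r"
  then obtain s l where s: "strict_mono s" "(\<lambda>n. f (u (r (s n)))) \<longlonglongrightarrow> l"
    using u unfolding rel_compact_seq_def by blast
  have "Cauchy (\<lambda>n. g (u (r (s n))))"
  proof (rule metric_CauchyI)
    fix e :: real assume e: "0 < e"
    define K where "K = \<bar>C\<bar> + 1"
    have K: "0 < K" by (simp add: K_def)
    obtain M where M: "\<And>m n. m \<ge> M \<Longrightarrow> n \<ge> M \<Longrightarrow>
        dist (f (u (r (s m)))) (f (u (r (s n)))) < e / K"
      using metric_CauchyD[OF LIMSEQ_imp_Cauchy[OF s(2)], of "e / K"] K e by auto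
    have "dist (g (u (r (s m)))) (g (u (r (s n)))) < e" if "m \<ge> M" "n \<ge> M" for m n
    proof -
      have "dist (g (u (r (s m)))) (g (u (r (s n)))) \<le> C * dist (f (u (r (s m)))) (f (u (r (s n))))"
        using dom[of "u (r (s m)) - u (r (s n))"] by (simp add: dist_norm linear_diff[OF f] linear_diff[OF g])
      also have "\<dots> \<le> K * dist (f (u (r (s m)))) (f (u (r (s n))))"
        by (intro mult_right_mono) (auto simp: K_def)
      also have "\<dots> < K * (e / K)" using M[OF that] K by (intro mult_strict_left_mono)
      finally show ?thesis using K by simp
    qed
    then show "\<exists>M. \<forall>m\<ge>M. \<forall>n\<ge>M. dist (g (u (r (s m)))) (g (u (r (s n)))) < e" by blast
  qed
  then obtain l where "(\<lambda>n. g (u (r (s n)))) \<longlonglongrightarrow> l"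
    by (auto simp: Cauchy_convergent_iff convergent_def)
  then show "\<exists>s::nat \<Rightarrow> nat. strict_mono s \<and> rel_compact_seq (\<lambda>n. g (u (r (s n))))"
    using s(1) convergent_imp_rel_compact_seq by blast
qed

lemma rel_compact_seq_complex:
  fixes u :: "nat \<Rightarrow> complex"
  assumes "Bseq u"
  shows "rel_compact_seq u"
  unfolding rel_compact_seq_def
proof (intro allI impI)
  fix r :: "nat \<Rightarrow> nat"
  obtain M where "\<And>n. norm (u n) \<le> M" using assms unfolding Bseq_def by blast
  then have "bounded (range (\<lambda>n. u (r n)))" by (auto simp: bounded_iff)
  then obtain l and s :: "nat \<Rightarrow> nat" where "strict_mono s" "((\<lambda>n. u (r n)) \<circ> s) \<longlonglongrightarrow> l"
    using bounded_imp_convergent_subsequence by blast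
  then show "\<exists>(s::nat \<Rightarrow> nat) l. strict_mono s \<and> (\<lambda>n. u (r (s n))) \<longlonglongrightarrow> l"
    unfolding comp_def by blast
qed

subsection \<open>Finite-dimensional subspaces\<close>

lemma csubspace_imp_subspace:
  fixes S :: "'a::complex_normed_vector set"
  assumes "cvs.subspace S"
  shows "subspace S"
  using cvs.subspace_0[OF assms] cvs.subspace_add[OF assms] cvs.subspace_scale[OF assms]
  unfolding subspace_def by (metis scaleC_of_real)

lemma bounded_linear_scaleC_left: "bounded_linear (\<lambda>c. c *\<^sub>C x)"
  by (rule bounded_linear_intro[where K = "norm x"])
    (simp_all add: scaleC_add_left norm_scaleC scaleR_conv_of_real flip: scaleC_of_real)

lemma seq_compact_subspace_closed:
  fixes S :: "'a::real_normed_vector set"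
  assumes "\<And>u. Bseq u \<Longrightarrow> (\<And>n. u n \<in> S) \<Longrightarrow> \<exists>s::nat \<Rightarrow> nat. \<exists>l\<in>S. strict_mono s \<and> (\<lambda>n. u (s n)) \<longlonglongrightarrow> l"
  shows "closed S"
  unfolding closed_sequential_limits
proof (intro allI impI, elim conjE)
  fix u x assume u: "\<forall>n. u n \<in> S" "u \<longlonglongrightarrow> x"
  then obtain s l where "strict_mono s" "l \<in> S" "(\<lambda>n. u (s n)) \<longlonglongrightarrow> l"
    using assms[of u] convergentI[THEN convergent_imp_Bseq] by blast
  then show "x \<in> S"
    using LIMSEQ_unique LIMSEQ_subseq_LIMSEQ[OF u(2)] by (auto simp: comp_def)
qed

text \<open>Bolzano-Weierstrass by induction on the spanning set. The induction hypothesis makes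
  \<open>cvs.span B\<close> closed, so a new vector \<open>b\<close> has positive distance from it,
  which bounds the coefficients of \<open>b\<close>.\<close>

lemma span_finite_seq_compact:
  fixes u :: "nat \<Rightarrow> 'a::complex_normed_vector"
  assumes "finite B" and "Bseq u" and "\<And>n. u n \<in> cvs.span B"
  shows "\<exists>s::nat \<Rightarrow> nat. \<exists>l\<in>cvs.span B. strict_mono s \<and> (\<lambda>n. u (s n)) \<longlonglongrightarrow> l"
  using assms
proof (induction B arbitrary: u rule: finite_induct)
  case empty
  then show ?case using strict_mono_id by (auto intro!: exI[of _ id])
next
  case (insert b B)
  show ?case
  proof (cases "b \<in> cvs.span B")
    case True
    then have "cvs.span (insert b B) = cvs.span B"
      by (simp add: cvs.span_redundant)
    then show ?thesis using insert by simp
  next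
    case False
    have cl: "closed (cvs.span B)"
      using insert.IH by (intro seq_compact_subspace_closed) blast
    have "cvs.span B \<noteq> {}" using cvs.span_zero by blast
    define d where "d = infdist b (cvs.span B)"
    have d: "0 < d"
      using in_closed_iff_infdist_zero[OF cl \<open>cvs.span B \<noteq> {}\<close>] False infdist_nonneg
      by (metis d_def less_eq_real_def)
    have "\<exists>k. u n - k *\<^sub>C b \<in> cvs.span B" for n
      using insert.prems(2)[of n] cvs.span_breakdown_eq by blast
    then obtain k where k: "\<And>n. u n - k n *\<^sub>C b \<in> cvs.span B" by metis
    have kd: "cmod (k n) * d \<le> norm (u n)" for n
    proof (cases "k n = 0")
      case k0: False
      \<comment> \<open>Chosen so that dividing \<open>u n\<close> by \<open>k n\<close> gives
        \<open>b - ?y\<close>, whose norm is at least \<open>d\<close>.\<close>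
      let ?y = "- (inverse (k n) *\<^sub>C (u n - k n *\<^sub>C b))"
      have "?y \<in> cvs.span B" using k by (simp add: cvs.span_neg cvs.span_scale)
      then have "d \<le> dist b ?y" unfolding d_def by (rule infdist_le)
      also have "\<dots> = norm (inverse (k n) *\<^sub>C u n)"
        using k0 by (simp add: dist_norm cvs.scale_right_diff_distrib)
      finally show ?thesis using k0 by (simp add: norm_scaleC norm_inverse norm_divide field_simps)
    qed simp
    obtain M where M: "\<And>n. norm (u n) \<le> M" using insert.prems(1) unfolding Bseq_def by blast
    have km: "cmod (k n) \<le> M / d" for n using kd[of n] M[of n] d by (simp add: field_simps)
    then have "Bseq k" by (intro BseqI') auto
    then obtain s c where s: "strict_mono s" "(\<lambda>n. k (s n)) \<longlonglongrightarrow> c"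
      using rel_compact_seqD[OF rel_compact_seq_complex] by blast
    have "norm (u n - k n *\<^sub>C b) \<le> M + M / d * norm b" for n
      using norm_triangle_ineq4[of "u n" "k n *\<^sub>C b"] M[of n]
        mult_right_mono[OF km[of n], of "norm b"]
      by (simp add: norm_scaleC)
    then have "Bseq (\<lambda>n. u (s n) - k (s n) *\<^sub>C b)" by (intro BseqI') auto
    then obtain s' l where s': "strict_mono s'" "l \<in> cvs.span B"
      "(\<lambda>n. u (s (s' n)) - k (s (s' n)) *\<^sub>C b) \<longlonglongrightarrow> l"
      using insert.IH[of "\<lambda>n. u (s n) - k (s n) *\<^sub>C b"] k by blast
    have "(\<lambda>n. k (s (s' n)) *\<^sub>C b) \<longlonglongrightarrow> c *\<^sub>C b"
      using LIMSEQ_subseq_LIMSEQ[OF s(2) s'(1)] unfolding comp_def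
      by (rule bounded_linear.tendsto[OF bounded_linear_scaleC_left])
    from tendsto_add[OF s'(3) this] have "(\<lambda>n. u ((s \<circ> s') n)) \<longlonglongrightarrow> l + c *\<^sub>C b" by simp
    moreover have "l + c *\<^sub>C b \<in> cvs.span (insert b B)"
      using s'(2) cvs.span_mono[of B "insert b B"]
      by (meson cvs.span_add cvs.span_base cvs.span_scale insertI1 subset_insertI subsetD)
    ultimately show ?thesis using strict_mono_o[OF s(1) s'(1)] by blast
  qed
qed

lemma cdim_finiteE:
  assumes "cdim S < \<infinity>"
  obtains B where "finite B" "cvs.span B = S"
  using assms by (auto simp: cdim_def split: if_splits)

lemma cdim_finite_rel_compact_seq:
  fixes u :: "nat \<Rightarrow> 'a::complex_normed_vector"
  assumes "cdim S < \<infinity>" "Bseq u" "\<And>n. u n \<in> S"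
  shows "rel_compact_seq u"
proof -
  obtain B where B: "finite B" "cvs.span B = S" using cdim_finiteE[OF assms(1)] by blast
  show ?thesis
    unfolding rel_compact_seq_def
  proof (intro allI impI)
    fix r :: "nat \<Rightarrow> nat"
    have "Bseq (\<lambda>n. u (r n))" using assms(2) unfolding Bseq_def by blast
    from span_finite_seq_compact[OF B(1) this]
    show "\<exists>(s::nat \<Rightarrow> nat) l. strict_mono s \<and> (\<lambda>n. u (r (s n))) \<longlonglongrightarrow> l"
      using assms(3) B(2) by auto
  qed
qed

lemma cdim_finite_closed:
  fixes S :: "'a::complex_normed_vector set"
  assumes "cdim S < \<infinity>"
  shows "closed S"
proof -
  obtain B where B: "finite B" "cvs.span B = S" using cdim_finiteE[OF assms] by blast
  show ?thesis
  proof (rule seq_compact_subspace_closed)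
    fix u :: "nat \<Rightarrow> 'a" assume "Bseq u" "\<And>n. u n \<in> S"
    then show "\<exists>s::nat \<Rightarrow> nat. \<exists>l\<in>S. strict_mono s \<and> (\<lambda>n. u (s n)) \<longlonglongrightarrow> l"
      using span_finite_seq_compact[OF B(1), of u] by (simp add: B(2))
  qed
qed

lemma cdim_subset_span_finite:
  assumes "cvs.subspace S" "finite B" "S \<subseteq> cvs.span B"
  shows "cdim S < \<infinity>"
proof -
  obtain C where C: "C \<subseteq> S" "cvs.independent C" "S \<subseteq> cvs.span C"
    by (rule cvs.basis_exists)
  have "C \<subseteq> cvs.span B" using C(1) assms(3) by (rule subset_trans)
  then have "finite C" using cvs.independent_span_bound[OF assms(2) C(2)] by simp
  moreover have "cvs.span C = S"
    using cvs.span_minimal[OF C(1) assms(1)] C(3) by (rule subset_antisym)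
  ultimately have "\<exists>B. finite B \<and> cvs.span B = S" by blast
  then show ?thesis by (simp add: cdim_def)
qed

section \<open>Operators with closed range\<close>

text \<open>The open mapping theorem onto the closed range, phrased without the quotient by the
  kernel. Baire category yields approximate preimages of controlled norm, and successive correction
  makes them exact.\<close>

lemma open_mapping_estimate:
  fixes f :: "'a::banach \<Rightarrow> 'b::banach"
  assumes f: "bounded_linear f" and cl: "closed (range f)"
  shows "\<exists>C. \<forall>x. \<exists>z. f z = 0 \<and> norm (x - z) \<le> C * norm (f x)"
proof -
  interpret f: bounded_linear f by (rule f)
  let ?X = "top_of_set (range f)"
  let ?G = "\<lambda>n::nat. closure (f ` cball 0 (real n))"
  have sub: "?G n \<subseteq> range f" for n
    using cl by (intro closure_minimal) auto
  have "\<exists>n. ?X interior_of ?G n \<noteq> {}"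
  proof (rule ccontr)
    assume neg: "\<not> ?thesis"
    have "?X interior_of \<Union>(range ?G) = {}"
    proof (rule Baire_category_alt)
      show "completely_metrizable_space ?X \<or> locally_compact_space ?X \<and> regular_space ?X"
        using completely_metrizable_space_closedin[OF completely_metrizable_space_euclidean] cl by auto
      show "closedin ?X T \<and> ?X interior_of T = {}" if TG: "T \<in> range ?G" for T
      proof -
        obtain n where T: "T = ?G n" using TG by auto
        then show ?thesis using neg closed_subset[OF sub closed_closure, of n] by simp
      qed
    qed simp
    moreover have "\<Union>(range ?G) = range f"
    proof (rule subset_antisym)
      show "range f \<subseteq> \<Union>(range ?G)"
      proof
        fix y assume "y \<in> range f"
        then obtain x where x: "y = f x" by blast
        obtain n where "norm x \<le> real n" using real_arch_simple by blast
        then have "y \<in> ?G n" using x closure_subset by fastforce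
        then show "y \<in> \<Union>(range ?G)" by blast
      qed
    qed (use sub in blast)
    ultimately show False
      using interior_of_topspace[of ?X] by auto
  qed
  then obtain n y0 where "y0 \<in> ?X interior_of ?G n" by blast
  then obtain U where U: "open U" "y0 \<in> U" "y0 \<in> range f" "range f \<inter> U \<subseteq> ?G n"
    unfolding interior_of_def openin_open by auto
  then obtain r where r: "0 < r" "ball y0 r \<subseteq> U" using openE by blast
  have near: "\<exists>x. norm x \<le> 4 * real n / r * norm y \<and> norm (y - f x) \<le> norm y / 2"
    if y: "y \<in> range f" for y
  proof (cases "y = 0")
    case False
    \<comment> \<open>Scaled to norm \<open>r / 2\<close>, the vector \<open>y\<close> moves
      \<open>y0\<close> to a point still inside \<open>U\<close>.\<close>
    define t where "t = r / (2 * norm y)"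
    have t: "0 < t" using r False by (simp add: t_def)
    have tn: "norm (t *\<^sub>R y) = r / 2" using r(1) False by (simp add: t_def)
    obtain v0 where v0: "y0 = f v0" using U(3) by blast
    obtain v where v: "y = f v" using y by blast
    have "y0 + t *\<^sub>R y = f (v0 + t *\<^sub>R v)" by (simp add: v0 v f.add f.scaleR)
    then have "y0 + t *\<^sub>R y \<in> range f" by (rule range_eqI)
    moreover have "y0 + t *\<^sub>R y \<in> U" using tn r by (intro subsetD[OF r(2)]) (simp add: dist_norm)
    ultimately have 1: "y0 + t *\<^sub>R y \<in> ?G n" using U(4) by (meson IntI subsetD)
    have 2: "y0 \<in> ?G n" using U(2-4) by (meson IntI subsetD)
    have e: "0 < r / 8" using r by simp
    have "\<exists>w\<in>f ` cball 0 (real n). dist w (y0 + t *\<^sub>R y) < r / 8"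
      using 1 e unfolding closure_approachable by blast
    then obtain a where a: "norm a \<le> real n" "dist (f a) (y0 + t *\<^sub>R y) < r / 8" by auto
    have "\<exists>w\<in>f ` cball 0 (real n). dist w y0 < r / 8"
      using 2 e unfolding closure_approachable by blast
    then obtain b where b: "norm b \<le> real n" "dist (f b) y0 < r / 8" by auto
    \<comment> \<open>\<open>f a - f b\<close> approximates \<open>t *\<^sub>R y\<close> up to
      \<open>r / 4\<close>; division by \<open>t\<close> turns this error into half the norm of
      \<open>y\<close>.\<close>
    let ?x = "(1 / t) *\<^sub>R (a - b)"
    have "norm ?x \<le> 1 / t * (2 * real n)"
      using norm_triangle_ineq4[of a b] a(1) b(1) t
      by (simp add: divide_right_mono)
    also have "\<dots> = 4 * real n / r * norm y" using False by (simp add: t_def)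
    finally have "norm ?x \<le> 4 * real n / r * norm y" .
    moreover have "norm (y - f ?x) \<le> norm y / 2"
    proof -
      have "t *\<^sub>R (y - f ?x) = (y0 + t *\<^sub>R y - f a) - (y0 - f b)"
        using t by (simp add: f.scaleR f.diff scaleR_diff_right)
      then have "t * norm (y - f ?x) \<le> r / 8 + r / 8"
        using norm_triangle_ineq4[of "y0 + t *\<^sub>R y - f a" "y0 - f b"] a(2) b(2) t
        by (simp add: dist_norm norm_minus_commute flip: norm_scaleR) 
          (smt (verit) norm_scaleR)
      then show ?thesis using False r(1) by (simp add: t_def field_simps)
    qed
    ultimately show ?thesis by blast
  qed (auto intro!: exI[of _ 0])
  then obtain g where g: "\<And>y. y \<in> range f \<Longrightarrow> norm (g y) \<le> 4 * real n / r * norm y"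
      "\<And>y. y \<in> range f \<Longrightarrow> norm (y - f (g y)) \<le> norm y / 2" by metis
  show ?thesis
  proof (intro exI allI)
    fix x
    \<comment> \<open>\<open>h\<close> is the remainder after one approximate preimage. Iteration
      halves it each time, the preimages sum to some \<open>s\<close> with \<open>f s = f x\<close>,
      and the kernel vector sought is \<open>x - s\<close>.\<close>
    define h where "h y = y - f (g y)" for y
    define y where "y k = (h ^^ k) (f x)" for k
    have y_Suc: "y (Suc k) = y k - f (g (y k))" for k by (simp add: y_def h_def)
    have yr: "y k \<in> range f" for k
    proof (induction k)
      case (Suc k)
      then obtain v where "y k = f v" by blast
      then have "y (Suc k) = f (v - g (y k))" by (simp add: y_Suc f.diff)
      then show ?case by blast
    qed (simp add: y_def)
    have yn: "norm (y k) \<le> (1 / 2) ^ k * norm (f x)" for k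
    proof (induction k)
      case (Suc k)
      then show ?case using g(2)[OF yr, of k] by (simp add: y_Suc)
    qed (simp add: y_def)
    have gn: "norm (g (y k)) \<le> 4 * real n / r * norm (f x) * (1 / 2) ^ k" for k
      using g(1)[OF yr, of k] mult_left_mono[OF yn, of "4 * real n / r" k] r(1)
      by (simp add: mult_ac)
    have sg: "summable (\<lambda>k. 4 * real n / r * norm (f x) * (1 / 2) ^ k)"
      by (intro summable_mult summable_geometric) simp
    have sn: "summable (\<lambda>k. norm (g (y k)))"
      by (rule summable_comparison_test'[OF sg, of 0]) (use gn in simp)
    define s where "s = (\<Sum>k. g (y k))"
    have "(\<lambda>k. g (y k)) sums s" unfolding s_def by (rule summable_sums[OF summable_norm_cancel[OF sn]])
    then have "(\<lambda>k. f (g (y k))) sums f s" by (rule f.sums)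
    moreover have "(\<lambda>k. f (g (y k))) sums f x"
    proof -
      have "(\<lambda>k. (1 / 2) ^ k * norm (f x)) \<longlonglongrightarrow> 0 * norm (f x)"
        by (intro tendsto_mult_right LIMSEQ_power_zero) simp
      then have "y \<longlonglongrightarrow> 0"
        by (intro Lim_null_comparison[where f = y]) (use yn in auto)
      from telescope_sums'[OF this] show ?thesis by (simp add: y_Suc) (simp add: y_def)
    qed
    ultimately have "f s = f x" by (rule sums_unique2)
    moreover have "norm s \<le> 8 * real n / r * norm (f x)"
    proof -
      have "norm s \<le> (\<Sum>k. norm (g (y k)))" unfolding s_def by (rule summable_norm[OF sn])
      also have "\<dots> \<le> (\<Sum>k. 4 * real n / r * norm (f x) * (1 / 2) ^ k)"
        by (rule suminf_le[OF gn sn sg])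
      also have "\<dots> = 8 * real n / r * norm (f x)"
        by (subst suminf_mult) (simp_all add: suminf_geometric summable_geometric)
      finally show ?thesis .
    qed
    ultimately show "f (x - s) = 0 \<and> norm (x - (x - s)) \<le> 8 * real n / r * norm (f x)"
      by (simp add: f.diff)
  qed
qed

text \<open>Take points \<open>f (x n)\<close> converging geometrically to a point of the closure.
  The increments of \<open>x\<close>, corrected by kernel vectors, are absolutely summable, and
  \<open>f\<close> of their sum telescopes.\<close>

lemma closed_range_if_estimate:
  fixes f :: "'a::banach \<Rightarrow> 'b::real_normed_vector"
  assumes f: "bounded_linear f" and est: "\<And>x. \<exists>z. f z = 0 \<and> norm (x - z) \<le> C * norm (f x)"
  shows "closed (range f)"
proof -
  interpret f: bounded_linear f by (rule f)
  have "y \<in> range f" if y: "y \<in> closure (range f)" for y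
  proof -
    have "\<exists>x. dist (f x) y < (1 / 2) ^ n" for n
      using y unfolding closure_approachable by (metis imageE zero_less_power half_gt_zero zero_less_one)
    then obtain x where x: "\<And>n. dist (f (x n)) y < (1 / 2) ^ n" by metis
    obtain z where z: "\<And>n. f (z n) = 0"
      "\<And>n. norm (x (Suc n) - x n - z n) \<le> C * norm (f (x (Suc n) - x n))"
    proof -
      have "\<forall>n. \<exists>z. f z = 0 \<and> norm (x (Suc n) - x n - z) \<le> C * norm (f (x (Suc n) - x n))"
        using est by blast
      from choice[OF this] show ?thesis using that by blast
    qed
    define w where "w n = x (Suc n) - x n - z n" for n
    have fw: "f (w n) = f (x (Suc n)) - f (x n)" for n by (simp add: w_def f.diff z)
    have wn: "norm (w n) \<le> \<bar>C\<bar> * 2 * (1 / 2) ^ n" for n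
    proof -
      have "norm (f (x (Suc n) - x n)) \<le> dist (f (x (Suc n))) y + dist (f (x n)) y"
        by (simp add: f.diff dist_norm[symmetric] dist_triangle2)
      also have "\<dots> \<le> 2 * (1 / 2) ^ n"
        using x[of n] x[of "Suc n"] zero_le_power[of "1 / 2 :: real" n]
        unfolding power_Suc by linarith
      finally have "\<bar>C\<bar> * norm (f (x (Suc n) - x n)) \<le> \<bar>C\<bar> * (2 * (1 / 2) ^ n)"
        by (intro mult_left_mono) auto
      moreover have "norm (w n) \<le> \<bar>C\<bar> * norm (f (x (Suc n) - x n))"
      proof -
        have "C * norm (f (x (Suc n) - x n)) \<le> \<bar>C\<bar> * norm (f (x (Suc n) - x n))"
          by (intro mult_right_mono) auto
        then show ?thesis unfolding w_def using z(2)[of n] by linarith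
      qed
      ultimately show ?thesis by simp
    qed
    have "summable (\<lambda>n. \<bar>C\<bar> * 2 * (1 / 2) ^ n)"
      by (intro summable_mult summable_geometric) simp
    then have "summable (\<lambda>n. norm (w n))"
      by (rule summable_comparison_test'[of _ 0]) (use wn in simp)
    then have "w sums suminf w" by (rule summable_sums[OF summable_norm_cancel])
    then have "(\<lambda>n. f (w n)) sums f (suminf w)" by (rule f.sums)
    moreover have "(\<lambda>n. f (x n)) \<longlonglongrightarrow> y"
      by (subst tendsto_dist_iff, rule Lim_null_comparison[of _ "\<lambda>n. (1 / 2) ^ n"])
        (use x in \<open>auto intro!: always_eventually LIMSEQ_power_zero less_imp_le\<close>)
    from telescope_sums[OF this] have "(\<lambda>n. f (w n)) sums (y - f (x 0))" by (simp add: fw)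
    ultimately have "f (suminf w) = y - f (x 0)" by (rule sums_unique2)
    then have "y = f (suminf w + x 0)" by (simp add: f.add)
    then show ?thesis by blast
  qed
  then show ?thesis by (metis closure_subset_eq subsetI)
qed

section \<open>Estimates from almost null vectors far from the kernel\<close>

lemma infdist_lessE:
  assumes "infdist x M < a" "M \<noteq> {}"
  obtains z where "z \<in> M" "dist x z < a"
proof -
  have "\<exists>z\<in>M. dist x z < a"
  proof (rule ccontr)
    assume "\<not> ?thesis"
    then have "\<And>z. z \<in> M \<Longrightarrow> a \<le> dist x z" by (meson not_le)
    then have "a \<le> infdist x M"
      using assms(2) by (subst infdist_notempty) (auto intro!: cINF_greatest)
    then show False using assms(1) by simp
  qed
  then show thesis using that by blast
qed

text \<open>As in Riesz's lemma: take a vector violating the estimate with constant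
  \<open>1 / e\<close>, subtract a kernel vector that is nearest up to a factor 2, and normalise.
  That factor is the source of the bound 1/2.\<close>

lemma near_null_vector:
  fixes f :: "'a::real_normed_vector \<Rightarrow> 'b::real_normed_vector"
  assumes f: "linear f" and S: "subspace S"
    and neg: "\<nexists>C. \<forall>x\<in>S. \<exists>z\<in>S. f z = 0 \<and> norm (x - z) \<le> C * norm (f x)"
    and e: "0 < e"
  shows "\<exists>w\<in>S. norm w = 1 \<and> norm (f w) < e \<and> (\<forall>z\<in>S. f z = 0 \<longrightarrow> 1 / 2 \<le> norm (w - z))"
proof -
  obtain x where x: "x \<in> S" "\<And>z. z \<in> S \<Longrightarrow> f z = 0 \<Longrightarrow> 1 / e * norm (f x) < norm (x - z)"
    using neg by (metis not_le)
  define N where "N = {z \<in> S. f z = 0}"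
  have N: "0 \<in> N" using subspace_0[OF S] linear_0[OF f] by (simp add: N_def)
  have fx: "f x \<noteq> 0" using x(2)[OF x(1)] by auto
  define d where "d = infdist x N"
  have "1 / e * norm (f x) \<le> d"
    unfolding d_def using N x(2) by (subst infdist_notempty) (auto intro!: cINF_greatest simp: N_def dist_norm less_imp_le)
  moreover have "0 < 1 / e * norm (f x)" using fx e by simp
  ultimately have d: "0 < d" by linarith
  obtain z0 where z0: "z0 \<in> N" "dist x z0 < 2 * d"
    using infdist_lessE[of x N "2 * d"] N d by (auto simp: d_def)
  define t where "t = norm (x - z0)"
  have t: "0 < t" "t < 2 * d"
  proof -
    show "t < 2 * d" using z0(2) by (simp add: t_def dist_norm)
    have "1 / e * norm (f x) < t" using x(2)[of z0] z0(1) by (simp add: t_def N_def)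
    then show "0 < t" using \<open>0 < 1 / e * norm (f x)\<close> by linarith
  qed
  define w where "w = (1 / t) *\<^sub>R (x - z0)"
  have "w \<in> S" unfolding w_def using S x(1) z0(1) by (simp add: N_def subspace_diff subspace_scale)
  moreover have "norm w = 1" using t by (simp add: w_def t_def)
  moreover have "norm (f w) < e"
  proof -
    have "f w = (1 / t) *\<^sub>R f x"
      using z0(1) by (simp add: w_def linear_scale[OF f] linear_diff[OF f] N_def)
    moreover have "1 / e * norm (f x) < t" using x(2)[of z0] z0(1) by (simp add: t_def N_def)
    ultimately show ?thesis using t e by (simp add: field_simps)
  qed
  moreover have "1 / 2 \<le> norm (w - z)" if "z \<in> S" "f z = 0" for z
  proof -
    have "z0 + t *\<^sub>R z \<in> N"
      using that z0(1) S by (simp add: N_def subspace_add subspace_scale linear_add[OF f] linear_scale[OF f])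
    then have "d \<le> norm (x - (z0 + t *\<^sub>R z))" unfolding d_def using infdist_le by (metis dist_norm)
    also have "x - (z0 + t *\<^sub>R z) = t *\<^sub>R (w - z)"
      using t by (simp add: w_def scaleR_diff_right)
    finally have "d \<le> t * norm (w - z)" using t by simp
    also have "\<dots> \<le> 2 * d * norm (w - z)" using t by (intro mult_right_mono) auto
    finally show ?thesis using d by simp
  qed
  ultimately show ?thesis by blast
qed

text \<open>Without the estimate, near null vectors would have a subsequence converging to a null
  vector in \<open>S\<close>, from which they keep distance 1/2. The form relative to
  \<open>S\<close> serves \<open>finite_ascent\<close>, where \<open>S\<close> is an intersection of
  ranges.\<close>

lemma estimate_if_rel_compact:
  fixes f :: "'a::real_normed_vector \<Rightarrow> 'b::real_normed_vector"
  assumes f: "bounded_linear f" and S: "subspace S" "closed S"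
    and rc: "\<And>u. Bseq u \<Longrightarrow> (\<And>n. u n \<in> S) \<Longrightarrow> (\<lambda>n. f (u n)) \<longlonglongrightarrow> 0 \<Longrightarrow> rel_compact_seq u"
  shows "\<exists>C. \<forall>x\<in>S. \<exists>z\<in>S. f z = 0 \<and> norm (x - z) \<le> C * norm (f x)"
proof (rule ccontr)
  assume neg: "\<not> ?thesis"
  have "\<exists>w\<in>S. norm w = 1 \<and> norm (f w) < (1 / 2) ^ n \<and> (\<forall>z\<in>S. f z = 0 \<longrightarrow> 1 / 2 \<le> norm (w - z))" for n :: nat
    using near_null_vector[OF bounded_linear.linear[OF f] S(1) neg] by simp
  then obtain w where w: "\<And>n. w n \<in> S" "\<And>n. norm (w n) = 1" "\<And>n. norm (f (w n)) < (1 / 2) ^ n"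
    "\<And>n z. z \<in> S \<Longrightarrow> f z = 0 \<Longrightarrow> 1 / 2 \<le> norm (w n - z)" by metis
  have lim: "(\<lambda>n. f (w n)) \<longlonglongrightarrow> 0"
    by (rule Lim_null_comparison[of _ "\<lambda>n. (1 / 2) ^ n"])
      (use w(3) in \<open>auto intro!: always_eventually LIMSEQ_power_zero less_imp_le\<close>)
  have "Bseq w" using w(2) by (intro BseqI'[of _ 1]) simp
  then have "rel_compact_seq w" using rc w(1) lim by blast
  then obtain s l where s: "strict_mono s" "(\<lambda>n. w (s n)) \<longlonglongrightarrow> l" by (rule rel_compact_seqD)
  have "l \<in> S" using closed_sequentially[OF S(2), of "\<lambda>n. w (s n)" l] w(1) s(2) by simp
  moreover have "f l = 0"
    using bounded_linear.tendsto[OF f s(2)] LIMSEQ_subseq_LIMSEQ[OF lim s(1)]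
    by (auto simp: comp_def intro: LIMSEQ_unique)
  ultimately have "1 / 2 \<le> norm (w (s n) - l)" for n using w(4)[of l "s n"] by simp
  moreover have "(\<lambda>n. norm (w (s n) - l)) \<longlonglongrightarrow> 0"
    using s(2) by (simp add: LIM_zero tendsto_norm_zero)
  ultimately have "(1 / 2 :: real) \<le> 0" by (intro LIMSEQ_le_const) auto
  then show False by simp
qed

section \<open>Upper semi-Fredholm operators\<close>

lemma linear_cblinfun_apply: "linear (cblinfun_apply f)"
  by (rule bounded_linear.linear[OF bounded_linear_cblinfun_apply])

lemma csubspace_null_space: "cvs.subspace (null_space (cblinfun_apply T))"
  using linear_0[OF linear_cblinfun_apply[of T]]
    linear_add[OF linear_cblinfun_apply[of T]]
  by (auto simp: null_space_def cvs.subspace_def cblinfun_apply_scaleC)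

lemma bounded_below_iff:
  fixes T :: "('a::cbanach, 'a) cblinfun"
  shows "bounded_below T \<longleftrightarrow> (\<exists>c>0. \<forall>x. c * norm x \<le> norm (T x))"
proof
  assume bb: "bounded_below T"
  then obtain C where C: "\<And>x. \<exists>z. T z = 0 \<and> norm (x - z) \<le> C * norm (T x)"
    using open_mapping_estimate[OF bounded_linear_cblinfun_apply[of T]]
    unfolding bounded_below_def by blast
  have "1 / (\<bar>C\<bar> + 1) * norm x \<le> norm (T x)" for x
  proof -
    obtain z where z: "T z = 0" "norm (x - z) \<le> C * norm (T x)" using C by blast
    have "z = 0" using z(1) bb unfolding bounded_below_def null_space_def by blast
    then have "norm x \<le> C * norm (T x)" using z by simp
    also have "\<dots> \<le> (\<bar>C\<bar> + 1) * norm (T x)" by (intro mult_right_mono) auto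
    finally show ?thesis by (simp add: field_simps)
  qed
  moreover have "0 < 1 / (\<bar>C\<bar> + 1)" by simp
  ultimately show "\<exists>c>0. \<forall>x. c * norm x \<le> norm (T x)" by blast
next
  assume "\<exists>c>0. \<forall>x. c * norm x \<le> norm (T x)"
  then obtain c where c: "0 < c" "\<And>x. c * norm x \<le> norm (T x)" by blast
  have T0: "T 0 = 0" by (rule linear_0[OF linear_cblinfun_apply])
  have "x = 0" if "T x = 0" for x
    using c(2)[of x] c(1) that by (simp add: mult_le_0_iff)
  then have "null_space T = {0}" using T0 by (auto simp: null_space_def)
  moreover have "closed (range T)"
  proof (rule closed_range_if_estimate[OF bounded_linear_cblinfun_apply])
    have "norm x \<le> 1 / c * norm (T x)" for x using c by (simp add: field_simps)
    then show "\<exists>z. T z = 0 \<and> norm (x - z) \<le> 1 / c * norm (T x)" for x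
      using T0 by (intro exI[of _ 0]) simp
  qed
  ultimately show "bounded_below T" by (simp add: bounded_below_def)
qed

text \<open>A sequential substitute for being upper semi-Fredholm. It passes to powers at once,
  which closedness of the range alone would not.\<close>

definition proper_on_bounded :: "('a::real_normed_vector \<Rightarrow> 'b::real_normed_vector) \<Rightarrow> bool"
  where "proper_on_bounded f \<longleftrightarrow> (\<forall>u. Bseq u \<longrightarrow> rel_compact_seq (\<lambda>n. f (u n)) \<longrightarrow> rel_compact_seq u)"

lemma Bseq_bounded_linear:
  assumes "bounded_linear f" "Bseq u"
  shows "Bseq (\<lambda>n. f (u n))"
proof -
  obtain M where M: "\<And>n. norm (u n) \<le> M" using assms(2) unfolding Bseq_def by blast
  obtain K where K: "0 \<le> K" "\<And>x. norm (f x) \<le> norm x * K"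
    using bounded_linear.nonneg_bounded[OF assms(1)] by blast
  have "norm (f (u n)) \<le> M * K" for n
    using K(2)[of "u n"] mult_right_mono[OF M K(1), of n] by linarith
  then show ?thesis by (rule BseqI')
qed

lemma bounded_linear_funpow:
  fixes f :: "'a::real_normed_vector \<Rightarrow> 'a"
  assumes "bounded_linear f"
  shows "bounded_linear (f ^^ n)"
  by (induction n)
    (simp_all add: id_def bounded_linear_ident bounded_linear_compose[OF assms] comp_def)

lemma proper_on_bounded_funpow:
  fixes f :: "'a::real_normed_vector \<Rightarrow> 'a"
  assumes "bounded_linear f" "proper_on_bounded f"
  shows "proper_on_bounded (f ^^ n)"
proof (induction n)
  case (Suc n)
  show ?case
    unfolding proper_on_bounded_def
  proof (intro allI impI)
    fix u :: "nat \<Rightarrow> 'a" assume u: "Bseq u" "rel_compact_seq (\<lambda>k. (f ^^ Suc n) (u k))"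
    have "Bseq (\<lambda>k. (f ^^ n) (u k))"
      using bounded_linear_funpow[OF assms(1)] u(1) by (rule Bseq_bounded_linear)
    then have "rel_compact_seq (\<lambda>k. (f ^^ n) (u k))"
      using assms(2) u(2) unfolding proper_on_bounded_def by simp
    then show "rel_compact_seq u" using Suc u(1) unfolding proper_on_bounded_def by simp
  qed
qed (simp add: proper_on_bounded_def)

lemma closed_range_if_proper:
  fixes f :: "'a::banach \<Rightarrow> 'b::real_normed_vector"
  assumes f: "bounded_linear f" and p: "proper_on_bounded f"
  shows "closed (range f)"
proof -
  have "rel_compact_seq u" if "Bseq u" "(\<lambda>n. f (u n)) \<longlonglongrightarrow> 0" for u
    using p that convergent_imp_rel_compact_seq unfolding proper_on_bounded_def by blast
  then obtain C where "\<forall>x\<in>UNIV. \<exists>z\<in>UNIV. f z = 0 \<and> norm (x - z) \<le> C * norm (f x)"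
    using estimate_if_rel_compact[OF f subspace_UNIV closed_UNIV] by blast
  then show ?thesis using closed_range_if_estimate[OF f] by blast
qed

lemma upper_semi_fredholm_estimate:
  fixes T :: "('a::cbanach, 'a) cblinfun"
  assumes "upper_semi_fredholm T"
  obtains C where "0 < C" "\<And>x. \<exists>z\<in>null_space T. norm (x - z) \<le> C * norm (T x)"
proof -
  obtain C where C: "\<And>x. \<exists>z. T z = 0 \<and> norm (x - z) \<le> C * norm (T x)"
    using open_mapping_estimate[OF bounded_linear_cblinfun_apply[of T]] assms
    unfolding upper_semi_fredholm_def by blast
  show thesis
  proof
    show "0 < \<bar>C\<bar> + 1" by simp
    fix x
    obtain z where z: "T z = 0" "norm (x - z) \<le> C * norm (T x)" using C by blast
    have "C * norm (T x) \<le> (\<bar>C\<bar> + 1) * norm (T x)" by (intro mult_right_mono) auto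
    then show "\<exists>z\<in>null_space T. norm (x - z) \<le> (\<bar>C\<bar> + 1) * norm (T x)"
      using z by (intro bexI[of _ z]) (auto simp: null_space_def)
  qed
qed

text \<open>Along a subsequence \<open>T (u n)\<close> tends to some \<open>T x\<close>. Then
  \<open>u n - x\<close> differs by a null sequence from bounded vectors of the finite-dimensional
  null space.\<close>

lemma upper_semi_fredholm_proper:
  fixes T :: "('a::cbanach, 'a) cblinfun"
  assumes T: "upper_semi_fredholm T"
  shows "proper_on_bounded T"
  unfolding proper_on_bounded_def
proof (intro allI impI, rule rel_compact_seqI)
  fix u and r :: "nat \<Rightarrow> nat"
  assume u: "Bseq u" "rel_compact_seq (\<lambda>n. T (u n))" and r: "strict_mono r"
  interpret T: bounded_linear "cblinfun_apply T" by (rule bounded_linear_cblinfun_apply)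
  obtain s l where s: "strict_mono s" "(\<lambda>n. T (u (r (s n)))) \<longlonglongrightarrow> l"
    using u(2) r unfolding rel_compact_seq_def by blast
  have "closed (range T)" using T by (simp add: upper_semi_fredholm_def)
  then have "l \<in> range T" using closed_sequentially[OF _ _ s(2)] by blast
  then obtain x where x: "l = T x" by blast
  obtain C where C: "0 < C" "\<And>x. \<exists>z\<in>null_space T. norm (x - z) \<le> C * norm (T x)"
    using upper_semi_fredholm_estimate[OF T] by blast
  define v where "v n = u (r (s n)) - x" for n
  obtain z where z: "\<And>n. z n \<in> null_space T" "\<And>n. norm (v n - z n) \<le> C * norm (T (v n))"
  proof -
    have "\<forall>n. \<exists>z. z \<in> null_space T \<and> norm (v n - z) \<le> C * norm (T (v n))" using C(2) by blast
    from choice[OF this] show ?thesis using that by blast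
  qed
  have "(\<lambda>n. T (v n)) \<longlonglongrightarrow> 0" using s(2) by (simp add: v_def T.diff x LIM_zero)
  then have "(\<lambda>n. C * norm (T (v n))) \<longlonglongrightarrow> 0" by (intro tendsto_mult_right_zero tendsto_norm_zero)
  then have d0: "(\<lambda>n. v n - z n) \<longlonglongrightarrow> 0"
    by (rule Lim_null_comparison[rotated]) (simp add: z(2))
  have "Bseq (\<lambda>n. u (r (s n)))" using u(1) unfolding Bseq_def by blast
  from Bseq_add[OF this, of "- x"] have "Bseq v" unfolding v_def by simp
  moreover have "Bseq (\<lambda>n. v n - z n)" using d0 convergentI convergent_imp_Bseq by blast
  ultimately obtain M M' where M: "\<And>n. norm (v n) \<le> M" "\<And>n. norm (v n - z n) \<le> M'"
    unfolding Bseq_def by blast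
  have "norm (z n) \<le> M + M'" for n
    using norm_triangle_ineq4[of "v n" "v n - z n"] M[of n] by simp
  then have "Bseq z" by (rule BseqI')
  then have "rel_compact_seq z"
    using cdim_finite_rel_compact_seq[of "null_space T" z] T z(1)
    by (simp add: upper_semi_fredholm_def nullity_def)
  from rel_compact_seq_add[OF convergent_imp_rel_compact_seq[OF d0] this]
  have "rel_compact_seq v" by simp
  from rel_compact_seq_add[OF this convergent_imp_rel_compact_seq[OF tendsto_const[of x]]]
  have "rel_compact_seq (\<lambda>n. u (r (s n)))" unfolding v_def by simp
  then show "\<exists>s::nat \<Rightarrow> nat. strict_mono s \<and> rel_compact_seq (\<lambda>n. u (r (s n)))" using s(1) by blast
qed

lemma upper_semi_fredholm_closed_range_pow:
  fixes T :: "('a::cbanach, 'a) cblinfun"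
  assumes "upper_semi_fredholm T"
  shows "closed (range (cblinfun_apply T ^^ n))"
  by (intro closed_range_if_proper bounded_linear_funpow proper_on_bounded_funpow
      bounded_linear_cblinfun_apply upper_semi_fredholm_proper assms)

subsection \<open>Finite ascent\<close>

text \<open>The sequence is constant from an index of least dimension on. The common finite spanning
  set makes all bases finite, so that cardinalities can be compared.\<close>

lemma decseq_csubspace_stable:
  fixes M :: "nat \<Rightarrow> 'a::complex_normed_vector set"
  assumes M: "\<And>n. cvs.subspace (M n)" and dec: "\<And>m n. m \<le> n \<Longrightarrow> M n \<subseteq> M m"
    and fin: "finite B" "\<And>n. M n \<subseteq> cvs.span B"
  shows "\<exists>m. \<forall>n\<ge>m. M n = M m"
proof -
  obtain m where m: "\<And>n. cvs.dim (M m) \<le> cvs.dim (M n)"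
    using exists_least_iff[of "\<lambda>k. \<exists>n. k = cvs.dim (M n)"] by (metis not_le)
  have "M m \<subseteq> M n" if n: "m \<le> n" for n
  proof
    fix x assume x: "x \<in> M m"
    obtain C where C: "C \<subseteq> M n" "cvs.independent C" "M n \<subseteq> cvs.span C" "card C = cvs.dim (M n)"
      by (rule cvs.basis_exists)
    obtain D where D: "D \<subseteq> M m" "cvs.independent D" "M m \<subseteq> cvs.span D" "card D = cvs.dim (M m)"
      by (rule cvs.basis_exists)
    have finD: "finite D"
      using cvs.independent_span_bound[OF fin(1) D(2)] D(1) fin(2) by (meson order_trans)
    have finC: "finite C"
      using cvs.independent_span_bound[OF fin(1) C(2)] C(1) fin(2) by (meson order_trans)
    show "x \<in> M n"
    proof (rule ccontr)
      assume "x \<notin> M n"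
      moreover have "cvs.span C \<subseteq> M n" using cvs.span_minimal[OF C(1) M] .
      ultimately have xC: "x \<notin> cvs.span C" by blast
      then have "cvs.independent (insert x C)" using C(2) by (simp add: cvs.independent_insert)
      moreover have "insert x C \<subseteq> cvs.span D"
        using x C(1) dec[OF n] D(3) by blast
      ultimately have "card (insert x C) \<le> card D"
        using cvs.independent_span_bound[OF finD] by blast
      moreover have "x \<notin> C" using xC cvs.span_base by blast
      ultimately show False using finC C(4) D(4) m[of n] by simp
    qed
  qed
  then show ?thesis using dec by blast
qed

lemma funpow_range_antimono: "m \<le> n \<Longrightarrow> range (f ^^ n) \<subseteq> range (f ^^ m)" for f :: "'a \<Rightarrow> 'a"
proof -
  assume "m \<le> n"
  then have "f ^^ n = f ^^ m \<circ> f ^^ (n - m)" by (simp flip: funpow_add)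
  then show ?thesis by (auto simp: comp_def)
qed

lemma csubspace_range_pow:
  fixes T :: "('a::complex_normed_vector, 'a) cblinfun"
  shows "cvs.subspace (range (cblinfun_apply T ^^ n))"
proof -
  have add: "(cblinfun_apply T ^^ n) (x + y) = (cblinfun_apply T ^^ n) x + (cblinfun_apply T ^^ n) y" for x y
    by (rule linear_add[OF bounded_linear.linear[OF bounded_linear_funpow[OF bounded_linear_cblinfun_apply]]])
  have zero: "(cblinfun_apply T ^^ n) 0 = 0"
    by (rule linear_0[OF bounded_linear.linear[OF bounded_linear_funpow[OF bounded_linear_cblinfun_apply]]])
  have scale: "(cblinfun_apply T ^^ n) (c *\<^sub>C x) = c *\<^sub>C (cblinfun_apply T ^^ n) x" for c x
    by (induction n) (simp_all add: cblinfun_apply_scaleC)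
  show ?thesis
    unfolding cvs.subspace_def
  proof (intro conjI ballI allI)
    show "0 \<in> range (cblinfun_apply T ^^ n)" using zero by (rule range_eqI[OF sym])
    fix x y c assume "x \<in> range (cblinfun_apply T ^^ n)"
    then obtain x' where x: "x = (cblinfun_apply T ^^ n) x'" by (rule imageE)
    show "c *\<^sub>C x \<in> range (cblinfun_apply T ^^ n)"
      unfolding x scale[symmetric] by (rule rangeI)
    assume "y \<in> range (cblinfun_apply T ^^ n)"
    then obtain y' where y: "y = (cblinfun_apply T ^^ n) y'" by (rule imageE)
    show "x + y \<in> range (cblinfun_apply T ^^ n)"
      unfolding x y add[symmetric] by (rule rangeI)
  qed
qed

lemma shift_apply: "cblinfun_apply (shift T \<mu>) x = T x - \<mu> *\<^sub>C x"
  by (simp add: shift_def cblinfun_apply_diff scaleC_cblinfun_apply cblinfun_id_apply)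

text \<open>Otherwise \<open>N(T)\<close> meets the closed subspace \<open>Y = \<Inter>\<^sub>n R(T\<^sup>n)\<close>, on which \<open>T\<close> is
  surjective. A backward orbit \<open>y\<^sub>n\<close> in \<open>Y\<close> of a null vector, of at most geometric growth, then
  yields the eigenvectors \<open>\<Sum>n. \<mu>\<^sup>n y\<^sub>n\<close> for all small \<open>\<mu>\<close>.\<close>

lemma finite_ascent:
  fixes T :: "('a::cbanach, 'a) cblinfun"
  assumes T: "upper_semi_fredholm T" and r: "0 < r"
    and inj: "\<And>\<mu>. 0 < cmod \<mu> \<Longrightarrow> cmod \<mu> < r \<Longrightarrow> null_space (shift T \<mu>) = {0}"
  shows "\<exists>a. null_space (cblinfun_apply T ^^ a) = null_space (cblinfun_apply T ^^ (a + 1))"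
proof (rule ccontr)
  assume neg: "\<not> ?thesis"
  interpret T: bounded_linear "cblinfun_apply T" by (rule bounded_linear_cblinfun_apply)
  let ?T = "cblinfun_apply T"
  have pow0: "(?T ^^ n) 0 = 0" for n by (induction n) (simp_all add: T.zero)
  \<comment> \<open>These subspaces of the finite-dimensional null space decrease, hence are
    constant from some \<open>m\<close> on.\<close>
  define M where "M n = null_space T \<inter> range (?T ^^ n)" for n
  obtain B where B: "finite B" "cvs.span B = null_space T"
    using T cdim_finiteE unfolding upper_semi_fredholm_def nullity_def by blast
  have sub: "cvs.subspace (M n)" for n
    unfolding M_def by (intro cvs.subspace_inter csubspace_null_space csubspace_range_pow)
  have "M n \<subseteq> M m" if "m \<le> n" for m n
    unfolding M_def using funpow_range_antimono[OF that, of ?T] by blast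
  then obtain m where m: "\<And>n. n \<ge> m \<Longrightarrow> M n = M m"
    using decseq_csubspace_stable[of M B] sub B unfolding M_def by blast
  define Y where "Y = (\<Inter>n. range (?T ^^ n))"
  have YI: "y \<in> Y" if "\<And>n. n \<ge> m \<Longrightarrow> y \<in> range (?T ^^ n)" for y
    unfolding Y_def
  proof
    fix n
    show "y \<in> range (?T ^^ n)"
      using that[of "max m n"] funpow_range_antimono[of n "max m n" ?T] by auto
  qed
  \<comment> \<open>Infinite ascent makes the inclusion of null spaces strict also at this
    particular \<open>m\<close>; then \<open>(?T ^^ m) x\<close> lies in \<open>M m\<close>, and so
    in every range.\<close>
  obtain x where x: "(?T ^^ m) x \<noteq> 0" "(?T ^^ (m + 1)) x = 0"
  proof -
    have "null_space (?T ^^ m) \<subseteq> null_space (?T ^^ (m + 1))"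
      by (auto simp: null_space_def T.zero)
    then show ?thesis using neg that by (auto simp: null_space_def)
  qed
  define e where "e = (1 / norm ((?T ^^ m) x)) *\<^sub>R (?T ^^ m) x"
  have e1: "norm e = 1" using x(1) by (simp add: e_def)
  have "(?T ^^ m) x \<in> M m" using x(2) by (simp add: M_def null_space_def)
  then have eM: "e \<in> M m" unfolding e_def using csubspace_imp_subspace[OF sub] by (simp add: subspace_scale)
  have eN: "T e = 0" using eM by (simp add: M_def null_space_def)
  have eY: "e \<in> Y" using eM m by (intro YI) (auto simp: M_def)
  have onto: "\<exists>x\<in>Y. T x = y" if y: "y \<in> Y" for y
  proof -
    have pre: "\<exists>x. x \<in> range (?T ^^ n) \<and> T x = y" for n
    proof -
      have "y \<in> range (?T ^^ Suc n)" using y unfolding Y_def by blast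
      then show ?thesis by auto
    qed
    obtain x where x: "x \<in> range (?T ^^ m)" "T x = y" using pre by blast
    \<comment> \<open>A preimage taken from a smaller range differs from \<open>x\<close> by an
      element of \<open>M m = M n\<close>, so \<open>x\<close> lies in that range too.\<close>
    have "x \<in> Y"
    proof (rule YI)
      fix n assume n: "n \<ge> m"
      obtain x' where x': "x' \<in> range (?T ^^ n)" "T x' = y" using pre by blast
      have "x' \<in> range (?T ^^ m)" using x'(1) funpow_range_antimono[OF n, of ?T] by blast
      then have "x - x' \<in> M m"
        using x x'(2) cvs.subspace_diff[OF csubspace_range_pow] by (simp add: M_def null_space_def T.diff)
      then have "x - x' \<in> range (?T ^^ n)" using m[OF n] by (auto simp: M_def)
      from cvs.subspace_add[OF csubspace_range_pow this x'(1)] show "x \<in> range (?T ^^ n)" by simp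
    qed
    then show ?thesis using x(2) by blast
  qed
  have Ysub: "subspace Y"
    unfolding Y_def by (intro subspace_Inter) (auto intro: csubspace_imp_subspace csubspace_range_pow)
  have Ycl: "closed Y"
    unfolding Y_def by (intro closed_INT ballI upper_semi_fredholm_closed_range_pow T)
  have "rel_compact_seq u" if "Bseq u" "(\<lambda>n. T (u n)) \<longlonglongrightarrow> 0" for u
    using upper_semi_fredholm_proper[OF T] that convergent_imp_rel_compact_seq
    unfolding proper_on_bounded_def by blast
  \<comment> \<open>The estimate is taken inside \<open>Y\<close>, so that correcting a preimage by
    a null vector does not leave \<open>Y\<close>.\<close>
  then obtain C0 where C0: "\<And>x. x \<in> Y \<Longrightarrow> \<exists>z\<in>Y. T z = 0 \<and> norm (x - z) \<le> C0 * norm (T x)"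
    using estimate_if_rel_compact[OF bounded_linear_cblinfun_apply[of T] Ysub Ycl] by blast
  define C where "C = \<bar>C0\<bar> + 1"
  have C: "1 \<le> C" "C0 \<le> C" by (simp_all add: C_def)
  have "\<exists>x. x \<in> Y \<and> T x = y \<and> norm x \<le> C * norm y" if y: "y \<in> Y" for y
  proof -
    obtain x where x: "x \<in> Y" "T x = y" using onto y by blast
    obtain z where z: "z \<in> Y" "T z = 0" "norm (x - z) \<le> C0 * norm (T x)" using C0 x(1) by blast
    have "C0 * norm (T x) \<le> C * norm (T x)" using C by (intro mult_right_mono) auto
    then have "norm (x - z) \<le> C * norm y" using z(3) x(2) by simp
    moreover have "T (x - z) = y" using x z by (simp add: T.diff)
    moreover have "x - z \<in> Y" using Ysub x z by (simp add: subspace_diff)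
    ultimately show ?thesis by blast
  qed
  then have "\<forall>y. \<exists>x. y \<in> Y \<longrightarrow> x \<in> Y \<and> T x = y \<and> norm x \<le> C * norm y" by blast
  from choice[OF this] obtain g
    where g: "\<And>y. y \<in> Y \<Longrightarrow> g y \<in> Y" "\<And>y. y \<in> Y \<Longrightarrow> T (g y) = y"
      "\<And>y. y \<in> Y \<Longrightarrow> norm (g y) \<le> C * norm y" by blast
  define y where "y n = (g ^^ n) e" for n
  have yY: "y n \<in> Y" for n by (induction n) (simp_all add: y_def eY g(1))
  have yn: "norm (y n) \<le> C ^ n" for n
  proof (induction n)
    case (Suc n)
    have "norm (y (Suc n)) \<le> C * norm (y n)" using g(3)[OF yY[of n]] by (simp add: y_def)
    also have "\<dots> \<le> C * C ^ n" using Suc C by (intro mult_left_mono) auto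
    finally show ?case by simp
  qed (simp add: y_def e1)
  have Ty: "T (y (Suc n)) = y n" for n using g(2)[OF yY[of n]] by (simp add: y_def)
  have y0: "y 0 = e" by (simp add: y_def)
  \<comment> \<open>The bound \<open>r / 2\<close> puts \<mu> where \<open>inj\<close> applies; the
    other makes the series of \<open>\<mu> ^ n *\<^sub>R y n\<close> converge with a tail smaller
    than its first term \<open>e\<close>.\<close>
  define \<mu> where "\<mu> = min (r / 2) (1 / (4 * C))"
  have \<mu>: "0 < \<mu>" "\<mu> < r" "\<mu> * C \<le> 1 / 4"
  proof -
    have "\<mu> \<le> 1 / (4 * C)" by (simp add: \<mu>_def)
    then show "\<mu> * C \<le> 1 / 4" using C by (simp add: field_simps)
    show "0 < \<mu>" "\<mu> < r" using r C by (auto simp: \<mu>_def min_def)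
  qed
  define f where "f n = \<mu> ^ n *\<^sub>R y n" for n
  have fn: "norm (f n) \<le> (1 / 4) ^ n" for n
  proof -
    have "norm (f n) \<le> \<mu> ^ n * C ^ n" using yn[of n] \<mu>(1) by (simp add: f_def)
    also have "\<dots> = (\<mu> * C) ^ n" by (simp add: power_mult_distrib)
    also have "\<dots> \<le> (1 / 4) ^ n" using \<mu> C by (intro power_mono) auto
    finally show ?thesis .
  qed
  have sg: "summable (\<lambda>n. (1 / 4 :: real) ^ n)" by (rule summable_geometric) simp
  have sn: "summable (\<lambda>n. norm (f n))"
    by (rule summable_comparison_test'[OF sg, of 0]) (use fn in simp)
  have sf: "summable f" by (rule summable_norm_cancel[OF sn])
  define v where "v = suminf f"
  have fs: "f sums v" unfolding v_def by (rule summable_sums[OF sf])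
  have "(\<lambda>n. T (f n)) sums T v" by (rule T.sums[OF fs])
  \<comment> \<open>\<open>T\<close> kills the term of index 0 and turns each later term into \<mu>
    times its predecessor, which makes \<open>v\<close> an eigenvector.\<close>
  then have "(\<lambda>n. T (f (Suc n))) sums (T v - T (f 0))" by (subst sums_Suc_iff) simp
  moreover have "T (f (Suc n)) = \<mu> *\<^sub>R f n" for n by (simp add: f_def T.scaleR Ty)
  moreover have "T (f 0) = 0" by (simp add: f_def y0 eN)
  ultimately have "(\<lambda>n. \<mu> *\<^sub>R f n) sums T v" by simp
  moreover have "(\<lambda>n. \<mu> *\<^sub>R f n) sums (\<mu> *\<^sub>R v)" by (rule sums_scaleR_right[OF fs])
  ultimately have "T v = \<mu> *\<^sub>R v" by (rule sums_unique2)
  then have "v \<in> null_space (shift T (of_real \<mu>))"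
    by (simp add: null_space_def shift_apply scaleC_of_real)
  then have "v = 0" using inj[of "of_real \<mu>"] \<mu> by simp
  \<comment> \<open>The tail has norm at most 1/4 + 1/16 + ... = 1/3, whereas \<open>e\<close> has
    norm 1, so \<open>v\<close> cannot vanish.\<close>
  have "(\<lambda>n. f (Suc n)) sums (v - e)" using fs by (subst sums_Suc_iff) (simp add: f_def y0)
  moreover have "summable (\<lambda>n. norm (f (Suc n)))" using sn by (subst summable_Suc_iff)
  ultimately have "norm (v - e) \<le> (\<Sum>n. norm (f (Suc n)))"
    using summable_norm[of "\<lambda>n. f (Suc n)"] by (simp flip: sums_unique)
  also have "\<dots> \<le> (\<Sum>n. (1 / 4) * (1 / 4) ^ n)"
    using fn[of "Suc _"] \<open>summable (\<lambda>n. norm (f (Suc n)))\<close> summable_mult[OF sg, of "1 / 4"]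
    by (intro suminf_le) auto
  also have "\<dots> = 1 / 3" by (subst suminf_mult[OF sg]) (simp add: suminf_geometric)
  finally show False using e1 \<open>v = 0\<close> by simp
qed

section \<open>The Hahn-Banach theorem\<close>

text \<open>Homogeneity is stated as an inequality because infima inherit it directly;
  \<open>sublinear_scaleR\<close> recovers equality by scaling back.\<close>

definition sublinear :: "('a::real_vector \<Rightarrow> real) \<Rightarrow> bool"
  where "sublinear p \<longleftrightarrow> (\<forall>x y. p (x + y) \<le> p x + p y) \<and> (\<forall>c>0. \<forall>x. p (c *\<^sub>R x) \<le> c * p x)"

lemma sublinear_add: "sublinear p \<Longrightarrow> p (x + y) \<le> p x + p y"
  and sublinear_scaleR_le: "sublinear p \<Longrightarrow> 0 < c \<Longrightarrow> p (c *\<^sub>R x) \<le> c * p x"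
  by (simp_all add: sublinear_def)

lemma sublinear_scaleR:
  assumes "sublinear p" "0 < c"
  shows "p (c *\<^sub>R x) = c * p x"
proof (rule antisym)
  have "p ((1 / c) *\<^sub>R c *\<^sub>R x) \<le> 1 / c * p (c *\<^sub>R x)"
    using assms by (intro sublinear_scaleR_le) auto
  then show "c * p x \<le> p (c *\<^sub>R x)" using assms(2) by (simp add: field_simps)
qed (rule sublinear_scaleR_le[OF assms])

lemma sublinear_zero: "sublinear p \<Longrightarrow> p 0 = 0"
  using sublinear_scaleR[of p 2 0] by simp

lemma sublinear_minus: "sublinear p \<Longrightarrow> - p (- x) \<le> p x"
  using sublinear_add[of p x "- x"] sublinear_zero[of p] by simp

text \<open>Lower \<open>p\<close> along the ray through \<open>v\<close> by the infimum of p (x + t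
  v) - t p v over t \<ge> 0, which is finite since these values are at least - p (- x). This serves
  both to prescribe a value and to show that minimal sublinear functionals are odd.\<close>

lemma sublinear_directional:
  fixes p :: "'a::real_vector \<Rightarrow> real"
  assumes p: "sublinear p"
  shows "\<exists>q. sublinear q \<and> (\<forall>x. q x \<le> p x) \<and> q (- v) \<le> - p v"
proof -
  define q where "q x = (INF t\<in>{0..}. p (x + t *\<^sub>R v) - t * p v)" for x
  have lower: "- p (- x) \<le> p (x + t *\<^sub>R v) - t * p v" if "0 \<le> t" for x t
  proof -
    have "t * p v = p (t *\<^sub>R v)"
      using that sublinear_scaleR[OF p, of t v] sublinear_zero[OF p] by (cases "t = 0") auto
    also have "\<dots> \<le> p (x + t *\<^sub>R v) + p (- x)"
      using sublinear_add[OF p, of "x + t *\<^sub>R v" "- x"] by simp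
    finally show ?thesis by simp
  qed
  have bdd: "bdd_below ((\<lambda>t. p (x + t *\<^sub>R v) - t * p v) ` {0..})" for x
    using lower by (intro bdd_belowI2) auto
  have le: "q x \<le> p (x + t *\<^sub>R v) - t * p v" if "0 \<le> t" for x t
    unfolding q_def using that by (intro cINF_lower[OF bdd]) auto
  have ge: "a \<le> q x" if "\<And>t. 0 \<le> t \<Longrightarrow> a \<le> p (x + t *\<^sub>R v) - t * p v" for a x
    unfolding q_def using that by (intro cINF_greatest) auto
  have "q (x + y) \<le> q x + q y" for x y
  proof -
    have "q (x + y) - (p (x + s *\<^sub>R v) - s * p v) \<le> p (y + t *\<^sub>R v) - t * p v"
      if "0 \<le> s" "0 \<le> t" for s t
    proof -
      have "q (x + y) \<le> p ((x + s *\<^sub>R v) + (y + t *\<^sub>R v)) - (s + t) * p v"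
        using le[of "s + t" "x + y"] that by (simp add: algebra_simps)
      then show ?thesis
        using sublinear_add[OF p, of "x + s *\<^sub>R v" "y + t *\<^sub>R v"] by (simp add: algebra_simps)
    qed
    then have "q (x + y) - (p (x + s *\<^sub>R v) - s * p v) \<le> q y" if "0 \<le> s" for s
      using that by (intro ge) auto
    then have "q (x + y) - q y \<le> p (x + s *\<^sub>R v) - s * p v" if "0 \<le> s" for s
      using that by (simp add: algebra_simps)
    then have "q (x + y) - q y \<le> q x" by (intro ge) auto
    then show ?thesis by simp
  qed
  moreover have "q (c *\<^sub>R x) \<le> c * q x" if c: "0 < c" for c x
  proof -
    have "q (c *\<^sub>R x) / c \<le> p (x + t *\<^sub>R v) - t * p v" if t: "0 \<le> t" for t
    proof -
      have "q (c *\<^sub>R x) \<le> p (c *\<^sub>R (x + t *\<^sub>R v)) - c * t * p v"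
        using le[of "c * t" "c *\<^sub>R x"] c t by (simp add: algebra_simps)
      also have "\<dots> = c * (p (x + t *\<^sub>R v) - t * p v)"
        by (simp only: sublinear_scaleR[OF p c]) (simp add: right_diff_distrib)
      finally show ?thesis using c by (simp add: field_simps)
    qed
    then have "q (c *\<^sub>R x) / c \<le> q x" by (intro ge)
    then show ?thesis using c by (simp add: field_simps)
  qed
  ultimately have "sublinear q" by (simp add: sublinear_def)
  moreover have "q x \<le> p x" for x using le[of 0 x] by simp
  moreover have "q (- v) \<le> - p v" using le[of 1 "- v"] sublinear_zero[OF p] by simp
  ultimately show ?thesis by blast
qed

text \<open>Zorn's lemma: the pointwise infimum of a chain below \<open>p\<close> is again
  sublinear, and finite because each member at x is at least - p (- x).\<close>

lemma sublinear_minimal_exists: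
  fixes p :: "'a::real_vector \<Rightarrow> real"
  assumes p: "sublinear p"
  shows "\<exists>m. sublinear m \<and> (\<forall>x. m x \<le> p x) \<and> (\<forall>q. sublinear q \<longrightarrow> (\<forall>x. q x \<le> m x) \<longrightarrow> q = m)"
proof -
  define A where "A = {q. sublinear q \<and> (\<forall>x. q x \<le> p x)}"
  have "\<exists>m\<in>A. \<forall>a\<in>A. a \<le> m \<longrightarrow> a = m"
  proof (rule predicate_Zorn)
    \<comment> \<open>The order is reversed, so that a maximal element is minimal pointwise.\<close>
    show "partial_order_on A (relation_of (\<lambda>x y. y \<le> x) A)"
      unfolding partial_order_on_def preorder_on_def relation_of_def refl_on_def trans_def antisym_def
      by auto
    fix C assume C: "C \<in> Chains (relation_of (\<lambda>x y. y \<le> x) A)"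
    then have CA: "C \<subseteq> A" and chain: "\<And>q r. q \<in> C \<Longrightarrow> r \<in> C \<Longrightarrow> q \<le> r \<or> r \<le> q"
      unfolding Chains_def relation_of_def by auto
    show "\<exists>u\<in>A. \<forall>a\<in>C. u \<le> a"
    proof (cases "C = {}")
      case True
      then show ?thesis using p by (auto simp: A_def)
    next
      case False
      define u where "u x = (INF q\<in>C. q x)" for x
      have bdd: "bdd_below ((\<lambda>q. q x) ` C)" for x
      proof (rule bdd_belowI2)
        fix q assume "q \<in> C"
        then have "sublinear q" "q (- x) \<le> p (- x)" using CA by (auto simp: A_def)
        then show "- p (- x) \<le> q x" using sublinear_minus[of q x] by linarith
      qed
      have le: "u x \<le> q x" if "q \<in> C" for q x
        unfolding u_def by (rule cINF_lower[OF bdd that])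
      have ge: "a \<le> u x" if "\<And>q. q \<in> C \<Longrightarrow> a \<le> q x" for a x
        unfolding u_def using that False by (intro cINF_greatest)
      have "u (x + y) \<le> u x + u y" for x y
      proof -
        have key: "u (x + y) \<le> q x + r y" if qr: "q \<in> C" "r \<in> C" for q r
        proof -
          \<comment> \<open>The two infima on the right are independent, so both chain members have
            to be replaced by the smaller one.\<close>
          obtain s where s: "s \<in> C" "s \<le> q" "s \<le> r" using chain[OF qr] qr by blast
          have "u (x + y) \<le> s (x + y)" by (rule le[OF s(1)])
          also have "\<dots> \<le> s x + s y"
            using s(1) CA by (intro sublinear_add) (auto simp: A_def)
          also have "\<dots> \<le> q x + r y" using s by (intro add_mono) (auto simp: le_fun_def)
          finally show ?thesis .
        qed
        have "u (x + y) - q x \<le> u y" if q: "q \<in> C" for q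
        proof (rule ge)
          show "u (x + y) - q x \<le> r y" if "r \<in> C" for r using key[OF q that] by linarith
        qed
        then have "u (x + y) - u y \<le> q x" if "q \<in> C" for q using that by fastforce
        then have "u (x + y) - u y \<le> u x" by (rule ge)
        then show ?thesis by simp
      qed
      moreover have "u (c *\<^sub>R x) \<le> c * u x" if c: "0 < c" for c x
      proof -
        have "u (c *\<^sub>R x) / c \<le> q x" if q: "q \<in> C" for q
        proof -
          have "u (c *\<^sub>R x) \<le> q (c *\<^sub>R x)" by (rule le[OF q])
          also have "\<dots> \<le> c * q x"
            using q CA c by (intro sublinear_scaleR_le) (auto simp: A_def)
          finally show ?thesis using c by (simp add: field_simps)
        qed
        then have "u (c *\<^sub>R x) / c \<le> u x" by (rule ge)
        then show ?thesis using c by (simp add: field_simps)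
      qed
      ultimately have "sublinear u" by (simp add: sublinear_def)
      moreover have "u x \<le> p x" for x
      proof -
        obtain q where q: "q \<in> C" using False by blast
        then have "q x \<le> p x" using CA by (auto simp: A_def)
        then show ?thesis using le[OF q, of x] by linarith
      qed
      ultimately have "u \<in> A" by (simp add: A_def)
      then show ?thesis using le by (auto simp: le_fun_def)
    qed
  qed
  then obtain m where m: "m \<in> A" "\<And>a. a \<in> A \<Longrightarrow> a \<le> m \<Longrightarrow> a = m" by blast
  have "q = m" if "sublinear q" "\<forall>x. q x \<le> m x" for q
  proof (rule m(2))
    show "q \<in> A" using that m(1) unfolding A_def by (fastforce intro: order_trans)
  qed (use that(2) in \<open>simp add: le_fun_def\<close>)
  then show ?thesis using m(1) by (auto simp: A_def)
qed

text \<open>A minimal sublinear functional is odd by \<open>sublinear_directional\<close>, hence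
  linear. Starting the minimisation below a \<open>q\<close> with
  \<open>q (- x0) \<le> - p x0\<close> forces the value at \<open>x0\<close>.\<close>

theorem hahn_banach_sublinear:
  fixes p :: "'a::real_vector \<Rightarrow> real"
  assumes p: "sublinear p"
  shows "\<exists>f. linear f \<and> (\<forall>x. f x \<le> p x) \<and> f x0 = p x0"
proof -
  obtain q where q: "sublinear q" "\<And>x. q x \<le> p x" "q (- x0) \<le> - p x0"
    using sublinear_directional[OF p] by blast
  obtain m where m: "sublinear m" "\<And>x. m x \<le> q x"
    and min: "\<And>r. sublinear r \<Longrightarrow> (\<And>x. r x \<le> m x) \<Longrightarrow> r = m"
    using sublinear_minimal_exists[OF q(1)] by blast
  have neg: "m (- v) = - m v" for v
  proof (rule antisym)
    obtain r where r: "sublinear r" "\<And>x. r x \<le> m x" "r (- v) \<le> - m v"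
      using sublinear_directional[OF m(1)] by blast
    then show "m (- v) \<le> - m v" using min[OF r(1,2)] by simp
    show "- m v \<le> m (- v)" using sublinear_minus[OF m(1), of "- v"] by simp
  qed
  have add: "m (x + y) = m x + m y" for x y
    using sublinear_add[OF m(1), of x y] sublinear_add[OF m(1), of "x + y" "- y"] neg[of y] by simp
  have scale: "m (c *\<^sub>R x) = c * m x" for c x
  proof -
    consider "c = 0" | "0 < c" | "0 < - c" by linarith
    then show ?thesis
    proof cases
      case 3
      then show ?thesis using sublinear_scaleR[OF m(1) 3, of x] neg[of "c *\<^sub>R x"] by simp
    qed (simp_all add: sublinear_zero[OF m(1)] sublinear_scaleR[OF m(1)])
  qed
  have "linear m" by (rule linearI) (simp_all add: add scale)
  moreover have "m x \<le> p x" for x using m(2)[of x] q(2)[of x] by linarith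
  moreover have "m x0 = p x0"
    using neg[of x0] m(2)[of "- x0"] q(3) \<open>m x0 \<le> p x0\<close> by linarith
  ultimately show ?thesis by blast
qed

text \<open>The real functional \<open>f\<close> is the real part of the complex one x \<mapsto> f x
  - i f (i x). The bound by the norm serves to make the result continuous.\<close>

theorem hahn_banach_seminorm:
  fixes p :: "'a::complex_normed_vector \<Rightarrow> real"
  assumes add: "\<And>x y. p (x + y) \<le> p x + p y" and scale: "\<And>c x. p (c *\<^sub>C x) = cmod c * p x"
    and bound: "\<And>x. p x \<le> norm x"
  shows "\<exists>\<phi>::('a, complex) cblinfun. (\<forall>x. cmod (\<phi> x) \<le> p x) \<and> \<phi> x0 = of_real (p x0)"
proof -
  have "sublinear p"
    unfolding sublinear_def using add scale by (auto simp flip: scaleC_of_real)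
  then obtain f where f: "linear f" "\<And>x. f x \<le> p x" "f x0 = p x0"
    using hahn_banach_sublinear by blast
  define g where "g x = Complex (f x) (- f (\<i> *\<^sub>C x))" for x
  have g_add: "g (x + y) = g x + g y" for x y
    by (simp add: g_def linear_add[OF f(1)] scaleC_add_right complex_eq_iff)
  have g_scale: "g (c *\<^sub>C x) = c * g x" for c x
  proof -
    have split: "c *\<^sub>C y = Re c *\<^sub>R y + Im c *\<^sub>R \<i> *\<^sub>C y" for y :: 'a
      by (subst complex_eq[of c]) (simp add: scaleC_add_left mult.commute flip: scaleC_of_real)
    have "\<i> *\<^sub>C c *\<^sub>C x = Re c *\<^sub>R \<i> *\<^sub>C x - Im c *\<^sub>R x"
    proof -
      have "\<i> *\<^sub>C c *\<^sub>C x = c *\<^sub>C \<i> *\<^sub>C x" by (simp add: mult.commute)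
      also have "\<dots> = Re c *\<^sub>R \<i> *\<^sub>C x + Im c *\<^sub>R \<i> *\<^sub>C \<i> *\<^sub>C x" by (rule split)
      also have "\<i> *\<^sub>C \<i> *\<^sub>C x = - x" by simp
      finally show ?thesis by simp
    qed
    then have "f (\<i> *\<^sub>C c *\<^sub>C x) = Re c * f (\<i> *\<^sub>C x) - Im c * f x"
      by (simp only: linear_diff[OF f(1)] linear_scale[OF f(1)] real_scaleR_def)
    moreover have "f (c *\<^sub>C x) = Re c * f x + Im c * f (\<i> *\<^sub>C x)"
      by (simp only: split[of x] linear_add[OF f(1)] linear_scale[OF f(1)] real_scaleR_def)
    ultimately show ?thesis
      unfolding g_def complex_eq_iff by (simp del: scaleC_scaleC cvs.scale_scale)
  qed
  have g_le: "cmod (g x) \<le> p x" for x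
  proof (cases "g x = 0")
    case True
    have "0 \<le> p x" using add[of x "- x"] scale[of "-1" x] scale[of 0 x] by simp
    then show ?thesis using True by simp
  next
    case False
    \<comment> \<open>Rotates \<open>g x\<close> to the positive real axis, where only the real part
      \<open>f\<close> matters.\<close>
    define c where "c = cnj (g x) / cmod (g x)"
    have c1: "cmod c = 1" using False by (simp add: c_def norm_divide)
    have "c * g x = of_real (cmod (g x))"
      using False by (simp add: c_def mult.commute[of "cnj _"] complex_norm_square[symmetric] power2_eq_square)
    then have "cmod (g x) = Re (g (c *\<^sub>C x))" by (simp add: g_scale)
    also have "\<dots> \<le> p (c *\<^sub>C x)" using f(2) by (simp add: g_def)
    finally show ?thesis by (simp add: scale c1)
  qed
  have "bounded_linear g"
  proof (rule bounded_linear_intro[where K = 1])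
    show "g (r *\<^sub>R x) = r *\<^sub>R g x" for r x
      using g_scale[of "of_real r" x] by (simp add: scaleC_of_real scaleR_conv_of_real)
    show "cmod (g x) \<le> norm x * 1" for x using g_le[of x] bound[of x] by simp
  qed (rule g_add)
  then have app: "cblinfun_apply (CBlinfun g) = g"
    by (rule CBlinfun_apply) (simp add: g_scale scaleC_complex_def)
  have "g x0 = of_real (p x0)"
  proof -
    have "Re (g x0) = p x0" by (simp add: g_def f(3))
    \<comment> \<open>The real part already exhausts the bound \<open>p x0\<close> on the
      modulus.\<close>
    moreover have "Im (g x0) = 0"
    proof -
      have "(cmod (g x0))\<^sup>2 \<le> (p x0)\<^sup>2" using g_le[of x0] by (intro power_mono) auto
      then show ?thesis using \<open>Re (g x0) = p x0\<close> by (simp add: cmod_power2)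
    qed
    ultimately show ?thesis by (simp add: complex_eq_iff)
  qed
  then show ?thesis using g_le app by (intro exI[of _ "CBlinfun g"]) simp
qed

section \<open>Norming and separating functionals, and dual bases\<close>

lemma norming_functional:
  fixes x0 :: "'a::complex_normed_vector"
  shows "\<exists>\<phi>::('a, complex) cblinfun. (\<forall>x. cmod (\<phi> x) \<le> norm x) \<and> \<phi> x0 = of_real (norm x0)"
  by (rule hahn_banach_seminorm) (simp_all add: norm_triangle_ineq norm_scaleC)

text \<open>The distance to \<open>M\<close> is a seminorm that vanishes on \<open>M\<close> and is
  positive at \<open>x0\<close>; a functional dominated by it only needs rescaling.\<close>

lemma separating_functional:
  fixes M :: "'a::complex_normed_vector set"
  assumes M: "cvs.subspace M" "closed M" and x0: "x0 \<notin> M"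
  shows "\<exists>\<phi>::('a, complex) cblinfun. (\<forall>x\<in>M. \<phi> x = 0) \<and> \<phi> x0 = 1"
proof -
  have ne: "M \<noteq> {}" using cvs.subspace_0[OF M(1)] by blast
  have add: "infdist (x + y) M \<le> infdist x M + infdist y M" for x y
  proof (rule field_le_epsilon)
    fix e :: real assume e: "0 < e"
    obtain z where z: "z \<in> M" "dist x z < infdist x M + e / 2"
      using infdist_lessE[of x M "infdist x M + e / 2"] ne e by auto
    obtain w where w: "w \<in> M" "dist y w < infdist y M + e / 2"
      using infdist_lessE[of y M "infdist y M + e / 2"] ne e by auto
    have "infdist (x + y) M \<le> dist (x + y) (z + w)"
      using cvs.subspace_add[OF M(1) z(1) w(1)] by (rule infdist_le)
    also have "\<dots> \<le> dist x z + dist y w" by (rule dist_triangle_add)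
    finally show "infdist (x + y) M \<le> infdist x M + infdist y M + e" using z(2) w(2) by simp
  qed
  have scale_le: "infdist (c *\<^sub>C x) M \<le> cmod c * infdist x M" for c x
  proof (cases "c = 0")
    case True
    then show ?thesis using cvs.subspace_0[OF M(1)] by simp
  next
    case False
    have "infdist (c *\<^sub>C x) M / cmod c \<le> dist x z" if z: "z \<in> M" for z
    proof -
      have "infdist (c *\<^sub>C x) M \<le> dist (c *\<^sub>C x) (c *\<^sub>C z)"
        using cvs.subspace_scale[OF M(1) z] by (rule infdist_le)
      also have "\<dots> = cmod c * dist x z"
        by (simp add: dist_norm norm_scaleC flip: cvs.scale_right_diff_distrib)
      finally show ?thesis using False by (simp add: field_simps)
    qed
    then have "infdist (c *\<^sub>C x) M / cmod c \<le> infdist x M"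
      using ne by (subst (2) infdist_notempty) (auto intro!: cINF_greatest)
    then show ?thesis using False by (simp add: field_simps)
  qed
  have scale: "infdist (c *\<^sub>C x) M = cmod c * infdist x M" for c x
  proof (cases "c = 0")
    case False
    have "infdist (inverse c *\<^sub>C c *\<^sub>C x) M \<le> cmod (inverse c) * infdist (c *\<^sub>C x) M" by (rule scale_le)
    then have "cmod c * infdist x M \<le> infdist (c *\<^sub>C x) M"
      using False by (simp add: norm_inverse norm_divide field_simps)
    then show ?thesis using scale_le[of c x] by simp
  qed (use cvs.subspace_0[OF M(1)] in simp)
  have "infdist x M \<le> norm x" for x
    using infdist_le[OF cvs.subspace_0[OF M(1)], of x] by simp
  then obtain \<phi> :: "('a, complex) cblinfun"
    where \<phi>: "\<And>x. cmod (\<phi> x) \<le> infdist x M" "\<phi> x0 = of_real (infdist x0 M)"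
    using hahn_banach_seminorm[of "\<lambda>x. infdist x M" x0] add scale by blast
  have pos: "infdist x0 M \<noteq> 0" using in_closed_iff_infdist_zero[OF M(2) ne] x0 by blast
  have "cblinfun_apply ((1 / of_real (infdist x0 M)) *\<^sub>C \<phi>) x = 0" if "x \<in> M" for x
    using \<phi>(1)[of x] that by (simp add: scaleC_cblinfun_apply)
  moreover have "cblinfun_apply ((1 / of_real (infdist x0 M)) *\<^sub>C \<phi>) x0 = 1"
    using pos \<phi>(2) by (simp add: scaleC_cblinfun_apply scaleC_complex_def)
  ultimately show ?thesis by blast
qed

text \<open>Each basis vector is separated from the span of the others, which is closed by finite
  dimension.\<close>

lemma finite_dim_dual_basis:
  fixes N :: "'a::complex_normed_vector set"
  assumes "cdim N < \<infinity>"
  obtains B and F :: "'a \<Rightarrow> ('a, complex) cblinfun"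
  where "finite B" "B \<subseteq> N" "\<And>x. x \<in> N \<Longrightarrow> x = (\<Sum>b\<in>B. F b x *\<^sub>C b)"
proof -
  obtain B0 where B0: "finite B0" "cvs.span B0 = N" using cdim_finiteE[OF assms] by blast
  obtain B where B: "B \<subseteq> N" "cvs.independent B" "N \<subseteq> cvs.span B" "card B = cvs.dim N"
    by (rule cvs.basis_exists)
  have fin: "finite B" using cvs.independent_span_bound[OF B0(1) B(2)] B(1) B0(2) by blast
  have "\<exists>\<phi>::('a, complex) cblinfun. (\<forall>x\<in>B - {b}. \<phi> x = 0) \<and> \<phi> b = 1" if b: "b \<in> B" for b
  proof -
    have "b \<notin> cvs.span (B - {b})" using B(2) b cvs.dependent_def by blast
    moreover have "closed (cvs.span (B - {b}))"
    proof (rule cdim_finite_closed)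
      have "\<exists>C. finite C \<and> cvs.span C = cvs.span (B - {b})" using fin by blast
      then show "cdim (cvs.span (B - {b})) < \<infinity>" by (simp add: cdim_def)
    qed
    ultimately obtain \<phi> :: "('a, complex) cblinfun"
      where "\<forall>x\<in>cvs.span (B - {b}). \<phi> x = 0" "\<phi> b = 1"
      using separating_functional[OF cvs.subspace_span] by blast
    then show ?thesis using cvs.span_superset[of "B - {b}"] by (intro exI[of _ \<phi>]) blast
  qed
  then obtain F :: "'a \<Rightarrow> ('a, complex) cblinfun"
    where F: "\<And>b c. b \<in> B \<Longrightarrow> c \<in> B - {b} \<Longrightarrow> F b c = 0" "\<And>b. b \<in> B \<Longrightarrow> F b b = 1"
    by metis
  show thesis
  proof
    fix x assume "x \<in> N"
    then have "x \<in> cvs.span B" using B(3) by blast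
    then show "x = (\<Sum>b\<in>B. F b x *\<^sub>C b)"
    proof (induction rule: cvs.span_induct_alt)
      case base
      have "cblinfun_apply (F b) 0 = 0" for b
        by (rule linear_0[OF linear_cblinfun_apply])
      then show ?case by simp
    next
      case (step c b x)
      have Fadd: "F a (c *\<^sub>C b + x) = c * F a b + F a x" for a
        by (simp add: linear_add[OF linear_cblinfun_apply]
            cblinfun_apply_scaleC scaleC_complex_def)
      have "(\<Sum>a\<in>B. F a b *\<^sub>C a) = (\<Sum>a\<in>B. if a = b then b else 0)"
        using F step(1) by (intro sum.cong) auto
      also have "\<dots> = b" using fin step(1) by simp
      finally have "(\<Sum>a\<in>B. F a b *\<^sub>C a) = b" .
      moreover have "(\<Sum>a\<in>B. F a (c *\<^sub>C b + x) *\<^sub>C a)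
          = c *\<^sub>C (\<Sum>a\<in>B. F a b *\<^sub>C a) + (\<Sum>a\<in>B. F a x *\<^sub>C a)"
        by (simp only: Fadd scaleC_add_left sum.distrib cvs.scale_sum_right scaleC_scaleC)
      ultimately show ?case using step(2) by simp
    qed
  qed (use fin B(1) in auto)
qed

section \<open>Joint approximate eigenvectors of commuting operators\<close>

text \<open>The seminormed space to which \<open>approximate_eigenvalue_exists\<close> is applied consists of the
  sequences that \<open>D\<close> sends to a null sequence, with the upper limit of the distance to \<open>N(D)\<close>
  as seminorm.\<close>

lemma joint_approximate_eigenvector:
  fixes L D :: "('v::complex_normed_vector, 'v) cblinfun"
  assumes comm: "\<And>x. L (D x) = D (L x)"
    and neg: "\<nexists>C. \<forall>x. \<exists>z. D z = 0 \<and> norm (x - z) \<le> C * norm (D x)"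
  shows "\<exists>\<mu>. \<forall>\<epsilon>>0. \<exists>x. norm x \<le> 2 \<and> (\<forall>z. D z = 0 \<longrightarrow> 1 / 2 \<le> norm (x - z)) \<and> norm (D x) \<le> \<epsilon>
    \<and> (\<exists>z. D z = 0 \<and> norm (L x - \<mu> *\<^sub>C x - z) \<le> \<epsilon>)"
proof -
  interpret D: bounded_linear "cblinfun_apply D" by (rule bounded_linear_cblinfun_apply)
  interpret L: bounded_linear "cblinfun_apply L" by (rule bounded_linear_cblinfun_apply)
  define P where "P a u \<longleftrightarrow> (\<forall>\<^sub>F n in sequentially. \<exists>z. D z = 0 \<and> norm (u n - z) \<le> a)" for a :: real and u :: "nat \<Rightarrow> 'v"
  define E where "E = {u. (\<exists>a\<ge>0. P a u) \<and> (\<lambda>n. D (u n)) \<longlonglongrightarrow> 0}"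
  define q where "q u = Inf {a. 0 \<le> a \<and> P a u}" for u
  define S where "S = (\<lambda>c (u :: nat \<Rightarrow> 'v) n. c *\<^sub>C u n)"
  define L' where "L' = (\<lambda>(u :: nat \<Rightarrow> 'v) n. L (u n))"
  have P_mono: "P b u" if "P a u" "a \<le> b" for a b u
    using that(1) unfolding P_def by eventually_elim (use that(2) in \<open>meson order_trans\<close>)
  have P_add: "P (a + b) (u + v)" if "P a u" "P b v" for a b u v
    using that unfolding P_def
  proof eventually_elim
    case (elim n)
    then obtain z w where "D z = 0" "norm (u n - z) \<le> a" "D w = 0" "norm (v n - w) \<le> b" by blast
    then show ?case using norm_triangle_ineq[of "u n - z" "v n - w"]
      by (intro exI[of _ "z + w"]) (simp add: D.add algebra_simps)
  qed
  have P_scale: "P (cmod c * a) (S c u)" if "P a u" for c a u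
    using that unfolding P_def
  proof eventually_elim
    case (elim n)
    then obtain z where "D z = 0" "norm (u n - z) \<le> a" by blast
    then show ?case
      by (intro exI[of _ "c *\<^sub>C z"])
        (simp add: S_def cblinfun_apply_scaleC norm_scaleC mult_left_mono flip: cvs.scale_right_diff_distrib)
  qed
  have P_L: "P ((norm L + 1) * a) (L' u)" if "P a u" for a u
    using that unfolding P_def
  proof eventually_elim
    case (elim n)
    then obtain z where z: "D z = 0" "norm (u n - z) \<le> a" by blast
    have "norm (L (u n) - L z) \<le> norm L * norm (u n - z)"
      using norm_cblinfun[of L "u n - z"] by (simp add: L.diff)
    also have "\<dots> \<le> (norm L + 1) * a" using z(2) by (intro mult_mono) auto
    finally show ?case using z(1) comm[of z] L.zero by (intro exI[of _ "L z"]) (simp add: L'_def)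
  qed
  have q_le: "q u \<le> a" if "0 \<le> a" "P a u" for a u
    unfolding q_def using that by (intro cInf_lower bdd_belowI[of _ 0]) auto
  have q_less: "P a u" if qa: "q u < a" and uE: "u \<in> E" for a u
  proof -
    have "{a. 0 \<le> a \<and> P a u} \<noteq> {}" using uE by (auto simp: E_def)
    then obtain b where "P b u" "b < a" using cInf_lessD[OF _ qa[unfolded q_def]] by blast
    then show ?thesis using P_mono by (meson less_imp_le)
  qed
  have q_nonneg: "0 \<le> q u" if "u \<in> E" for u
    unfolding q_def using that by (intro cInf_greatest) (auto simp: E_def)
  have S_mem: "S c u \<in> E" if uE: "u \<in> E" for c u
  proof -
    obtain a where a: "0 \<le> a" "P a u" using uE by (auto simp: E_def)
    have "(\<lambda>n. c *\<^sub>C D (u n)) \<longlonglongrightarrow> c *\<^sub>C 0"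
      using uE by (intro bounded_linear.tendsto[OF bounded_linear_scaleC]) (simp add: E_def)
    then show ?thesis
      using P_scale[OF a(2), of c] a(1) unfolding E_def
      by (auto intro!: exI[of _ "cmod c * a"] simp: S_def cblinfun_apply_scaleC)
  qed
  have add_mem: "u + v \<in> E" if uv: "u \<in> E" "v \<in> E" for u v
  proof -
    obtain a b where a: "0 \<le> a" "P a u" "0 \<le> b" "P b v" using uv by (auto simp: E_def)
    have "(\<lambda>n. D (u n) + D (v n)) \<longlonglongrightarrow> 0 + 0"
      using uv by (intro tendsto_add) (simp_all add: E_def)
    then show ?thesis
      using P_add[OF a(2,4)] a(1,3) unfolding E_def
      by (auto intro!: exI[of _ "a + b"] simp: D.add)
  qed
  have zero_mem: "0 \<in> E"
    unfolding E_def P_def by (auto intro!: exI[of _ 0] simp: D.zero)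
  have q_scale_le: "q (S c u) \<le> cmod c * q u" if u: "u \<in> E" for c u
  proof (cases "c = 0")
    case True
    have "P 0 (S c u)" unfolding P_def S_def True by (auto intro!: exI[of _ 0] simp: D.zero)
    then show ?thesis using q_le[of 0] True by simp
  next
    case False
    have "q (S c u) / cmod c \<le> a" if "q u < a" for a
    proof -
      have "0 \<le> a" using q_nonneg[OF u] that by simp
      then have "q (S c u) \<le> cmod c * a" using P_scale[OF q_less[OF that u], of c] by (intro q_le) auto
      then show ?thesis using False by (simp add: field_simps)
    qed
    then have "q (S c u) / cmod c \<le> q u" by (rule dense_ge)
    then show ?thesis using False by (simp add: field_simps)
  qed
  interpret vector_space S
    by standard (auto simp: S_def plus_fun_def scaleC_add_right scaleC_add_left)
  interpret seminormed_operator S E q L' "norm L + 1"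
  proof
    show "subspace E" by (rule subspaceI) (use zero_mem add_mem S_mem in auto)
    show "L' (x + y) = L' x + L' y" for x y by (simp add: L'_def plus_fun_def L.add)
    show "L' (S c x) = S c (L' x)" for c x by (simp add: L'_def S_def cblinfun_apply_scaleC)
    show "0 < norm L + 1" by (simp add: add_nonneg_pos)
    fix u assume u: "u \<in> E"
    show "L' u \<in> E"
    proof -
      obtain a where a: "0 \<le> a" "P a u" using u by (auto simp: E_def)
      have "(\<lambda>n. L (D (u n))) \<longlonglongrightarrow> L 0"
        using u by (intro L.tendsto) (simp add: E_def)
      then have "(\<lambda>n. D (L' u n)) \<longlonglongrightarrow> 0" by (simp add: comm L.zero L'_def)
      moreover have "0 \<le> (norm L + 1) * a" using a(1) by simp
      ultimately show ?thesis using P_L[OF a(2)] unfolding E_def by blast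
    qed
    show "q (L' u) \<le> (norm L + 1) * q u"
    proof -
      have pos: "0 < norm L + 1" by (simp add: add_nonneg_pos)
      have "q (L' u) / (norm L + 1) \<le> a" if "q u < a" for a
      proof -
        have "0 \<le> a" using q_nonneg[OF u] that by simp
        then have "q (L' u) \<le> (norm L + 1) * a" using P_L[OF q_less[OF that u]] by (intro q_le) auto
        then show ?thesis using pos by (simp add: pos_divide_le_eq mult.commute)
      qed
      then have "q (L' u) / (norm L + 1) \<le> q u" by (rule dense_ge)
      then show ?thesis using pos by (simp add: pos_divide_le_eq mult.commute)
    qed
    show "q (S c u) = cmod c * q u" for c
    proof (cases "c = 0")
      case False
      have "S (inverse c) (S c u) = u" using False by (simp add: S_def)
      then have "q u \<le> cmod (inverse c) * q (S c u)"
        using q_scale_le[OF S_mem[OF u], of "inverse c" c] by simp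
      then have "cmod c * q u \<le> q (S c u)" using False by (simp add: norm_inverse norm_divide field_simps)
      then show ?thesis using q_scale_le[OF u, of c] by simp
    next
      case True
      then show ?thesis using q_scale_le[OF u, of c] q_nonneg[OF S_mem[OF u], of c] by simp
    qed
    fix v assume v: "v \<in> E"
    show "q (u + v) \<le> q u + q v"
    proof (rule field_le_epsilon)
      fix e :: real assume e: "0 < e"
      have "P ((q u + e / 2) + (q v + e / 2)) (u + v)"
        using e u v by (intro P_add q_less) auto
      then have "q (u + v) \<le> (q u + e / 2) + (q v + e / 2)"
        using e q_nonneg[OF u] q_nonneg[OF v] by (intro q_le) auto
      then show "q (u + v) \<le> q u + q v + e" by simp
    qed
  qed
  \<comment> \<open>The failing estimate supplies a sequence in \<open>E\<close> of positive
    seminorm: unit vectors that \<open>D\<close> nearly kills but that stay away from its null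
    space.\<close>
  have "\<exists>w\<in>UNIV. norm w = 1 \<and> norm (D w) < (1 / 2) ^ n \<and> (\<forall>z\<in>UNIV. D z = 0 \<longrightarrow> 1 / 2 \<le> norm (w - z))" for n :: nat
    using neg by (intro near_null_vector D.linear) auto
  then obtain w where w: "\<And>n. norm (w n) = 1" "\<And>n. norm (D (w n)) < (1 / 2) ^ n"
    "\<And>n z. D z = 0 \<Longrightarrow> 1 / 2 \<le> norm (w n - z)"
    by (metis UNIV_I)
  have "(\<lambda>n. D (w n)) \<longlonglongrightarrow> 0"
    by (rule Lim_null_comparison[of _ "\<lambda>n. (1 / 2) ^ n"])
      (use w(2) in \<open>auto intro!: always_eventually LIMSEQ_power_zero less_imp_le\<close>)
  moreover have "P 1 w" unfolding P_def
    by (intro always_eventually allI exI[of _ 0]) (simp add: D.zero w(1))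
  ultimately have wE: "w \<in> E" unfolding E_def by (auto intro: exI[of _ 1])
  have "0 < q w"
  proof (rule ccontr)
    assume "\<not> 0 < q w"
    then have "P (1 / 4) w" using q_less[OF _ wE, of "1 / 4"] by simp
    then have "\<forall>\<^sub>F n in sequentially. False"
      unfolding P_def
    proof eventually_elim
      case (elim n)
      then obtain z where "D z = 0" "norm (w n - z) \<le> 1 / 4" by blast
      then show False using w(3)[of z n] by linarith
    qed
    then show False by simp
  qed
  then obtain \<mu> where \<mu>: "\<And>\<epsilon>. 0 < \<epsilon> \<Longrightarrow> \<exists>u\<in>E. q (L' u - S \<mu> u) < \<epsilon> * q u"
    using approximate_eigenvalue_exists[OF wE] by blast
  show ?thesis
  proof (rule exI[of _ \<mu>], intro allI impI)
    fix \<epsilon> :: real assume \<epsilon>: "0 < \<epsilon>"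
    obtain u where u: "u \<in> E" and less: "q (L' u - S \<mu> u) < \<epsilon> * q u" using \<mu>[OF \<epsilon>] by blast
    define \<delta> where "\<delta> = q u"
    have E': "L' u - S \<mu> u \<in> E" using E_closed u by simp
    have "0 < \<epsilon> * \<delta>" using less q_nonneg[OF E'] by (simp add: \<delta>_def)
    then have \<delta>: "0 < \<delta>" using \<epsilon> by (simp add: zero_less_mult_iff)
    \<comment> \<open>The bounds 1, 2 and 4 hold for all large \<open>n\<close>, and by 3 a distance
      above \<delta>/2 occurs infinitely often, so one index satisfies all of them.\<close>
    have 1: "P (\<epsilon> * \<delta>) (L' u - S \<mu> u)" using less by (intro q_less E') (simp add: \<delta>_def)
    have 2: "P (2 * \<delta>) u" using \<delta> by (intro q_less u) (simp add: \<delta>_def)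
    have 3: "\<not> P (\<delta> / 2) u" using q_le[of "\<delta> / 2" u] \<delta> by (auto simp: \<delta>_def)
    have 4: "\<forall>\<^sub>F n in sequentially. norm (D (u n)) < \<epsilon> * \<delta>"
      using u \<open>0 < \<epsilon> * \<delta>\<close> tendstoD[of "\<lambda>n. D (u n)" 0 sequentially "\<epsilon> * \<delta>"]
      by (simp add: E_def dist_norm)
    have "\<exists>\<^sub>F n in sequentially. \<not> (\<exists>z. D z = 0 \<and> norm (u n - z) \<le> \<delta> / 2)"
      using 3 unfolding P_def by (simp add: frequently_def)
    from frequently_eventually_frequently[OF this
        eventually_conj[OF 1[unfolded P_def] eventually_conj[OF 2[unfolded P_def] 4]]]
    obtain n where n: "\<not> (\<exists>z. D z = 0 \<and> norm (u n - z) \<le> \<delta> / 2)"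
      "\<exists>z. D z = 0 \<and> norm ((L' u - S \<mu> u) n - z) \<le> \<epsilon> * \<delta>"
      "\<exists>z. D z = 0 \<and> norm (u n - z) \<le> 2 * \<delta>" "norm (D (u n)) < \<epsilon> * \<delta>"
      using frequently_ex by blast
    obtain z0 where z0: "D z0 = 0" "norm (u n - z0) \<le> 2 * \<delta>" using n(3) by blast
    obtain z1 where z1: "D z1 = 0" "norm (L (u n) - \<mu> *\<^sub>C u n - z1) \<le> \<epsilon> * \<delta>"
      using n(2) by (auto simp: L'_def S_def fun_diff_def)
    define x where "x = (1 / \<delta>) *\<^sub>R (u n - z0)"
    have "norm x \<le> 2" using z0(2) \<delta> unfolding x_def norm_scaleR by (simp add: field_simps)
    moreover have "1 / 2 \<le> norm (x - z)" if z: "D z = 0" for z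
    proof -
      have "D (z0 + \<delta> *\<^sub>R z) = 0" using z z0 by (simp add: D.add D.scaleR)
      then have "\<delta> / 2 < norm (u n - (z0 + \<delta> *\<^sub>R z))" using n(1) by (meson not_le)
      also have "u n - (z0 + \<delta> *\<^sub>R z) = \<delta> *\<^sub>R (x - z)"
        using \<delta> by (simp add: x_def scaleR_diff_right)
      finally have "\<delta> * (1 / 2) < \<delta> * norm (x - z)" using \<delta> by simp
      then show ?thesis using \<delta> by simp
    qed
    moreover have "norm (D x) \<le> \<epsilon>"
      using n(4) \<delta> unfolding x_def D.scaleR norm_scaleR by (simp add: D.diff z0(1) field_simps)
    moreover have "\<exists>z. D z = 0 \<and> norm (L x - \<mu> *\<^sub>C x - z) \<le> \<epsilon>"
    proof (intro exI conjI)
      \<comment> \<open>\<open>L\<close> maps the null space of \<open>D\<close> into itself, so the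
        effect of subtracting \<open>z0\<close> is absorbed into the null vector.\<close>
      let ?z = "(1 / \<delta>) *\<^sub>R (z1 - (L z0 - \<mu> *\<^sub>C z0))"
      show "D ?z = 0"
        using z0(1) z1(1) comm[of z0] by (simp add: D.scaleR D.diff cblinfun_apply_scaleC L.zero)
      have "L x - \<mu> *\<^sub>C x - ?z = (1 / \<delta>) *\<^sub>R (L (u n) - \<mu> *\<^sub>C u n - z1)"
      proof -
        have "\<mu> *\<^sub>C x = (1 / \<delta>) *\<^sub>R (\<mu> *\<^sub>C u n - \<mu> *\<^sub>C z0)"
          unfolding x_def by (simp add: mult.commute cvs.scale_right_diff_distrib flip: scaleC_of_real)
        then show ?thesis by (simp add: x_def L.scaleR L.diff scaleR_diff_right)
      qed
      then show "norm (L x - \<mu> *\<^sub>C x - ?z) \<le> \<epsilon>"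
        using z1(2) \<delta> by (simp only: norm_scaleR) (simp add: field_simps)
    qed
    ultimately show "\<exists>x. norm x \<le> 2 \<and> (\<forall>z. D z = 0 \<longrightarrow> 1 / 2 \<le> norm (x - z)) \<and> norm (D x) \<le> \<epsilon>
        \<and> (\<exists>z. D z = 0 \<and> norm (L x - \<mu> *\<^sub>C x - z) \<le> \<epsilon>)" by blast
  qed
qed

section \<open>Generalized derivations\<close>

lemma norm_cblinfun_bound:
  assumes "0 \<le> b" "\<And>x. norm (cblinfun_apply f x) \<le> b * norm x"
  shows "norm f \<le> b"
  unfolding norm_cblinfun_eq_onorm using assms by (rule onorm_bound)

lemma cblinfun_apply_sum: "cblinfun_apply (sum F I) x = (\<Sum>i\<in>I. cblinfun_apply (F i) x)"
  by (induction I rule: infinite_finite_induct) (simp_all add: zero_cblinfun_apply cblinfun_apply_add)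

definition rank_one :: "'a::complex_normed_vector \<Rightarrow> ('b::complex_normed_vector, complex) cblinfun \<Rightarrow> ('b, 'a) cblinfun"
  where "rank_one x \<phi> = CBlinfun (\<lambda>y. \<phi> y *\<^sub>C x)"

lemma rank_one_apply: "cblinfun_apply (rank_one x \<phi>) y = \<phi> y *\<^sub>C x"
  unfolding rank_one_def
  by (subst CBlinfun_apply)
    (simp_all add: bounded_linear_compose[OF bounded_linear_scaleC_left bounded_linear_cblinfun_apply]
      cblinfun_apply_scaleC scaleC_complex_def)

lemma norm_rank_one: "norm (rank_one x \<phi>) = norm x * norm \<phi>"
proof (rule antisym)
  show "norm (rank_one x \<phi>) \<le> norm x * norm \<phi>"
  proof (rule norm_cblinfun_bound)
    show "norm (cblinfun_apply (rank_one x \<phi>) y) \<le> norm x * norm \<phi> * norm y" for y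
      using mult_left_mono[OF norm_cblinfun[of \<phi> y], of "norm x"]
      by (simp add: rank_one_apply norm_scaleC mult_ac)
  qed simp
  show "norm x * norm \<phi> \<le> norm (rank_one x \<phi>)"
  proof (cases "x = 0")
    case False
    have "norm \<phi> \<le> norm (rank_one x \<phi>) / norm x"
    proof (rule norm_cblinfun_bound)
      show "norm (cblinfun_apply \<phi> y) \<le> norm (rank_one x \<phi>) / norm x * norm y" for y
        using norm_cblinfun[of "rank_one x \<phi>" y] False
        by (simp add: rank_one_apply norm_scaleC field_simps)
    qed simp
    then show ?thesis using False by (simp add: field_simps)
  qed simp
qed

lemma bounded_linear_rank_one: "bounded_linear (rank_one x)"
proof (rule bounded_linear_intro[where K = "norm x"])
  show "rank_one x (r *\<^sub>R \<phi>) = r *\<^sub>R rank_one x \<phi>" for r \<phi>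
    by (rule cblinfun_eqI) (simp only: rank_one_apply scaleR_cblinfun_apply scaleR_conv_of_real scaleC_of_real scaleC_scaleC[symmetric])
qed (auto intro!: cblinfun_eqI simp: rank_one_apply cblinfun_apply_add scaleC_add_left norm_rank_one)

text \<open>Reduces questions about the derivation at \<open>\<mu> - \<nu>\<close> to questions at 0
  for shifted operators.\<close>

lemma shift_generalized_derivation:
  "shift (generalized_derivation A B) (\<mu> - \<nu>) = generalized_derivation (shift A \<mu>) (shift B \<nu>)"
  by (intro cblinfun_eqI)
    (simp add: shift_apply generalized_derivation_apply cblinfun_apply_diff cblinfun_compose_apply
      scaleC_cblinfun_apply linear_diff[OF linear_cblinfun_apply] cblinfun_apply_scaleC
      cvs.scale_left_diff_distrib)

lemma shift_banach_adjoint: "shift (banach_adjoint B) \<nu> = banach_adjoint (shift B \<nu>)"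
  by (intro cblinfun_eqI)
    (simp add: shift_apply banach_adjoint_apply cblinfun_apply_diff cblinfun_compose_apply
      scaleC_cblinfun_apply linear_diff[OF linear_cblinfun_apply] cblinfun_apply_scaleC)

lemma shift_shift: "shift (shift T \<mu>) \<nu> = shift T (\<mu> + \<nu>)"
  by (intro cblinfun_eqI) (simp add: shift_apply scaleC_add_left)

lemma generalized_derivation_rank_one:
  "generalized_derivation A B (rank_one x \<phi>) = rank_one (A x) \<phi> - rank_one x (banach_adjoint B \<phi>)"
  by (rule cblinfun_eqI)
    (simp add: generalized_derivation_apply cblinfun_apply_diff cblinfun_compose_apply rank_one_apply
      cblinfun_apply_scaleC banach_adjoint_apply)

text \<open>Tested on \<open>rank_one x \<phi>\<close> with \<open>x\<close> and \<phi> almost null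
  for \<open>A\<close> and for the adjoint of \<open>B\<close>; the norm of a rank-one operator is
  the product of the norms.\<close>

lemma bounded_below_generalized_derivation:
  fixes A :: "('x::cbanach, 'x) cblinfun" and B :: "('y::cbanach, 'y) cblinfun"
  assumes "bounded_below (generalized_derivation A B)"
  shows "bounded_below A \<or> bounded_below (banach_adjoint B)"
proof (rule ccontr)
  assume neg: "\<not> ?thesis"
  obtain c where c: "0 < c" "\<And>U. c * norm U \<le> norm (generalized_derivation A B U)"
    using assms bounded_below_iff by blast
  have "\<not> (\<forall>x. c / 2 * norm x \<le> norm (A x))"
    using neg c(1) bounded_below_iff[of A] half_gt_zero by blast
  then obtain x where x: "norm (A x) < c / 2 * norm x" by (auto simp: not_le)
  have "\<not> (\<forall>\<phi>. c / 2 * norm \<phi> \<le> norm (banach_adjoint B \<phi>))"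
    using neg c(1) bounded_below_iff[of "banach_adjoint B"] half_gt_zero by blast
  then obtain \<phi> where \<phi>: "norm (banach_adjoint B \<phi>) < c / 2 * norm \<phi>" by (auto simp: not_le)
  have pos: "0 < norm x" "0 < norm \<phi>"
    using x \<phi> c(1) norm_ge_zero[of "A x"] norm_ge_zero[of "banach_adjoint B \<phi>"]
    by (auto simp: linear_0[OF linear_cblinfun_apply])
  have "c * (norm x * norm \<phi>) \<le> norm (A x) * norm \<phi> + norm x * norm (banach_adjoint B \<phi>)"
    using c(2)[of "rank_one x \<phi>"]
      norm_triangle_ineq4[of "rank_one (A x) \<phi>" "rank_one x (banach_adjoint B \<phi>)"]
    by (simp add: generalized_derivation_rank_one norm_rank_one)
  also have "\<dots> < (c / 2 * norm x) * norm \<phi> + norm x * (c / 2 * norm \<phi>)"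
    using x \<phi> pos by (intro add_strict_mono mult_strict_right_mono mult_strict_left_mono)
  finally show False by simp
qed

lemma approx_spectrum_generalized_derivation:
  fixes A :: "('x::cbanach, 'x) cblinfun" and B :: "('y::cbanach, 'y) cblinfun"
  assumes "\<mu> \<in> approx_spectrum A" "\<nu> \<in> approx_spectrum (banach_adjoint B)"
  shows "\<mu> - \<nu> \<in> approx_spectrum (generalized_derivation A B)"
  using assms bounded_below_generalized_derivation[of "shift A \<mu>" "shift B \<nu>"]
  by (auto simp: approx_spectrum_def shift_generalized_derivation shift_banach_adjoint)

text \<open>With one coordinate fixed, z \<mapsto> z - \<nu> and z \<mapsto> \<mu> - z map the two
  spectra into that of the derivation, so an isolating neighbourhood pulls back.\<close>

lemma iso_approx_spectrum_generalized_derivation: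
  fixes A :: "('x::cbanach, 'x) cblinfun" and B :: "('y::cbanach, 'y) cblinfun"
  assumes iso: "\<mu> - \<nu> \<in> iso (approx_spectrum (generalized_derivation A B))"
    and mem: "\<mu> \<in> approx_spectrum A" "\<nu> \<in> approx_spectrum (banach_adjoint B)"
  shows "\<mu> \<in> iso (approx_spectrum A)" "\<nu> \<in> iso (approx_spectrum (banach_adjoint B))"
proof -
  obtain T where T: "open T" "T \<inter> approx_spectrum (generalized_derivation A B) = {\<mu> - \<nu>}"
    using iso by (auto simp: iso_def isolated_in_def)
  have "open ((\<lambda>z. z - \<nu>) -` T)" by (intro open_vimage T(1) continuous_intros)
  moreover have "(\<lambda>z. z - \<nu>) -` T \<inter> approx_spectrum A = {\<mu>}"
  proof -
    have "x = \<mu>" if "x \<in> approx_spectrum A" "x - \<nu> \<in> T" for x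
    proof -
      have "x - \<nu> \<in> T \<inter> approx_spectrum (generalized_derivation A B)"
        using that approx_spectrum_generalized_derivation[OF _ mem(2)] by blast
      then show ?thesis using T(2) by simp
    qed
    moreover have "\<mu> - \<nu> \<in> T" using T(2) by blast
    ultimately show ?thesis using mem unfolding vimage_def by blast
  qed
  ultimately show "\<mu> \<in> iso (approx_spectrum A)"
    using mem(1) by (auto simp: iso_def isolated_in_def)
  have "open ((\<lambda>z. \<mu> - z) -` T)" by (intro open_vimage T(1) continuous_intros)
  moreover have "(\<lambda>z. \<mu> - z) -` T \<inter> approx_spectrum (banach_adjoint B) = {\<nu>}"
  proof -
    have "x = \<nu>" if "x \<in> approx_spectrum (banach_adjoint B)" "\<mu> - x \<in> T" for x
    proof -
      have "\<mu> - x \<in> T \<inter> approx_spectrum (generalized_derivation A B)"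
        using that approx_spectrum_generalized_derivation[OF mem(1)] by blast
      then show ?thesis using T(2) by simp
    qed
    moreover have "\<mu> - \<nu> \<in> T" using T(2) by blast
    ultimately show ?thesis using mem unfolding vimage_def by blast
  qed
  ultimately show "\<nu> \<in> iso (approx_spectrum (banach_adjoint B))"
    using mem(2) by (auto simp: iso_def isolated_in_def)
qed

subsection \<open>Relatively compact sequences of operators\<close>

lemma rel_compact_seq_compose_left:
  fixes A :: "('x::cbanach, 'x) cblinfun" and U :: "nat \<Rightarrow> ('y::complex_normed_vector, 'x) cblinfun"
  assumes "bounded_below A" "rel_compact_seq (\<lambda>n. A o\<^sub>C U n)"
  shows "rel_compact_seq U"
proof -
  obtain c where c: "0 < c" "\<And>x. c * norm x \<le> norm (A x)" using assms(1) bounded_below_iff by blast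
  have "norm V \<le> 1 / c * norm (A o\<^sub>C V)" for V :: "('y, 'x) cblinfun"
  proof (rule norm_cblinfun_bound)
    fix y
    show "norm (V y) \<le> 1 / c * norm (A o\<^sub>C V) * norm y"
      using c(2)[of "V y"] c(1) norm_cblinfun[of "A o\<^sub>C V" y]
      by (simp add: cblinfun_compose_apply field_simps)
  qed (use c(1) in simp)
  from rel_compact_seq_dominated[OF bounded_linear.linear[OF bounded_linear_cblinfun_compose_right]
      linear_ident this assms(2)]
  show ?thesis .
qed

text \<open>The hypothesis controls functionals only. It reaches an operator \<open>V\<close>
  through \<open>\<psi> o\<^sub>C V\<close> with \<psi> norming \<open>V y\<close>.\<close>

lemma rel_compact_seq_compose_right:
  fixes B :: "('y::cbanach, 'y) cblinfun" and U :: "nat \<Rightarrow> ('y, 'x::cbanach) cblinfun"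
  assumes "bounded_below (banach_adjoint B)" "rel_compact_seq (\<lambda>n. U n o\<^sub>C B)"
  shows "rel_compact_seq U"
proof -
  obtain c where c: "0 < c" "\<And>\<phi> :: ('y, complex) cblinfun. c * norm \<phi> \<le> norm (\<phi> o\<^sub>C B)"
    using assms(1) bounded_below_iff[of "banach_adjoint B"] by (auto simp: banach_adjoint_apply)
  have "norm V \<le> 1 / c * norm (V o\<^sub>C B)" for V :: "('y, 'x) cblinfun"
  proof (rule norm_cblinfun_bound)
    fix y
    obtain \<psi> :: "('x, complex) cblinfun"
      where \<psi>: "\<And>x. cmod (\<psi> x) \<le> norm x" "\<psi> (V y) = of_real (norm (V y))"
      using norming_functional[of "V y"] by blast
    have \<psi>1: "norm \<psi> \<le> 1" by (rule norm_cblinfun_bound) (simp_all add: \<psi>(1))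
    have "norm (V y) = cmod ((\<psi> o\<^sub>C V) y)" by (simp add: cblinfun_compose_apply \<psi>(2))
    also have "\<dots> \<le> norm (\<psi> o\<^sub>C V) * norm y" by (rule norm_cblinfun)
    also have "norm (\<psi> o\<^sub>C V) \<le> 1 / c * norm (V o\<^sub>C B)"
    proof -
      have "(\<psi> o\<^sub>C V) o\<^sub>C B = \<psi> o\<^sub>C (V o\<^sub>C B)" by (rule cblinfun_eqI) (simp add: cblinfun_compose_apply)
      then have "c * norm (\<psi> o\<^sub>C V) \<le> norm \<psi> * norm (V o\<^sub>C B)"
        using c(2)[of "\<psi> o\<^sub>C V"] norm_cblinfun_compose[of \<psi> "V o\<^sub>C B"] by simp
      also have "\<dots> \<le> 1 * norm (V o\<^sub>C B)" using \<psi>1 by (intro mult_right_mono) auto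
      finally show ?thesis using c(1) by (simp add: field_simps)
    qed
    finally show "norm (V y) \<le> 1 / c * norm (V o\<^sub>C B) * norm y" by (simp add: mult_right_mono)
  qed (use c(1) in simp)
  from rel_compact_seq_dominated[OF bounded_linear.linear[OF bounded_linear_cblinfun_compose_left]
      linear_ident this assms(2)]
  show ?thesis .
qed

text \<open>Let \<open>P\<close> be a finite-rank projection onto the null space of
  \<open>A\<close>. Composition with \<open>A\<close> controls the part
  \<open>U n - P o\<^sub>C U n\<close>, and \<open>P o\<^sub>C U n\<close> consists of finitely many
  functionals \<open>F b o\<^sub>C U n\<close>, to which the adjoint of \<open>B\<close>
  applies.\<close>

lemma rel_compact_seq_compose_both:
  fixes A :: "('x::cbanach, 'x) cblinfun" and B :: "('y::cbanach, 'y) cblinfun"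
    and U :: "nat \<Rightarrow> ('y, 'x) cblinfun"
  assumes A: "upper_semi_fredholm A" and B: "upper_semi_fredholm (banach_adjoint B)"
    and U: "Bseq U" "rel_compact_seq (\<lambda>n. A o\<^sub>C U n)" "rel_compact_seq (\<lambda>n. U n o\<^sub>C B)"
  shows "rel_compact_seq U"
proof -
  have "cdim (null_space A) < \<infinity>" using A by (simp add: upper_semi_fredholm_def nullity_def)
  then obtain J and F :: "'x \<Rightarrow> ('x, complex) cblinfun"
    where J: "finite J" "J \<subseteq> null_space A" "\<And>x. x \<in> null_space A \<Longrightarrow> x = (\<Sum>b\<in>J. F b x *\<^sub>C b)"
    using finite_dim_dual_basis by blast
  define P where "P = (\<Sum>b\<in>J. rank_one b (F b))"
  have P_apply: "P x = (\<Sum>b\<in>J. F b x *\<^sub>C b)" for x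
    by (simp add: P_def cblinfun_apply_sum rank_one_apply)
  obtain C where C: "0 < C" "\<And>x. \<exists>z\<in>null_space A. norm (x - z) \<le> C * norm (A x)"
    using upper_semi_fredholm_estimate[OF A] by blast
  have est: "norm (x - P x) \<le> (1 + norm P) * C * norm (A x)" for x
  proof -
    obtain z where z: "z \<in> null_space A" "norm (x - z) \<le> C * norm (A x)" using C(2) by blast
    have "P z = z" using J(3)[OF z(1)] by (simp add: P_apply)
    then have eq: "x - P x = (x - z) - P (x - z)" by (simp add: linear_diff[OF linear_cblinfun_apply])
    have "norm (x - P x) \<le> norm (x - z) + norm P * norm (x - z)"
      unfolding eq using norm_triangle_ineq4[of "x - z" "P (x - z)"] norm_cblinfun[of P "x - z"] by linarith
    also have "\<dots> = (1 + norm P) * norm (x - z)" by (simp add: distrib_right)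
    also have "\<dots> \<le> (1 + norm P) * (C * norm (A x))" using z(2) by (intro mult_left_mono) auto
    finally show ?thesis by (simp add: mult.assoc)
  qed
  have "norm (V - P o\<^sub>C V) \<le> ((1 + norm P) * C) * norm (A o\<^sub>C V)" for V :: "('y, 'x) cblinfun"
  proof (rule norm_cblinfun_bound)
    fix y
    have "norm (V y - P (V y)) \<le> (1 + norm P) * C * norm (A (V y))" by (rule est)
    also have "\<dots> \<le> (1 + norm P) * C * (norm (A o\<^sub>C V) * norm y)"
      using C(1) norm_cblinfun[of "A o\<^sub>C V" y]
      by (intro mult_left_mono) (auto simp: cblinfun_compose_apply)
    finally show "norm ((V - P o\<^sub>C V) y) \<le> ((1 + norm P) * C) * norm (A o\<^sub>C V) * norm y"
      by (simp add: cblinfun_apply_diff cblinfun_compose_apply mult.assoc)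
  qed (use C(1) in simp)
  from rel_compact_seq_dominated[OF bounded_linear.linear[OF bounded_linear_cblinfun_compose_right]
      bounded_linear.linear[OF bounded_linear_sub[OF bounded_linear_ident
          bounded_linear_cblinfun_compose_right]] this U(2)]
  have "rel_compact_seq (\<lambda>n. U n - P o\<^sub>C U n)" .
  moreover have "rel_compact_seq (\<lambda>n. P o\<^sub>C U n)"
  proof -
    have "rel_compact_seq (\<lambda>n. F b o\<^sub>C U n)" for b
    proof -
      have "Bseq (\<lambda>n. F b o\<^sub>C U n)"
        using bounded_linear_cblinfun_compose_right U(1) by (rule Bseq_bounded_linear)
      moreover have "banach_adjoint B (F b o\<^sub>C U n) = F b o\<^sub>C (U n o\<^sub>C B)" for n
        by (rule cblinfun_eqI) (simp add: banach_adjoint_apply cblinfun_compose_apply)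
      then have "rel_compact_seq (\<lambda>n. banach_adjoint B (F b o\<^sub>C U n))"
        using rel_compact_seq_bounded_linear[OF bounded_linear_cblinfun_compose_right U(3)] by simp
      ultimately show ?thesis
        using upper_semi_fredholm_proper[OF B] unfolding proper_on_bounded_def by blast
    qed
    then have "rel_compact_seq (\<lambda>n. \<Sum>b\<in>J. rank_one b (F b o\<^sub>C U n))"
      by (intro rel_compact_seq_sum rel_compact_seq_bounded_linear[OF bounded_linear_rank_one])
    moreover have "(\<Sum>b\<in>J. rank_one b (F b o\<^sub>C U n)) = P o\<^sub>C U n" for n
      by (rule cblinfun_eqI) (simp add: cblinfun_apply_sum rank_one_apply cblinfun_compose_apply P_apply)
    ultimately show ?thesis by simp
  qed
  ultimately show ?thesis using rel_compact_seq_add[of "\<lambda>n. U n - P o\<^sub>C U n" "\<lambda>n. P o\<^sub>C U n"] by simp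
qed

text \<open>The \<mu> found in the proof is not known beforehand, so \<open>fred\<close> covers all
  decompositions of \<zeta> within the two spectra; if \<mu> or \<nu> lies outside its spectrum, a
  lower bound takes over.\<close>

theorem closed_range_generalized_derivation:
  fixes A :: "('x::cbanach, 'x) cblinfun" and B :: "('y::cbanach, 'y) cblinfun" and \<zeta> :: complex
  defines "D \<equiv> shift (generalized_derivation A B) \<zeta>"
  assumes fin: "nullity D < \<infinity>"
    and fred: "\<And>\<mu> \<nu>. \<mu> \<in> approx_spectrum A \<Longrightarrow> \<nu> \<in> approx_spectrum (banach_adjoint B) \<Longrightarrow> \<mu> - \<nu> = \<zeta> \<Longrightarrow>
      upper_semi_fredholm (shift A \<mu>) \<and> upper_semi_fredholm (shift (banach_adjoint B) \<nu>)"
  shows "closed (range D)"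
proof -
  have "\<exists>C. \<forall>U. \<exists>Z. D Z = 0 \<and> norm (U - Z) \<le> C * norm (D U)"
  proof (rule ccontr)
    assume neg: "\<not> ?thesis"
    \<comment> \<open>Left multiplication by \<open>A\<close>, obtained as the derivation with
      second operator 0; it commutes with \<open>D\<close>.\<close>
    let ?L = "generalized_derivation A (0 :: ('y, 'y) cblinfun)"
    have L: "?L U = A o\<^sub>C U" for U
      by (rule cblinfun_eqI) (simp add: generalized_derivation_apply cblinfun_apply_diff
          cblinfun_compose_apply zero_cblinfun_apply linear_0[OF linear_cblinfun_apply])
    have comm: "?L (D U) = D (?L U)" for U
      by (rule cblinfun_eqI) (simp add: L D_def shift_apply generalized_derivation_apply
          cblinfun_apply_diff cblinfun_compose_apply scaleC_cblinfun_apply cblinfun_apply_scaleC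
          linear_diff[OF linear_cblinfun_apply] linear_0[OF linear_cblinfun_apply]
          zero_cblinfun_apply cvs.scale_right_diff_distrib)
    obtain \<mu> where \<mu>: "\<And>\<epsilon>. 0 < \<epsilon> \<Longrightarrow> \<exists>U. norm U \<le> 2 \<and> (\<forall>Z. D Z = 0 \<longrightarrow> 1 / 2 \<le> norm (U - Z)) \<and>
        norm (D U) \<le> \<epsilon> \<and> (\<exists>Z. D Z = 0 \<and> norm (?L U - \<mu> *\<^sub>C U - Z) \<le> \<epsilon>)"
      using joint_approximate_eigenvector[OF comm neg] by blast
    have "\<exists>p. norm (fst p) \<le> 2 \<and> (\<forall>Z. D Z = 0 \<longrightarrow> 1 / 2 \<le> norm (fst p - Z)) \<and>
        norm (D (fst p)) \<le> (1 / 2) ^ n \<and> D (snd p) = 0 \<and>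
        norm (?L (fst p) - \<mu> *\<^sub>C fst p - snd p) \<le> (1 / 2) ^ n" for n :: nat
    proof -
      obtain U Z where "norm U \<le> 2" "\<forall>Z. D Z = 0 \<longrightarrow> 1 / 2 \<le> norm (U - Z)"
        "norm (D U) \<le> (1 / 2) ^ n" "D Z = 0" "norm (?L U - \<mu> *\<^sub>C U - Z) \<le> (1 / 2) ^ n"
        using \<mu>[of "(1 / 2) ^ n"] by auto
      then show ?thesis by (intro exI[of _ "(U, Z)"]) simp
    qed
    then obtain p where p: "\<And>n. norm (fst (p n)) \<le> 2"
      "\<And>n Z. D Z = 0 \<Longrightarrow> 1 / 2 \<le> norm (fst (p n) - Z)"
      "\<And>n. norm (D (fst (p n))) \<le> (1 / 2) ^ n" "\<And>n. D (snd (p n)) = 0"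
      "\<And>n. norm (?L (fst (p n)) - \<mu> *\<^sub>C fst (p n) - snd (p n)) \<le> (1 / 2) ^ n"
      by metis
    define U Z where "U n = fst (p n)" and "Z n = snd (p n)" for n
    note U = p[folded U_def Z_def]
    \<comment> \<open>Chosen so that \<open>D V = ?A o\<^sub>C V - V o\<^sub>C ?B\<close>. As
      \<open>D (U n)\<close> tends to 0, relative compactness passes from one product to the
      other.\<close>
    define \<nu> where "\<nu> = \<mu> - \<zeta>"
    let ?A = "shift A \<mu>" and ?B = "shift B \<nu>"
    have null_seq: "f \<longlonglongrightarrow> 0" if "\<And>n. norm (f n) \<le> (1 / 2) ^ n" for f :: "nat \<Rightarrow> ('y, 'x) cblinfun"
      by (rule Lim_null_comparison[of _ "\<lambda>n. (1 / 2) ^ n"])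
        (use that in \<open>auto intro!: always_eventually LIMSEQ_power_zero\<close>)
    have AU: "?L V - \<mu> *\<^sub>C V = ?A o\<^sub>C V" for V
      by (rule cblinfun_eqI) (simp add: L cblinfun_apply_diff scaleC_cblinfun_apply
          cblinfun_compose_apply shift_apply)
    have DAB: "D V = ?A o\<^sub>C V - V o\<^sub>C ?B" for V
      using shift_generalized_derivation[of A B \<mu> \<nu>]
      by (simp add: D_def \<nu>_def generalized_derivation_apply)
    have D0: "(\<lambda>n. D (U n)) \<longlonglongrightarrow> 0" using U(3) by (rule null_seq)
    have Z0: "(\<lambda>n. ?A o\<^sub>C U n - Z n) \<longlonglongrightarrow> 0" using U(5) unfolding AU by (rule null_seq)
    have bU: "Bseq U" using U(1) by (rule BseqI')
    have "Bseq Z"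
    proof -
      have "Bseq (\<lambda>n. ?A o\<^sub>C U n)"
        using bounded_linear_cblinfun_compose_right bU by (rule Bseq_bounded_linear)
      moreover have "Bseq (\<lambda>n. ?A o\<^sub>C U n - Z n)" using Z0 convergentI convergent_imp_Bseq by blast
      ultimately obtain M N where "\<And>n. norm (?A o\<^sub>C U n) \<le> M" "\<And>n. norm (?A o\<^sub>C U n - Z n) \<le> N"
        unfolding Bseq_def by blast
      then have "norm (Z n) \<le> M + N" for n
        using norm_triangle_ineq4[of "?A o\<^sub>C U n" "?A o\<^sub>C U n - Z n"] by (smt (verit) diff_diff_eq2 add_diff_cancel_left')
      then show ?thesis by (rule BseqI')
    qed
    \<comment> \<open>Here the finite nullity of \<open>D\<close> makes up for the eigenvector
      relation holding only modulo null vectors.\<close>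
    then have "rel_compact_seq Z"
      using fin U(4) cdim_finite_rel_compact_seq[of "null_space D" Z]
      by (simp add: nullity_def null_space_def)
    from rel_compact_seq_add[OF convergent_imp_rel_compact_seq[OF Z0] this]
    have rA: "rel_compact_seq (\<lambda>n. ?A o\<^sub>C U n)" by simp
    from rel_compact_seq_diff[OF this convergent_imp_rel_compact_seq[OF D0]]
    have rB: "rel_compact_seq (\<lambda>n. U n o\<^sub>C ?B)" by (simp add: DAB)
    have "rel_compact_seq U"
    proof (cases "bounded_below ?A \<or> bounded_below (banach_adjoint ?B)")
      case True
      then show ?thesis using rel_compact_seq_compose_left rel_compact_seq_compose_right rA rB by blast
    next
      case False
      then have "upper_semi_fredholm ?A \<and> upper_semi_fredholm (shift (banach_adjoint B) \<nu>)"
        by (intro fred) (simp_all add: approx_spectrum_def shift_banach_adjoint \<nu>_def)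
      then show ?thesis
        using rel_compact_seq_compose_both[OF _ _ bU rA rB] by (simp add: shift_banach_adjoint)
    qed
    then obtain s l where s: "strict_mono s" "(\<lambda>n. U (s n)) \<longlonglongrightarrow> l" by (rule rel_compact_seqD)
    have "D l = 0"
      using bounded_linear.tendsto[OF bounded_linear_cblinfun_apply s(2), of D]
        LIMSEQ_subseq_LIMSEQ[OF D0 s(1)] by (auto simp: comp_def intro: LIMSEQ_unique)
    then have "1 / 2 \<le> norm (U (s n) - l)" for n by (rule U(2))
    moreover have "(\<lambda>n. norm (U (s n) - l)) \<longlonglongrightarrow> 0"
      using s(2) by (simp add: LIM_zero tendsto_norm_zero)
    ultimately have "(1 / 2 :: real) \<le> 0" by (intro LIMSEQ_le_const) auto
    then show False by simp
  qed
  then obtain C where "\<And>U. \<exists>Z. D Z = 0 \<and> norm (U - Z) \<le> C * norm (D U)" by blast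
  then show ?thesis by (rule closed_range_if_estimate[OF bounded_linear_cblinfun_apply])
qed

section \<open>Finite isolated eigenvalues of generalized derivations\<close>

lemma cdim_pos_iff:
  assumes "cvs.subspace S"
  shows "0 < cdim S \<longleftrightarrow> (\<exists>x\<in>S. x \<noteq> 0)"
proof
  assume pos: "0 < cdim S"
  show "\<exists>x\<in>S. x \<noteq> 0"
  proof (rule ccontr)
    assume "\<not> ?thesis"
    then have S: "S = cvs.span {}" using cvs.subspace_0[OF assms] by auto
    have "\<exists>B. finite B \<and> cvs.span B = S" using S by blast
    then have "cdim S = enat (cvs.dim S)" by (simp add: cdim_def)
    moreover have "cvs.dim S = 0" unfolding S cvs.dim_span
      using cvs.dim_eq_card_independent[OF cvs.independent_empty] by simp
    ultimately show False using pos by (simp add: zero_enat_def)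
  qed
next
  assume "\<exists>x\<in>S. x \<noteq> 0"
  then obtain x where x: "x \<in> S" "x \<noteq> 0" by blast
  show "0 < cdim S"
  proof (rule ccontr)
    assume "\<not> ?thesis"
    then have 0: "cdim S = 0" by simp
    then have "cdim S < \<infinity>" by simp
    then obtain B where B: "finite B" "cvs.span B = S" by (rule cdim_finiteE)
    then have "\<exists>B. finite B \<and> cvs.span B = S" by blast
    then have d: "cvs.dim S = 0" using 0 by (simp add: cdim_def zero_enat_def)
    obtain C where C: "C \<subseteq> S" "cvs.independent C" "S \<subseteq> cvs.span C" "card C = cvs.dim S"
      by (rule cvs.basis_exists)
    have "finite C" using cvs.independent_span_bound[OF B(1) C(2)] C(1) B(2) by simp
    then have "C = {}" using C(4) d by simp
    then show False using C(3) x by auto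
  qed
qed

lemma cdim_finite_image:
  assumes N: "cdim N < \<infinity>" and S: "cvs.subspace S" "S \<subseteq> f ` N"
    and f: "\<And>x y. f (x + y) = f x + f y" "\<And>c x. f (c *\<^sub>C x) = c *\<^sub>C f x"
  shows "cdim S < \<infinity>"
proof -
  obtain B where B: "finite B" "cvs.span B = N" by (rule cdim_finiteE[OF N])
  have "f x \<in> cvs.span (f ` B)" if "x \<in> cvs.span B" for x
    using that
  proof (induction rule: cvs.span_induct_alt)
    case base
    have "f 0 = 0" using f(2)[of 0 0] by simp
    then show ?case by (simp add: cvs.span_zero)
  next
    case (step c b x)
    then show ?case by (simp add: f cvs.span_add cvs.span_scale cvs.span_base)
  qed
  then have "S \<subseteq> cvs.span (f ` B)" using S(2) B(2) by blast
  then show ?thesis using cdim_subset_span_finite[OF S(1)] B(1) by blast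
qed

lemma nullity_pos_iff: "0 < nullity T \<longleftrightarrow> (\<exists>x. T x = 0 \<and> x \<noteq> 0)"
  unfolding nullity_def using cdim_pos_iff[OF csubspace_null_space[of T]] by (auto simp: null_space_def)

text \<open>With a nonzero null vector fixed on one side, rank-one operators embed the other null
  space into that of the derivation. Evaluation at \<open>y\<close>, respectively composition with
  \<psi>, recovers the vector up to a scalar.\<close>

lemma nullity_generalized_derivation:
  fixes A :: "('x::complex_normed_vector, 'x) cblinfun" and B :: "('y::complex_normed_vector, 'y) cblinfun"
  assumes fin: "nullity (generalized_derivation A B) < \<infinity>"
    and pos: "0 < nullity A" "0 < nullity (banach_adjoint B)"
  shows "nullity A < \<infinity>" "nullity (banach_adjoint B) < \<infinity>"
proof -
  obtain x0 where x0: "A x0 = 0" "x0 \<noteq> 0" using pos(1) nullity_pos_iff by blast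
  obtain \<phi>0 where \<phi>0: "banach_adjoint B \<phi>0 = 0" "\<phi>0 \<noteq> 0" using pos(2) nullity_pos_iff by blast
  let ?N = "null_space (generalized_derivation A B)"
  have fin': "cdim ?N < \<infinity>" using fin by (simp add: nullity_def)
  have null: "rank_one x \<phi> \<in> ?N" if "A x = 0" "banach_adjoint B \<phi> = 0" for x \<phi>
  proof -
    have "rank_one 0 \<phi> = 0" "rank_one x (0 :: ('y, complex) cblinfun) = 0"
      by (simp_all flip: norm_eq_zero add: norm_rank_one)
    then show ?thesis using that by (simp add: null_space_def generalized_derivation_rank_one)
  qed
  obtain y where y: "\<phi>0 y \<noteq> 0" using \<phi>0(2) cblinfun_eqI[of \<phi>0 0] zero_cblinfun_apply by metis
  have sub: "null_space A \<subseteq> (\<lambda>U. inverse (\<phi>0 y) *\<^sub>C cblinfun_apply U y) ` ?N"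
  proof
    fix x assume "x \<in> null_space A"
    then have "rank_one x \<phi>0 \<in> ?N" using null \<phi>0(1) by (simp add: null_space_def)
    moreover have "x = inverse (\<phi>0 y) *\<^sub>C cblinfun_apply (rank_one x \<phi>0) y"
      using y by (simp add: rank_one_apply)
    ultimately show "x \<in> (\<lambda>U. inverse (\<phi>0 y) *\<^sub>C cblinfun_apply U y) ` ?N" by (rule rev_image_eqI)
  qed
  show "nullity A < \<infinity>"
    unfolding nullity_def
    by (rule cdim_finite_image[OF fin' csubspace_null_space sub])
      (simp_all add: cblinfun_apply_add scaleC_cblinfun_apply scaleC_add_right mult.commute)
  obtain \<psi> :: "('x, complex) cblinfun" where \<psi>: "\<psi> x0 = of_real (norm x0)"
    using norming_functional[of x0] by blast
  have \<psi>0: "\<psi> x0 \<noteq> 0" using x0(2) \<psi> by simp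
  have sub: "null_space (banach_adjoint B) \<subseteq> (\<lambda>U. inverse (\<psi> x0) *\<^sub>C (\<psi> o\<^sub>C U)) ` ?N"
  proof
    fix \<phi> assume "\<phi> \<in> null_space (banach_adjoint B)"
    then have "rank_one x0 \<phi> \<in> ?N" using null x0(1) by (simp add: null_space_def)
    moreover have "\<phi> = inverse (\<psi> x0) *\<^sub>C (\<psi> o\<^sub>C rank_one x0 \<phi>)"
      using \<psi>0 by (intro cblinfun_eqI)
        (simp add: rank_one_apply cblinfun_compose_apply scaleC_cblinfun_apply cblinfun_apply_scaleC
          scaleC_complex_def)
    ultimately show "\<phi> \<in> (\<lambda>U. inverse (\<psi> x0) *\<^sub>C (\<psi> o\<^sub>C U)) ` ?N" by (rule rev_image_eqI)
  qed
  show "nullity (banach_adjoint B) < \<infinity>"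
    unfolding nullity_def
  proof (rule cdim_finite_image[OF fin' csubspace_null_space sub])
    show "inverse (\<psi> x0) *\<^sub>C (\<psi> o\<^sub>C (U + V))
        = inverse (\<psi> x0) *\<^sub>C (\<psi> o\<^sub>C U) + inverse (\<psi> x0) *\<^sub>C (\<psi> o\<^sub>C V)" for U V
      by (simp add: linear_add[OF bounded_linear.linear[OF bounded_linear_cblinfun_compose_right]]
          scaleC_add_right)
  qed (simp add: cblinfun_compose_scaleC_right mult.commute)
qed

section \<open>Left poles and isolated eigenvalues of finite multiplicity\<close>

lemma iso_subset: "iso K \<subseteq> K"
  by (auto simp: iso_def isolated_in_def)

lemma a_weyl_upper_semi_fredholm:
  assumes "a_weyl T" "\<mu> \<in> iso_approx_eigenvalues T" "nullity (shift T \<mu>) < \<infinity>"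
  shows "upper_semi_fredholm (shift T \<mu>)"
proof -
  have "\<mu> \<in> approx_spectrum T"
    using assms(2) iso_subset unfolding iso_approx_eigenvalues_def by blast
  moreover have "\<mu> \<notin> weyl_approx_spectrum T"
    using assms unfolding a_weyl_def iso_approx_eigenvalues_finite_def by simp
  ultimately show ?thesis by (simp add: weyl_approx_spectrum_def)
qed

text \<open>An injective shift has ascent 0; the range condition then makes it bounded below, which
  is impossible on the approximate spectrum.\<close>

lemma left_poles_finite_subset:
  "left_poles_finite T \<subseteq> iso_approx_eigenvalues_finite T"
proof
  fix \<mu> assume \<mu>: "\<mu> \<in> left_poles_finite T"
  let ?T = "shift T \<mu>"
  from \<mu> have iso: "\<mu> \<in> iso (approx_spectrum T)" and fin: "nullity ?T < \<infinity>"
    by (simp_all add: left_poles_finite_def left_poles_def)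
  obtain a where a: "ascent ?T = enat a" "closed (range (cblinfun_apply ?T ^^ (a + 1)))"
    using \<mu> unfolding left_poles_finite_def left_poles_def by blast
  have "0 < nullity ?T"
  proof (rule ccontr)
    assume "\<not> ?thesis"
    then have N: "null_space ?T = {0}"
      using nullity_pos_iff[of ?T] by (auto simp: null_space_def linear_0[OF linear_cblinfun_apply])
    then have 0: "null_space (cblinfun_apply ?T ^^ 0) = null_space (cblinfun_apply ?T ^^ (0 + 1))"
      by (simp add: null_space_def)
    then have ex: "\<exists>a. null_space (cblinfun_apply ?T ^^ a) = null_space (cblinfun_apply ?T ^^ (a + 1))" by blast
    have "(LEAST a. null_space (cblinfun_apply ?T ^^ a) = null_space (cblinfun_apply ?T ^^ (a + 1))) = 0"
      using 0 by (rule Least_eq_0)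
    \<comment> \<open>The closed range in \<open>a(2)\<close> is thus that of the first
      power.\<close>
    then have "a = 0" using a(1) ex unfolding ascent_def by simp
    then have "bounded_below ?T" using a(2) N by (simp add: bounded_below_def)
    then show False using iso iso_subset by (auto simp: approx_spectrum_def)
  qed
  then show "\<mu> \<in> iso_approx_eigenvalues_finite T"
    using iso fin by (simp add: iso_approx_eigenvalues_finite_def iso_approx_eigenvalues_def)
qed

text \<open>Isolation makes all nearby shifts injective, as \<open>finite_ascent\<close> demands;
  closedness of the ranges of powers comes from semi-Fredholmness.\<close>

lemma iso_upper_semi_fredholm_left_pole:
  fixes T :: "('a::cbanach, 'a) cblinfun"
  assumes iso: "\<mu> \<in> iso (approx_spectrum T)" and usf: "upper_semi_fredholm (shift T \<mu>)"
  shows "\<mu> \<in> left_poles_finite T"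
proof -
  obtain W where W: "open W" "W \<inter> approx_spectrum T = {\<mu>}"
    using iso by (auto simp: iso_def isolated_in_def)
  then obtain r where r: "0 < r" "ball \<mu> r \<subseteq> W" by (metis Int_iff insertI1 openE)
  have inj: "null_space (shift (shift T \<mu>) \<nu>) = {0}" if \<nu>: "0 < cmod \<nu>" "cmod \<nu> < r" for \<nu>
  proof -
    have "\<mu> + \<nu> \<in> W" using r(2) \<nu>(2) by (auto simp: dist_norm subset_eq)
    moreover have "\<mu> + \<nu> \<noteq> \<mu>" using \<nu>(1) by auto
    ultimately have "\<mu> + \<nu> \<notin> approx_spectrum T" using W(2) by blast
    then show ?thesis by (simp add: approx_spectrum_def bounded_below_def shift_shift)
  qed
  have "\<exists>a. null_space (cblinfun_apply (shift T \<mu>) ^^ a)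
      = null_space (cblinfun_apply (shift T \<mu>) ^^ (a + 1))"
    by (rule finite_ascent[OF usf r(1) inj])
  then obtain a where "ascent (shift T \<mu>) = enat a" unfolding ascent_def by auto
  then show ?thesis
    using iso usf upper_semi_fredholm_closed_range_pow[OF usf, of "a + 1"]
    by (simp add: left_poles_finite_def left_poles_def upper_semi_fredholm_def)
qed

theorem iso_approx_eigenvalues_finite_generalized_derivation:
  fixes A :: "('x::cbanach, 'x) cblinfun" and B :: "('y::cbanach, 'y) cblinfun"
  assumes "a_isoloid A" "a_isoloid (banach_adjoint B)" "a_weyl A" "a_weyl (banach_adjoint B)"
  shows "iso_approx_eigenvalues_finite (generalized_derivation A B)
    \<subseteq> left_poles_finite (generalized_derivation A B)"
proof
  let ?\<rho> = "generalized_derivation A B"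
  fix \<zeta> assume "\<zeta> \<in> iso_approx_eigenvalues_finite ?\<rho>"
  then have iso: "\<zeta> \<in> iso (approx_spectrum ?\<rho>)" and fin: "nullity (shift ?\<rho> \<zeta>) < \<infinity>"
    by (simp_all add: iso_approx_eigenvalues_finite_def iso_approx_eigenvalues_def)
  have "closed (range (shift ?\<rho> \<zeta>))"
  proof (rule closed_range_generalized_derivation[OF fin])
    fix \<mu> \<nu>
    assume mem: "\<mu> \<in> approx_spectrum A" "\<nu> \<in> approx_spectrum (banach_adjoint B)" and eq: "\<mu> - \<nu> = \<zeta>"
    \<comment> \<open>Being \<open>a_isoloid\<close> turns isolated points into eigenvalues; the
      rank-one argument for finite multiplicity needs null vectors on both sides.\<close>
    have "\<mu> \<in> iso_approx_eigenvalues A" "\<nu> \<in> iso_approx_eigenvalues (banach_adjoint B)"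
      using iso_approx_spectrum_generalized_derivation[OF _ mem] iso eq assms(1,2)
      by (simp_all add: a_isoloid_def)
    moreover from this have "0 < nullity (shift A \<mu>)" "0 < nullity (banach_adjoint (shift B \<nu>))"
      by (simp_all add: iso_approx_eigenvalues_def shift_banach_adjoint)
    then have "nullity (shift A \<mu>) < \<infinity>" "nullity (shift (banach_adjoint B) \<nu>) < \<infinity>"
      using nullity_generalized_derivation[of "shift A \<mu>" "shift B \<nu>"] fin
      unfolding eq[symmetric] shift_generalized_derivation shift_banach_adjoint by simp_all
    ultimately show "upper_semi_fredholm (shift A \<mu>) \<and> upper_semi_fredholm (shift (banach_adjoint B) \<nu>)"
      using a_weyl_upper_semi_fredholm[OF assms(3)] a_weyl_upper_semi_fredholm[OF assms(4)] by simp
  qed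
  then have "upper_semi_fredholm (shift ?\<rho> \<zeta>)" using fin by (simp add: upper_semi_fredholm_def)
  then show "\<zeta> \<in> left_poles_finite ?\<rho>" by (rule iso_upper_semi_fredholm_left_pole[OF iso])
qed

theorem theorem5p5:
  fixes A :: "('x::cbanach, 'x) cblinfun"
    and B :: "('y::cbanach, 'y) cblinfun"
  assumes "cdim (UNIV :: 'x set) = \<infinity>"
    and "cdim (UNIV :: 'y set) = \<infinity>"
    and "a_isoloid A"
    and "a_isoloid (banach_adjoint B)"
    and "a_weyl A"
    and "a_weyl (banach_adjoint B)"
  shows "a_weyl (generalized_derivation A B) \<longleftrightarrow> a_browder (generalized_derivation A B)"
proof -
  have "iso_approx_eigenvalues_finite (generalized_derivation A B)
      = left_poles_finite (generalized_derivation A B)"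
    using iso_approx_eigenvalues_finite_generalized_derivation[OF assms(3-6)]
      left_poles_finite_subset by (rule subset_antisym)
  then show ?thesis by (simp add: a_weyl_def a_browder_def)
qed

end
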